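(* Let $F:\mathbb{R}^n\to\mathbb{R}^n$ be continuously differentiable, $G:\mathbb{R}^n\to\mathbb{R}^s$ twice continuously differentiable, and $D\subseteq\mathbb{R}^s$ a convex polyhedral set. Suppose that $\bar x$ solves the generalized equation $0\in F(x)+\nabla G(x)N_D(G(x))$ and that $(\bar x,G(\bar x))$ is nondegenerate with some modulus $\tilde\gamma>0$. Suppose further that, with $\bar\lambda$ the unique multiplier at $\bar x$, for any face $\mathcal F$ of the critical cone $\mathcal K_D(G(\bar x),\bar\lambda)$ there is a matrix $Z_{\mathcal F}$, whose columns form an orthogonal basis of $\{u\mid G'(\bar x)u\in\operatorname{span}\mathcal F\}$, such that the matrix $Z_{\mathcal F}^\top\mathcal L'_{\bar\lambda}(\bar x)Z_{\mathcal F}$ is nonsingular. Then Algorithm A (the implementable semismooth* Newton method for the generalized equation) is an instance of the general G-semismooth Newton method (in the form of Algorithm B, which is that method for the nonsmooth equation $S(x)=0$ with the set-valued mapping $\mathcal T_S$), in the sense that the local superlinear convergence of Algorithm A can be obtained from the convergence theorem for the general G-semismooth Newton method. All of these algorithms, and that convergence theorem, are described in the context.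
   Context: Notation. $G'(x)$ is the Jacobian and $\nabla G(x)$ its adjoint; $N_D$ and $T_D$ are the normal and tangent cones of convex analysis; $\operatorname{lin}$ of a convex cone is its lineality space (the largest linear subspace contained in it); $\operatorname{span}$ is the smallest linear subspace containing a set. $\mathcal L_\lambda(x):=F(x)+\nabla G(x)\lambda$, and $\mathcal L_\lambda'(x)$ is its derivative in $x$ with $\lambda$ fixed. For $d\in D$ and $\lambda\in N_D(d)$, $\mathcal K_D(d,\lambda):=T_D(d)\cap\{\lambda\}^\perp$ is the critical cone. Faces of a polyhedral cone $K$ are the sets $K\cap\{\nu\}^\perp$ with $\nu$ in the polar cone $K^\circ$. $\mathbb B_\omega(\bar x)$ is the closed ball of radius $\omega$ centered at $\bar x$. $\operatorname{dist}$ is the distance from a point to a set. Nondegeneracy. $(x,d)$ is nondegenerate with modulus $\gamma>0$ if $\|\nabla G(x)\lambda\|\ge\gamma\|\lambda\|$ for all $\lambda\in\operatorname{span}N_D(d)$. When $\bar x$ is a solution and $(\bar x,G(\bar x))$ is nondegenerate, there is a unique $\bar\lambda\in N_D(G(\bar x))$ with $\mathcal L_{\bar\lambda}(\bar x)=0$ (the multiplier at $\bar x$). Approximation step at $x$. Compute $$\hat u=\arg\min_{u\in\mathbb{R}^n}\Big\{\tfrac12\|u\|^2+\langle F(x),u\rangle\ \Big|\ G(x)+G'(x)u\in D\Big\}$$ together with a multiplier $\hat\lambda\in N_D(G(x)+G'(x)\hat u)$ satisfying $\hat u+F(x)+\nabla G(x)\hat\lambda=0$, and set $\hat d:=G(x)+G'(x)\hat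 u$. Under the nondegeneracy assumption at $(\bar x,G(\bar x))$ there is a radius $\omega>0$ (and constants $\beta,\beta_u,\beta_\lambda>0$) such that for all $x\in\mathbb B_\omega(\bar x)$ this quadratic program has a unique solution $\hat u$; $\|\hat u\|\le\beta_u\|x-\bar x\|$; $\|((x;\hat d);(\mathcal L_{\hat\lambda}(x);G(x)-\hat d))-((\bar x;G(\bar x));(0;0))\|\le\beta\|x-\bar x\|$; $\|\hat\lambda-\bar\lambda\|\le\beta_\lambda\|x-\bar x\|$; $(x,\hat d)$ is nondegenerate with modulus $\tilde\gamma/2$; and $N_D(\hat d)\subseteq N_D(G(\bar x))$. For $x\in\mathbb B_\omega(\bar x)$ write $S(x):=\hat u$ and $\Lambda(x):=\hat\lambda$ (both single-valued); thus $S(x)$ is the unique $u$ with $0\in u+F(x)+\nabla G(x)N_D(G(x)+G'(x)u)$. On $\mathbb B_\omega(\bar x)$, $S(x)=0$ if and only if $x$ solves the generalized equation. Algorithm A (input $x^{(0)}$). For $k=0,1,\dots$: (1) if $x^{(k)}$ solves the generalized equation, stop; (2) run the approximation step at $x^{(k)}$ to compute $\hat\lambda^{(k)},\hat d^{(k)}$ and $\mathcal L_{\hat\lambda^{(k)}}(x^{(k)})$; (3) set $\hat l^{(k)}=\dim(\operatorname{lin}T_D(\hat d^{(k)}))$, compute an $s\times(s-\hat l^{(k)})$ matrix $\hat W^{(k)}$ whose columns form a basis of $\operatorname{span}N_D(\hat d^{(k)})$ and then an $n\times(n-(s-\hat l^{(k)}))$ matrix $\hat Z^{(k)}$ whose columns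 are an orthogonal basis of $\ker(\hat W^{(k)\top}G'(x^{(k)}))$; (4) set $x^{(k+1)}=x^{(k)}+\Delta x^{(k)}$ where $\Delta x^{(k)}$ is a solution of $$\hat Z^{(k)\top}\big(\mathcal L'_{\hat\lambda^{(k)}}(x^{(k)})\Delta x^{(k)}+\mathcal L_{\hat\lambda^{(k)}}(x^{(k)})\big)=0,\qquad \hat W^{(k)\top}\big(G(x^{(k)})+G'(x^{(k)})\Delta x^{(k)}-\hat d^{(k)}\big)=0.$$ Local superlinear convergence of Algorithm A means: there is a neighborhood $U$ of $\bar x$ such that for every $x^{(0)}\in U$, Algorithm A either stops after finitely many iterations at a solution of the generalized equation or produces a sequence converging superlinearly to $\bar x$. The set-valued mapping $\mathcal T_S$. For $x\in\mathbb B_\omega(\bar x)$, with $u=S(x)$, $d=G(x)+G'(x)u$, $\lambda=\Lambda(x)$, let $\mathcal T_S(x)$ be the set of all matrices $$-\mathcal L_\lambda'(x)+\nabla G(x)W\big[W^\top G'(x)\nabla G(x)W\big]^{-1}W^\top\big(G'(x)\mathcal L_\lambda'(x)-[G(x)+G'(x)u]'_x\big)$$ where $W$ has full column rank and $\operatorname{range}W=(\operatorname{span}\mathcal F)^\perp$ for some face $\mathcal F$ of $\mathcal K_D(d,\lambda)$; here $[\cdot]'_x$ is the derivative in $x$ with $u$ fixed. Algorithm B (input $x^{(0)}$ and $\varrho\ge0$). For $k=0,1,\dots$: (1) if $x^{(k)}$ solves the generalized equation, stop; (2) run the approximation step at $x^{(k)}$ to compute $\hat u^{(k)}$ (which is $S(x^{(k)})$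 for $x^{(k)}\in\mathbb B_\omega(\bar x)$), $\hat\lambda^{(k)}$, $\hat d^{(k)}$ and $\mathcal L_{\hat\lambda^{(k)}}(x^{(k)})$; (3) compute $V^{(k)}$ with $\operatorname{dist}(V^{(k)},\mathcal T_S(x^{(k)}))\le\varrho\|\hat u^{(k)}\|$; (4) compute $\Delta x^{(k)}$ satisfying $V^{(k)}\Delta x^{(k)}+\hat u^{(k)}=0$ and set $x^{(k+1)}:=x^{(k)}+\Delta x^{(k)}$. General G-semismooth Newton method. Let $\mathcal X$ be a finite-dimensional real Hilbert space, $\mathbb L(\mathcal X)$ the space of linear operators on $\mathcal X$, $\Omega\subseteq\mathcal X$ open, $H:\Omega\to\mathcal X$, $\mathcal T$ a set-valued mapping with values in subsets of $\mathbb L(\mathcal X)$, and $\varrho\ge0$. From $x^{(0)}$, for $k=0,1,\dots$: (1) if $H(x^{(k)})=0$, stop; (2) select $V_k\in\mathbb L(\mathcal X)$ with $\operatorname{dist}(V_k,\mathcal T(x^{(k)}))\le\varrho\|H(x^{(k)})\|$, compute $\Delta x^{(k)}$ by solving $V_k\Delta x=-H(x^{(k)})$, and set $x^{(k+1)}:=x^{(k)}+\Delta x^{(k)}$. Definitions. A continuous $H$ is G-semismooth at $x$ with respect to $\mathcal T$ if $H(x+h)-H(x)-Vh=o(\|h\|)$ for any $h\to0$ and $V\in\mathcal T(x+h)$. $\mathcal T$ is outer semicontinuous at $x$ if for any $\varepsilon>0$ there is $\delta>0$ such that $\mathcal T(x')\subseteq\mathcal T(x)+\varepsilon\mathbb B$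 whenever $\|x'-x\|\le\delta$, with $\mathbb B$ the unit ball of $\mathbb L(\mathcal X)$. Convergence theorem for the general G-semismooth Newton method. Suppose that $H$ is locally Lipschitz continuous and G-semismooth with respect to $\mathcal T:\Omega\rightrightarrows\mathbb L(\mathcal X)$ at $\bar x$ with $H(\bar x)=0$, that $\mathcal T$ is compact valued and outer semicontinuous at $\bar x$, and that $V^{-1}$ exists for all $V\in\mathcal T(\bar x)$. Then there is a neighborhood of $\bar x$ such that, for any $x^{(0)}$ in it, the method either terminates in finitely many steps or generates an infinite sequence satisfying $\|x^{(k+1)}-\bar x\|=o(\|x^{(k)}-\bar x\|)$ as $k\to\infty$. *)

theory Defs
  imports
    "HOL-Analysis.Analysis"
    "HOL-Library.Landau_Symbols"
    "Jordan_Normal_Form.Matrix"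
begin

section \<open>Smoothness\<close>

definition cont_diff :: "('a::real_normed_vector \<Rightarrow> 'b::real_normed_vector) \<Rightarrow> bool" where
  "cont_diff f \<longleftrightarrow> (\<exists>f' :: 'a \<Rightarrow> 'a \<Rightarrow>\<^sub>L 'b.
     (\<forall>x. (f has_derivative blinfun_apply (f' x)) (at x)) \<and> continuous_on UNIV f')"

definition twice_cont_diff :: "('a::real_normed_vector \<Rightarrow> 'b::real_normed_vector) \<Rightarrow> bool" where
  "twice_cont_diff f \<longleftrightarrow> (\<exists>f' :: 'a \<Rightarrow> 'a \<Rightarrow>\<^sub>L 'b.
     (\<forall>x. (f has_derivative blinfun_apply (f' x)) (at x)) \<and> cont_diff f')"

definition Jac :: "(real^'n \<Rightarrow> real^'s) \<Rightarrow> real^'n \<Rightarrow> real^'n^'s" where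
  "Jac G x = jacobian G (at x)"

definition grad :: "(real^'n \<Rightarrow> real^'s) \<Rightarrow> real^'n \<Rightarrow> real^'s^'n" where
  "grad G x = Finite_Cartesian_Product.transpose (Jac G x)"


section \<open>Normal and tangent cones, faces\<close>

text \<open>Both cones are empty at points outside the set, as usual in variational analysis; in
  particular a solution of the generalized equation satisfies \<open>G x \<in> D\<close>.\<close>

definition normal_cone :: "'a::real_inner set \<Rightarrow> 'a \<Rightarrow> 'a set" where
  "normal_cone D d = (if d \<in> D then {l. \<forall>y\<in>D. inner l (y - d) \<le> 0} else {})"

definition tangent_cone :: "'a::real_inner set \<Rightarrow> 'a \<Rightarrow> 'a set" where
  "tangent_cone D d = (if d \<in> D then closure (cone hull ((\<lambda>y. y - d) ` D)) else {})"

definition lin :: "'a::real_vector set \<Rightarrow> 'a set" where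
  "lin K = (GREATEST L. subspace L \<and> L \<subseteq> K)"

definition polar_cone :: "'a::real_inner set \<Rightarrow> 'a set" where
  "polar_cone K = {\<nu>. \<forall>v\<in>K. inner \<nu> v \<le> 0}"

definition critical_cone :: "(real^'s) set \<Rightarrow> real^'s \<Rightarrow> real^'s \<Rightarrow> (real^'s) set" where
  "critical_cone D d l = tangent_cone D d \<inter> orthogonal_comp {l}"

definition cone_face :: "(real^'s) set \<Rightarrow> (real^'s) set \<Rightarrow> bool" where
  "cone_face K E \<longleftrightarrow> (\<exists>\<nu>\<in>polar_cone K. E = K \<inter> orthogonal_comp {\<nu>})"


section \<open>Matrices with a variable number of columns\<close>

text \<open>A matrix with columns \<open>w\<^sub>0, \<dots>, w\<^sub>m\<^sub>-\<^sub>1\<close>, where \<open>m\<close> depends on the data and may be zero, is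
  represented by the list \<open>W\<close> of its columns; its range is \<open>span (set W)\<close>, and \<open>W\<^sup>T v = 0\<close> reads
  \<open>\<forall>w\<in>set W. inner w v = 0\<close>. The resulting square matrices of order \<open>m\<close> are of type
  \<open>real mat\<close>; the one of order zero is invertible.\<close>

definition full_col_rank :: "(real^'k) list \<Rightarrow> bool" where
  "full_col_rank W \<longleftrightarrow> distinct W \<and> independent (set W)"

definition cols_basis :: "(real^'k) list \<Rightarrow> (real^'k) set \<Rightarrow> bool" where
  "cols_basis W V \<longleftrightarrow> full_col_rank W \<and> span (set W) = V"

definition cols_orth_basis :: "(real^'k) list \<Rightarrow> (real^'k) set \<Rightarrow> bool" where
  "cols_orth_basis W V \<longleftrightarrow> cols_basis W V \<and> pairwise Linear_Algebra.orthogonal (set W)"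

text \<open>\<open>W\<^sup>T A W\<close>\<close>

definition compress :: "(real^'k) list \<Rightarrow> real^'k^'k \<Rightarrow> real Matrix.mat" where
  "compress W A = Matrix.mat (length W) (length W) (\<lambda>(i, j). inner (W ! i) (A *v (W ! j)))"

text \<open>\<open>W B W\<^sup>T\<close>\<close>

definition expand :: "(real^'k) list \<Rightarrow> real Matrix.mat \<Rightarrow> real^'k^'k" where
  "expand W B = (\<chi> a b. \<Sum>i<length W. \<Sum>j<length W.
      vec_nth (W ! i) a * index_mat B (i, j) * vec_nth (W ! j) b)"

definition inverse_mat_of :: "real Matrix.mat \<Rightarrow> real Matrix.mat \<Rightarrow> bool" where
  "inverse_mat_of A B \<longleftrightarrow> inverts_mat A B \<and> inverts_mat B A"


section \<open>The generalized equation\<close>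

definition solves_ge ::
  "(real^'n \<Rightarrow> real^'n) \<Rightarrow> (real^'n \<Rightarrow> real^'s) \<Rightarrow> (real^'s) set \<Rightarrow> real^'n \<Rightarrow> bool" where
  "solves_ge F G D x \<longleftrightarrow> 0 \<in> (\<lambda>l. F x + grad G x *v l) ` normal_cone D (G x)"

definition nondegenerate ::
  "(real^'n \<Rightarrow> real^'s) \<Rightarrow> (real^'s) set \<Rightarrow> real \<Rightarrow> real^'n \<Rightarrow> real^'s \<Rightarrow> bool" where
  "nondegenerate G D \<gamma> x d \<longleftrightarrow>
     \<gamma> > 0 \<and> (\<forall>l\<in>span (normal_cone D d). norm (grad G x *v l) \<ge> \<gamma> * norm l)"

definition Lag ::
  "(real^'n \<Rightarrow> real^'n) \<Rightarrow> (real^'n \<Rightarrow> real^'s) \<Rightarrow> real^'s \<Rightarrow> real^'n \<Rightarrow> real^'n" where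
  "Lag F G l x = F x + grad G x *v l"

definition dLag ::
  "(real^'n \<Rightarrow> real^'n) \<Rightarrow> (real^'n \<Rightarrow> real^'s) \<Rightarrow> real^'s \<Rightarrow> real^'n \<Rightarrow> real^'n^'n" where
  "dLag F G l x = Jac (Lag F G l) x"


section \<open>Approximation step\<close>

definition lin_G :: "(real^'n \<Rightarrow> real^'s) \<Rightarrow> real^'n \<Rightarrow> real^'n \<Rightarrow> real^'s" where
  "lin_G G u x = G x + Jac G x *v u"

definition qp_solution ::
  "(real^'n \<Rightarrow> real^'n) \<Rightarrow> (real^'n \<Rightarrow> real^'s) \<Rightarrow> (real^'s) set \<Rightarrow> real^'n \<Rightarrow> real^'n \<Rightarrow> bool" where
  "qp_solution F G D x u \<longleftrightarrow>
     is_arg_min (\<lambda>u. (norm u)\<^sup>2 / 2 + inner (F x) u) (\<lambda>u. lin_G G u x \<in> D) u"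

definition qp_multiplier ::
  "(real^'n \<Rightarrow> real^'n) \<Rightarrow> (real^'n \<Rightarrow> real^'s) \<Rightarrow> (real^'s) set \<Rightarrow> real^'n \<Rightarrow> real^'n \<Rightarrow> real^'s \<Rightarrow> bool"
  where
  "qp_multiplier F G D x u l \<longleftrightarrow>
     l \<in> normal_cone D (lin_G G u x) \<and> u + F x + grad G x *v l = 0"

definition approx_step ::
  "(real^'n \<Rightarrow> real^'n) \<Rightarrow> (real^'n \<Rightarrow> real^'s) \<Rightarrow> (real^'s) set \<Rightarrow> real^'n \<Rightarrow> real^'n \<Rightarrow> real^'s \<Rightarrow> bool"
  where
  "approx_step F G D x u l \<longleftrightarrow> qp_solution F G D x u \<and> qp_multiplier F G D x u l"

text \<open>The following two maps are meaningful only where solution and multiplier are unique.\<close>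

definition S_map ::
  "(real^'n \<Rightarrow> real^'n) \<Rightarrow> (real^'n \<Rightarrow> real^'s) \<Rightarrow> (real^'s) set \<Rightarrow> real^'n \<Rightarrow> real^'n" where
  "S_map F G D x = (THE u. qp_solution F G D x u)"

definition Lambda_map ::
  "(real^'n \<Rightarrow> real^'n) \<Rightarrow> (real^'n \<Rightarrow> real^'s) \<Rightarrow> (real^'s) set \<Rightarrow> real^'n \<Rightarrow> real^'s" where
  "Lambda_map F G D x = (THE l. qp_multiplier F G D x (S_map F G D x) l)"


section \<open>Algorithm A\<close>

text \<open>One iteration from a non-terminal iterate, for an arbitrary choice of the quantities that
  the algorithm leaves open.\<close>

definition algA_step ::
  "(real^'n \<Rightarrow> real^'n) \<Rightarrow> (real^'n \<Rightarrow> real^'s) \<Rightarrow> (real^'s) set \<Rightarrow> real^'n \<Rightarrow> real^'n \<Rightarrow> bool" where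
  "algA_step F G D x x' \<longleftrightarrow>
     (\<exists>u l d W Z \<Delta>.
        approx_step F G D x u l \<and>
        d = lin_G G u x \<and>
        length W + dim (lin (tangent_cone D d)) = CARD('s) \<and>
        cols_basis W (span (normal_cone D d)) \<and>
        length Z + length W = CARD('n) \<and>
        cols_orth_basis Z {v. \<forall>w\<in>set W. inner w (Jac G x *v v) = 0} \<and>
        (\<forall>z\<in>set Z. inner z (dLag F G l x *v \<Delta> + Lag F G l x) = 0) \<and>
        (\<forall>w\<in>set W. inner w (G x + Jac G x *v \<Delta> - d) = 0) \<and>
        x' = x + \<Delta>)"


section \<open>The mapping T_S and Algorithm B\<close>

definition TS_matrices ::
  "(real^'n \<Rightarrow> real^'n) \<Rightarrow> (real^'n \<Rightarrow> real^'s) \<Rightarrow> (real^'s) set \<Rightarrow> real^'n \<Rightarrow> (real^'n^'n) set" where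
  "TS_matrices F G D x =
     (let u = S_map F G D x; l = Lambda_map F G D x; d = lin_G G u x in
      {- dLag F G l x
         + grad G x ** expand W B ** (Jac G x ** dLag F G l x - Jac (lin_G G u) x) | W B E.
         cone_face (critical_cone D d l) E \<and>
         full_col_rank W \<and> span (set W) = orthogonal_comp (span E) \<and>
         inverse_mat_of (compress W (Jac G x ** grad G x)) B})"

definition T_S ::
  "(real^'n \<Rightarrow> real^'n) \<Rightarrow> (real^'n \<Rightarrow> real^'s) \<Rightarrow> (real^'s) set \<Rightarrow> real^'n
     \<Rightarrow> ((real^'n) \<Rightarrow>\<^sub>L (real^'n)) set" where
  "T_S F G D x = (\<lambda>V. Blinfun (\<lambda>h. V *v h)) ` TS_matrices F G D x"

text \<open>\<open>dist(V, T) \<le> r\<close>; the distance to the empty set is infinite, whereas \<open>infdist V {} = 0\<close>.\<close>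

definition dist_le :: "'a::metric_space \<Rightarrow> 'a set \<Rightarrow> real \<Rightarrow> bool" where
  "dist_le V T r \<longleftrightarrow> T \<noteq> {} \<and> infdist V T \<le> r"

definition algB_step ::
  "(real^'n \<Rightarrow> real^'n) \<Rightarrow> (real^'n \<Rightarrow> real^'s) \<Rightarrow> (real^'s) set \<Rightarrow> real
     \<Rightarrow> real^'n \<Rightarrow> real^'n \<Rightarrow> bool" where
  "algB_step F G D \<rho> x x' \<longleftrightarrow>
     (\<exists>u l V \<Delta>.
        approx_step F G D x u l \<and>
        dist_le V (T_S F G D x) (\<rho> * norm u) \<and>
        blinfun_apply V \<Delta> + u = 0 \<and>
        x' = x + \<Delta>)"


section \<open>General G-semismooth Newton method\<close>

definition gss_newton_step ::
  "'a::euclidean_space set \<Rightarrow> ('a \<Rightarrow> 'a) \<Rightarrow> ('a \<Rightarrow> ('a \<Rightarrow>\<^sub>L 'a) set) \<Rightarrow> real \<Rightarrow> 'a \<Rightarrow> 'a \<Rightarrow> bool" where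
  "gss_newton_step \<Omega> H T \<rho> x x' \<longleftrightarrow>
     x \<in> \<Omega> \<and>
     (\<exists>V \<Delta>. dist_le V (T x) (\<rho> * norm (H x)) \<and> blinfun_apply V \<Delta> = - H x \<and> x' = x + \<Delta>)"

definition locally_lipschitz_on ::
  "'a::metric_space set \<Rightarrow> ('a \<Rightarrow> 'b::metric_space) \<Rightarrow> bool" where
  "locally_lipschitz_on \<Omega> H \<longleftrightarrow> (\<forall>x\<in>\<Omega>. \<exists>r>0. \<exists>L. L-lipschitz_on (cball x r \<inter> \<Omega>) H)"

definition G_semismooth_at ::
  "'a::euclidean_space set \<Rightarrow> ('a \<Rightarrow> 'a) \<Rightarrow> ('a \<Rightarrow> ('a \<Rightarrow>\<^sub>L 'a) set) \<Rightarrow> 'a \<Rightarrow> bool" where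
  "G_semismooth_at \<Omega> H T x \<longleftrightarrow>
     continuous_on \<Omega> H \<and>
     (\<forall>\<epsilon>>0. \<exists>\<delta>>0. \<forall>h. norm h \<le> \<delta> \<and> x + h \<in> \<Omega> \<longrightarrow>
        (\<forall>V\<in>T (x + h). norm (H (x + h) - H x - blinfun_apply V h) \<le> \<epsilon> * norm h))"

definition outer_semicont_at ::
  "'a::euclidean_space set \<Rightarrow> ('a \<Rightarrow> ('a \<Rightarrow>\<^sub>L 'a) set) \<Rightarrow> 'a \<Rightarrow> bool" where
  "outer_semicont_at \<Omega> T x \<longleftrightarrow>
     (\<forall>\<epsilon>>0. \<exists>\<delta>>0. \<forall>x'\<in>\<Omega>. norm (x' - x) \<le> \<delta> \<longrightarrow> T x' \<subseteq> (\<Union>V\<in>T x. cball V \<epsilon>))"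

definition gss_newton_hyps ::
  "'a::euclidean_space set \<Rightarrow> ('a \<Rightarrow> 'a) \<Rightarrow> ('a \<Rightarrow> ('a \<Rightarrow>\<^sub>L 'a) set) \<Rightarrow> 'a \<Rightarrow> bool" where
  "gss_newton_hyps \<Omega> H T xbar \<longleftrightarrow>
     open \<Omega> \<and> xbar \<in> \<Omega> \<and> H xbar = 0 \<and>
     locally_lipschitz_on \<Omega> H \<and>
     G_semismooth_at \<Omega> H T xbar \<and>
     (\<forall>x\<in>\<Omega>. compact (T x)) \<and>
     outer_semicont_at \<Omega> T xbar \<and>
     (\<forall>V\<in>T xbar. \<exists>V'. V o\<^sub>L V' = id_blinfun \<and> V' o\<^sub>L V = id_blinfun)"


section \<open>Local superlinear convergence of an iterative method\<close>

text \<open>A method is given by its stopping test and its (possibly nondeterministic) step relation.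
  In a run \<open>X\<close> the values after the first index at which the test holds are irrelevant. The
  second clause of the last definition says that the method never gets stuck: every finite
  sequence of iterations started in \<open>U\<close> that has not stopped can be continued.\<close>

definition iterates_upto ::
  "('a \<Rightarrow> bool) \<Rightarrow> ('a \<Rightarrow> 'a \<Rightarrow> bool) \<Rightarrow> (nat \<Rightarrow> 'a) \<Rightarrow> nat \<Rightarrow> bool" where
  "iterates_upto stop step X k \<longleftrightarrow> (\<forall>j<k. \<not> stop (X j) \<and> step (X j) (X (Suc j)))"

definition superlinear :: "(nat \<Rightarrow> 'a::real_normed_vector) \<Rightarrow> 'a \<Rightarrow> bool" where
  "superlinear X xbar \<longleftrightarrow>
     X \<longlonglongrightarrow> xbar \<and> (\<lambda>k. norm (X (Suc k) - xbar)) \<in> o(\<lambda>k. norm (X k - xbar))"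

definition locally_superlinear ::
  "('a::real_normed_vector \<Rightarrow> bool) \<Rightarrow> ('a \<Rightarrow> 'a \<Rightarrow> bool) \<Rightarrow> 'a \<Rightarrow> bool" where
  "locally_superlinear stop step xbar \<longleftrightarrow>
     (\<exists>U. open U \<and> xbar \<in> U \<and>
       (\<forall>X k. X 0 \<in> U \<and> iterates_upto stop step X k \<and> \<not> stop (X k) \<longrightarrow> (\<exists>y. step (X k) y)) \<and>
       (\<forall>X. X 0 \<in> U \<and> (\<forall>k. iterates_upto stop step X k) \<longrightarrow> superlinear X xbar))"

end

theory Submission
  imports Defs "Jordan_Normal_Form.Determinant"
begin

text \<open>
  Write \<open>u = S x\<close>, \<open>l = \<Lambda> x\<close>, \<open>d = G x + G' x u\<close>. Comparing the optimal \<open>u\<close> with a small feasible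
  point in the range of \<open>\<nabla>G x\<close> gives \<open>u = O(\<parallel>x - xbar\<parallel>)\<close>, hence \<open>N\<^sub>D d \<subseteq> N\<^sub>D (G xbar)\<close> near \<open>xbar\<close> because
  \<open>D\<close> is polyhedral; nondegeneracy then provides the multiplier and \<open>l - lbar = O(\<parallel>x - xbar\<parallel>)\<close>, and
  monotonicity of the normal cone makes \<open>S\<close> Lipschitz. A matrix \<open>V\<close> in \<open>T_S x\<close> that belongs to the
  face \<open>E\<close> is characterized, with \<open>M = (span E)\<^sup>\<bottom>\<close>, by the reduced linear system
  \<open>V h + L' h \<in> \<nabla>G x M\<close>, \<open>G' x (V h) + d' h \<perp> M\<close>, whose solutions depend on the data in a stable way.
  Near \<open>xbar\<close> the subspaces \<open>M\<close> are among the finitely many that occur at \<open>xbar\<close>, and both \<open>l - lbar \<in> M\<close>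
  and \<open>d - G xbar \<perp> M\<close>. Thus \<open>S x\<close> itself solves the system for \<open>h = x - xbar\<close> up to \<open>o(\<parallel>h\<parallel>)\<close>, which is
  semismoothness, and outer semicontinuity is the stability of the system. The step of Algorithm A
  solves the system of the smallest face with \<open>d' h\<close> replaced by \<open>G' x h\<close>, a perturbation of order
  \<open>\<parallel>S x\<parallel>\<close>; so it is a step of Algorithm B for some \<open>\<varrho> > 0\<close>.
\<close>

text \<open>A matrix of \<open>T_S\<close> is written with a basis \<open>W\<close> and the inverse
  of a Gram matrix, while the reduced system sees the face only through its span. Hence
  \<open>T_S x\<close> is finite, so compact, and matrices at \<open>x\<close> and
  \<open>xbar\<close> can be compared once their faces have equal spans. The obstacle is that the
  faces at \<open>x\<close> belong to a different critical cone; their transfer to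
  \<open>xbar\<close> rests on the inclusion of normal cones and on the closeness of the
  multipliers, both collected in \<open>regular\<close>. A second obstacle is existence. That every
  step of Algorithm A is a step of Algorithm B controls the steps that are made but does not produce
  one. The local analysis of the general method therefore also yields a lower bound valid for all
  admissible operators, and the operator of Algorithm A, being admissible, is invertible. The
  constant is \<open>\<rho> = C0 / (\<gamma> / 2)\<close>: \<open>C0\<close> bounds the second
  derivative of \<open>G\<close>, and \<open>1 / (\<gamma> / 2)\<close> is the factor with which an
  error in the second equation of the reduced system enters its solution.\<close>

declare transpose_matrix_vector [simp del]

abbreviation tr :: "real^'n^'m \<Rightarrow> real^'m^'n" where
  "tr \<equiv> Finite_Cartesian_Product.transpose"

section \<open>Matrices given by their columns\<close>

lemma inner_transpose_mult:
  fixes A :: "real^'n^'s"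
  shows "inner (tr A *v l) u = inner l (A *v u)"
  by (simp add: dot_lmul_matrix transpose_matrix_vector)

lemma sum_nth_eq_sum_set:
  assumes "distinct W"
  shows "(\<Sum>i<length W. f (W ! i)) = sum f (set W)"
  using sum.reindex_bij_betw[OF bij_betw_nth[OF assms refl refl], of f] by simp

lemma span_list_obtain:
  fixes W :: "(real^'k) list"
  assumes "distinct W" "m \<in> span (set W)"
  obtains c where "m = (\<Sum>i<length W. c i *\<^sub>R (W ! i))"
proof -
  from assms(2) obtain u where "m = (\<Sum>w\<in>set W. u w *\<^sub>R w)"
    by (auto simp: span_finite)
  then have "m = (\<Sum>i<length W. u (W ! i) *\<^sub>R (W ! i))"
    by (simp add: sum_nth_eq_sum_set[OF assms(1), of "\<lambda>w. u w *\<^sub>R w"])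
  then show thesis by (rule that)
qed

lemma full_col_rank_coeffs_zero:
  assumes "full_col_rank W" "(\<Sum>i<length W. c i *\<^sub>R (W ! i)) = 0" "i < length W"
  shows "c i = 0"
proof -
  have dist: "distinct W" and ind: "independent (set W)"
    using assms(1) by (auto simp: full_col_rank_def)
  \<comment> \<open>Independence concerns the set of columns, so the coefficients are moved from
    positions to vectors; distinctness makes the position of a column unique.\<close>
  define u where "u w = c (THE i. i < length W \<and> W ! i = w)" for w
  have u: "u (W ! i) = c i" if "i < length W" for i
  proof -
    have "(THE j. j < length W \<and> W ! j = W ! i) = i"
      using dist that by (intro the_equality) (auto simp: nth_eq_iff_index_eq)
    then show ?thesis by (simp add: u_def)
  qed
  have "(\<Sum>w\<in>set W. u w *\<^sub>R w) = (\<Sum>i<length W. c i *\<^sub>R (W ! i))"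
    using sum_nth_eq_sum_set[OF dist, of "\<lambda>w. u w *\<^sub>R w"] u by simp
  then have "u (W ! i) = 0"
    using independentD[OF ind finite_set order_refl] assms(2,3) by simp
  then show ?thesis using u assms(3) by simp
qed

lemma full_col_rank_length:
  assumes "full_col_rank W"
  shows "length W = dim (span (set W))"
  using assms by (metis dim_span_eq_card_independent distinct_card full_col_rank_def)

lemma cols_basis_exists:
  fixes M :: "(real^'k) set"
  assumes "subspace M"
  shows "\<exists>W. cols_basis W M"
proof -
  obtain B where B: "B \<subseteq> M" "independent B" "M \<subseteq> span B" "card B = dim M"
    using basis_exists by blast
  then have "span B = M"
    by (metis assms span_minimal subset_antisym)
  moreover obtain W where "set W = B" "distinct W"
    using finite_distinct_list independent_imp_finite[OF B(2)] by blast
  ultimately show ?thesis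
    using B by (auto simp: cols_basis_def full_col_rank_def)
qed

lemma cols_orth_basis_exists:
  fixes M :: "(real^'k) set"
  assumes "subspace M"
  shows "\<exists>W. cols_orth_basis W M"
proof -
  obtain B where B: "pairwise Linear_Algebra.orthogonal B" "\<And>x. x \<in> B \<Longrightarrow> norm x = 1"
      "independent B" "span B = M"
    using orthonormal_basis_subspace[OF assms] by metis
  moreover obtain W where "set W = B" "distinct W"
    using finite_distinct_list independent_imp_finite[OF B(3)] by blast
  ultimately show ?thesis
    by (auto simp: cols_orth_basis_def cols_basis_def full_col_rank_def)
qed

lemma expand_mult:
  "expand W B *v v =
    (\<Sum>i<length W. (\<Sum>j<length W. index_mat B (i, j) * inner (W ! j) v) *\<^sub>R (W ! i))"
proof -
  have "vec_nth (expand W B *v v) a = vec_nth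
    (\<Sum>i<length W. (\<Sum>j<length W. index_mat B (i, j) * inner (W ! j) v) *\<^sub>R (W ! i)) a" for a
  proof -
    have "vec_nth (expand W B *v v) a = (\<Sum>b\<in>UNIV. \<Sum>i<length W. \<Sum>j<length W.
        vec_nth (W ! i) a * index_mat B (i, j) * vec_nth (W ! j) b * vec_nth v b)"
      by (simp add: expand_def matrix_vector_mult_def sum_distrib_right)
    also have "\<dots> = (\<Sum>i<length W. \<Sum>j<length W. \<Sum>b\<in>UNIV.
        vec_nth (W ! i) a * index_mat B (i, j) * vec_nth (W ! j) b * vec_nth v b)"
      by (subst sum.swap, rule sum.cong[OF refl], subst sum.swap) simp
    finally show ?thesis
      by (simp add: inner_vec_def sum_distrib_left sum_distrib_right mult_ac)
  qed
  then show ?thesis by (simp add: Finite_Cartesian_Product.vec_eq_iff)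
qed

lemma expand_mult_in_span: "expand W B *v v \<in> span (set W)"
  unfolding expand_mult by (intro span_sum span_scale span_base) auto

lemma inverse_mat_of_index:
  assumes "inverse_mat_of A B" "A \<in> carrier_mat n n" "i < n" "j < n"
  shows "(\<Sum>k<n. index_mat A (i, k) * index_mat B (k, j)) = (if i = j then 1 else 0)"
proof -
  have AB: "A * B = one_mat (dim_row A)" and BA: "B * A = one_mat (dim_row B)"
    using assms(1) by (auto simp: inverse_mat_of_def inverts_mat_def)
  \<comment> \<open>The relation \<open>inverse_mat_of\<close> does not fix the size of
    \<open>B\<close>; it is read off from the widths of the two products.\<close>
  have cB: "dim_col B = n"
    using arg_cong[OF AB, of dim_col] assms(2) by simp
  have rB: "dim_row B = n"
    using arg_cong[OF BA, of dim_col] assms(2) by simp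
  have "index_mat (A * B) (i, j) = (\<Sum>k<n. index_mat A (i, k) * index_mat B (k, j))"
    using assms cB rB by (simp add: scalar_prod_def atLeast0LessThan)
  then show ?thesis
    using AB assms by simp
qed

text \<open>With \<open>C = W^T P W\<close>, the identity \<open>C B = 1\<close> cancels in
  \<open>W^T P (W B W^T) v\<close> and leaves \<open>W^T v\<close>. For \<open>P = A A^T\<close>
  this is the orthogonality condition of the reduced system.\<close>

lemma expand_inverse:
  assumes "inverse_mat_of (compress W P) B" "w \<in> span (set W)"
  shows "inner w (P *v (expand W B *v v)) = inner w v"
proof -
  let ?n = "length W"
  have base: "inner (W ! k) (P *v (expand W B *v v)) = inner (W ! k) v" if k: "k < ?n" for k
  proof -
    have lin: "linear ((*v) P)" by simp
    have "inner (W ! k) (P *v (expand W B *v v)) =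
        (\<Sum>i<?n. (\<Sum>j<?n. index_mat B (i, j) * inner (W ! j) v) * inner (W ! k) (P *v (W ! i)))"
      unfolding expand_mult by (simp add: linear_sum[OF lin] linear_cmul[OF lin] inner_sum_right)
    also have "\<dots> = (\<Sum>i<?n. \<Sum>j<?n.
        index_mat (compress W P) (k, i) * index_mat B (i, j) * inner (W ! j) v)"
      using k by (intro sum.cong refl) (simp add: compress_def sum_distrib_left sum_distrib_right mult_ac)
    also have "\<dots> = (\<Sum>j<?n.
        (\<Sum>i<?n. index_mat (compress W P) (k, i) * index_mat B (i, j)) * inner (W ! j) v)"
      by (subst sum.swap) (simp add: sum_distrib_right)
    also have "\<dots> = (\<Sum>j<?n. (if k = j then 1 else 0) * inner (W ! j) v)"
      using inverse_mat_of_index[OF assms(1), of ?n k] k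
      by (intro sum.cong refl) (simp add: compress_def)
    also have "\<dots> = inner (W ! k) v"
      using k by (simp add: if_distrib[of "\<lambda>x. x * _"] sum.delta cong: if_cong)
    finally show ?thesis .
  qed
  show ?thesis
    using assms(2)
  proof (induction rule: span_induct_alt)
    case base then show ?case by simp
  next
    case (step c x y)
    then obtain k where "k < ?n" "x = W ! k" by (auto simp: in_set_conv_nth)
    with step base show ?case by (simp add: inner_add_left)
  qed
qed

lemma compress_mult_vec:
  assumes "i < length W"
  shows "(\<Sum>k<length W. index_mat (compress W P) (i, k) * c k)
     = inner (W ! i) (P *v (\<Sum>k<length W. c k *\<^sub>R (W ! k)))"
proof -
  have lin: "linear ((*v) P)" by simp
  show ?thesis
    using assms by (simp add: linear_sum[OF lin] linear_cmul[OF lin] inner_sum_right compress_def mult_ac)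
qed

text \<open>A kernel vector of the compressed matrix gives a combination \<open>m\<close> of the
  columns such that \<open>P m\<close> is orthogonal to every column, hence to \<open>m\<close>.
  Then \<open>m = 0\<close>, and independence of the columns makes the kernel vector zero, so the
  determinant cannot vanish.\<close>

lemma compress_inverse_exists:
  assumes W: "full_col_rank W"
    and pos: "\<And>m. m \<in> span (set W) \<Longrightarrow> inner m (P *v m) = 0 \<Longrightarrow> m = 0"
  shows "\<exists>B. inverse_mat_of (compress W P) B"
proof -
  let ?n = "length W" and ?C = "compress W P"
  have C: "?C \<in> carrier_mat ?n ?n" by (simp add: compress_def)
  have "Determinant.det ?C \<noteq> 0"
  proof
    assume "Determinant.det ?C = 0"
    then obtain v where v: "v \<in> carrier_vec ?n" "v \<noteq> zero_vec ?n" "mult_mat_vec ?C v = zero_vec ?n"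
      using det_0_iff_vec_prod_zero_field[OF C] by auto
    define m where "m = (\<Sum>k<?n. vec_index v k *\<^sub>R (W ! k))"
    have "inner (W ! i) (P *v m) = 0" if "i < ?n" for i
    proof -
      have "inner (W ! i) (P *v m) = (\<Sum>k<?n. index_mat ?C (i, k) * vec_index v k)"
        unfolding m_def by (simp only: compress_mult_vec[OF that, symmetric])
      also have "\<dots> = vec_index (mult_mat_vec ?C v) i"
        using that v(1) C by (simp add: scalar_prod_def atLeast0LessThan)
      finally show ?thesis using v that by simp
    qed
    then have "inner m (P *v m) = 0"
      by (subst (1) m_def) (simp add: inner_sum_left)
    moreover have "m \<in> span (set W)"
      unfolding m_def by (intro span_sum span_scale span_base) auto
    ultimately have "m = 0" using pos by blast
    then have "vec_index v i = 0" if "i < ?n" for i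
      using full_col_rank_coeffs_zero[OF W _ that] unfolding m_def by blast
    then have "v = zero_vec ?n" using v(1) by (intro eq_vecI) auto
    with v(2) show False by simp
  qed
  then obtain B where "B * ?C = one_mat ?n" "?C * B = one_mat ?n" "B \<in> carrier_mat ?n ?n"
    using det_non_zero_imp_unit[OF C] by (auto simp: Units_def ring_mat_def)
  then show ?thesis
    using C by (auto simp: inverse_mat_of_def inverts_mat_def)
qed

text \<open>The coordinates of \<open>h\<close> with respect to \<open>Z\<close> form a kernel
  vector of the compressed matrix. This is how the nonsingularity assumption on the faces
  enters.\<close>

lemma compress_invertible_kernel:
  assumes inv: "invertible_mat (compress Z P)" and Z: "distinct Z"
    and h: "h \<in> span (set Z)" and orth: "\<And>z. z \<in> set Z \<Longrightarrow> inner z (P *v h) = 0"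
  shows "h = 0"
proof -
  let ?n = "length Z" and ?C = "compress Z P"
  have C: "?C \<in> carrier_mat ?n ?n" by (simp add: compress_def)
  obtain B where B: "inverse_mat_of ?C B"
    using inv by (auto simp: invertible_mat_def inverse_mat_of_def)
  obtain c where c: "h = (\<Sum>i<?n. c i *\<^sub>R (Z ! i))"
    using span_list_obtain[OF Z h] .
  \<comment> \<open>The coordinates are recovered through \<open>B * ?C = 1\<close>, so the index
    formula is needed with matrix and inverse exchanged.\<close>
  have inv': "inverse_mat_of B ?C" "B \<in> carrier_mat ?n ?n"
  proof -
    show "inverse_mat_of B ?C" using B by (simp add: inverse_mat_of_def)
    have "?C * B = one_mat ?n" "B * ?C = one_mat (dim_row B)"
      using B C by (auto simp: inverse_mat_of_def inverts_mat_def)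
    then show "B \<in> carrier_mat ?n ?n"
      using arg_cong[of _ _ dim_col] C
      by (metis carrier_matD(2) carrier_mat_triv index_mult_mat(3) index_one_mat(3))
  qed
  have "c i = 0" if i: "i < ?n" for i
  proof -
    have "c i = (\<Sum>k<?n. (if i = k then 1 else 0) * c k)"
      using i by (simp add: if_distrib[of "\<lambda>x. x * _"] cong: if_cong)
    also have "\<dots> = (\<Sum>k<?n. (\<Sum>j<?n. index_mat B (i, j) * index_mat ?C (j, k)) * c k)"
      using i inverse_mat_of_index[OF inv'] by (intro sum.cong refl) simp
    also have "\<dots> = (\<Sum>j<?n. index_mat B (i, j) * (\<Sum>k<?n. index_mat ?C (j, k) * c k))"
      by (simp add: sum_distrib_left sum_distrib_right mult.assoc) (rule sum.swap)
    also have "\<dots> = (\<Sum>j<?n. index_mat B (i, j) * inner (Z ! j) (P *v h))"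
      by (intro sum.cong refl) (simp add: compress_mult_vec c)
    also have "\<dots> = 0"
      using orth by simp
    finally show ?thesis .
  qed
  then show ?thesis by (simp add: c)
qed

section \<open>Reduced linear systems\<close>

text \<open>With \<open>a = L' h\<close> and \<open>b = d' h\<close>, the first equation is the derivative of
  \<open>u + F x + \<nabla>G x l = 0\<close> with a multiplier increment \<open>-m \<in> M\<close>, the second one keeps the derivative of
  \<open>G x + G' x u\<close> in \<open>M\<^sup>\<bottom>\<close>, the span of the face.\<close>

definition face_deriv ::
  "real^'n^'s \<Rightarrow> (real^'s) set \<Rightarrow> real^'n \<Rightarrow> real^'s \<Rightarrow> real^'n \<Rightarrow> bool" where
  "face_deriv A M a b p \<longleftrightarrow>
     (\<exists>m\<in>M. p + a = tr A *v m) \<and> (\<forall>w\<in>M. inner w (A *v p + b) = 0)"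

text \<open>For \<open>p = A^T m\<close> one has \<open><p, p> = <m, A p>\<close>; the orthogonality
  replaces \<open>A q\<close> by \<open>r2\<close>, and \<open>norm m \<le> norm p / c\<close>
  allows one factor \<open>norm p\<close> to be cancelled. The bound contains \<open>c\<close> but
  no bound on \<open>A\<close>.\<close>

lemma reduced_system_bound:
  fixes A :: "real^'n^'s"
  assumes c: "c > 0" and M: "\<And>w. w \<in> M \<Longrightarrow> norm (tr A *v w) \<ge> c * norm w"
    and m: "m \<in> M" "q = r1 + tr A *v m"
    and orth: "inner m (A *v q - r2) = 0"
  shows "norm q \<le> 2 * norm r1 + norm r2 / c"
proof -
  define p where "p = tr A *v m"
  have "inner p p = inner m (A *v q - r2) + inner m r2 - inner p r1"
    by (simp add: p_def m inner_transpose_mult matrix_vector_right_distrib algebra_simps inner_diff_right)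
  then have "(norm p)\<^sup>2 = inner m r2 - inner p r1"
    using orth by (simp add: power2_norm_eq_inner)
  also have "\<dots> \<le> norm m * norm r2 + norm p * norm r1"
    using norm_cauchy_schwarz[of m r2] norm_cauchy_schwarz[of p "- r1"] by simp
  also have "norm m * norm r2 \<le> norm p / c * norm r2"
    using M[OF m(1)] c unfolding p_def
    by (intro mult_right_mono) (auto simp: field_simps)
  finally have "norm p * norm p \<le> norm p * (norm r2 / c + norm r1)"
    by (simp add: power2_eq_square algebra_simps)
  then have "norm p \<le> norm r2 / c + norm r1"
    using c by (cases "norm p = 0") (auto intro: mult_left_le_imp_le)
  then show ?thesis
    using norm_triangle_ineq[of r1 p] m(2) by (simp add: p_def)
qed

text \<open>The distance of an arbitrary \<open>q\<close> from the solution is measured by its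
  residuals, in which \<open>m \<in> M\<close> and \<open>e\<close> orthogonal to \<open>M\<close>
  may be chosen at will. All later comparisons consist of such a choice: increments of the
  multiplier and of the constraint value for semismoothness, the data of another system with the
  same \<open>M\<close> for outer semicontinuity and for Algorithm A.\<close>

lemma face_deriv_stable:
  fixes A :: "real^'n^'s"
  assumes c: "c > 0" and M: "\<And>w. w \<in> M \<Longrightarrow> norm (tr A *v w) \<ge> c * norm w"
    and sub: "subspace M" and p: "face_deriv A M a b p" and m: "m \<in> M"
    and orth: "\<And>w. w \<in> M \<Longrightarrow> inner w e = 0"
  shows "norm (q - p) \<le> 2 * norm (q + a - tr A *v m)
       + norm (A *v q + b - e) / c"
proof -
  obtain m' where m': "m' \<in> M" "p + a = tr A *v m'"
    and o: "\<And>w. w \<in> M \<Longrightarrow> inner w (A *v p + b) = 0"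
    using p by (auto simp: face_deriv_def)
  have mm: "m - m' \<in> M" using sub m m' by (simp add: subspace_diff)
  have a: "a = tr A *v m' - p"
    using m'(2) by (simp add: algebra_simps)
  show ?thesis
  proof (rule reduced_system_bound[OF c M mm])
    show "q - p = (q + a - tr A *v m)
        + tr A *v (m - m')"
      by (simp add: a matrix_vector_mult_diff_distrib)
    show "inner (m - m') (A *v (q - p) - (A *v q + b - e)) = 0"
      using orth[OF mm] o[OF mm]
      by (simp add: matrix_vector_mult_diff_distrib inner_diff_right inner_add_right)
  qed
qed

lemma face_deriv_unique:
  fixes A :: "real^'n^'s"
  assumes c: "c > 0" and M: "\<And>w. w \<in> M \<Longrightarrow> norm (tr A *v w) \<ge> c * norm w"
    and sub: "subspace M" and p: "face_deriv A M a b p" and q: "face_deriv A M a b q"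
  shows "p = q"
proof -
  obtain m where m: "m \<in> M" "q + a = tr A *v m"
    and o: "\<And>w. w \<in> M \<Longrightarrow> inner w (A *v q + b) = 0"
    using q by (auto simp: face_deriv_def)
  have "norm (q - p) \<le> 0"
    using face_deriv_stable[OF c M sub p m(1) o, of q] m(2) by simp
  then show ?thesis by simp
qed

text \<open>The multiplier of the system is \<open>m = W B W^T y\<close> with
  \<open>y = A L h - d' h\<close>, so that the explicit formula becomes
  \<open>V h = - L h + A^T m\<close>.\<close>

lemma face_deriv_formula:
  fixes A :: "real^'n^'s" and L :: "real^'n^'n" and d' :: "real^'n^'s"
  assumes "inverse_mat_of (compress W (A ** tr A)) B"
    and "V = - L + tr A ** expand W B ** (A ** L - d')"
  shows "face_deriv A (span (set W)) (L *v h) (d' *v h) (V *v h)"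
proof -
  define y where "y = (A ** L - d') *v h"
  define m where "m = expand W B *v y"
  have Vh: "V *v h = - (L *v h) + tr A *v m"
    by (simp add: assms(2) m_def y_def matrix_vector_mult_add_rdistrib
        matrix_vector_mult_diff_rdistrib flip: matrix_vector_mul_assoc)
  have y: "y = A *v (L *v h) - d' *v h"
    by (simp add: y_def matrix_vector_mult_diff_rdistrib matrix_vector_mul_assoc)
  have "inner w (A *v (V *v h) + d' *v h) = 0" if w: "w \<in> span (set W)" for w
  proof -
    have "A *v (V *v h) + d' *v h = (A ** tr A) *v m - y"
      by (simp add: Vh y matrix_vector_right_distrib matrix_vector_mul_assoc
          matrix_vector_mult_diff_distrib algebra_simps)
    then show ?thesis
      using expand_inverse[OF assms(1) w, of y] by (simp add: m_def inner_diff_right)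
  qed
  moreover have "m \<in> span (set W)" by (simp add: m_def expand_mult_in_span)
  ultimately show ?thesis
    unfolding face_deriv_def by (auto simp: Vh)
qed

lemma compress_gram_inverse_exists:
  fixes A :: "real^'n^'s"
  assumes W: "full_col_rank W" and c: "c > 0"
    and M: "\<And>w. w \<in> span (set W) \<Longrightarrow> norm (tr A *v w) \<ge> c * norm w"
  shows "\<exists>B. inverse_mat_of (compress W (A ** tr A)) B"
proof (rule compress_inverse_exists[OF W])
  fix m assume m: "m \<in> span (set W)"
    and "inner m ((A ** tr A) *v m) = 0"
  then have "inner (tr A *v m) (tr A *v m) = 0"
    by (simp add: inner_transpose_mult matrix_vector_mul_assoc)
  then have "c * norm m \<le> 0" using M[OF m] by simp
  with c show "m = 0" by (simp add: mult_le_0_iff)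
qed

section \<open>Polyhedral convex sets\<close>

lemma polyhedron_halfspaces:
  assumes "polyhedron D"
  obtains I :: "('a::euclidean_space \<times> real) set"
  where "finite I" "D = {x. \<forall>(a, b)\<in>I. inner a x \<le> b}"
proof -
  obtain H where H: "finite H" "D = \<Inter> H" "\<And>h. h \<in> H \<Longrightarrow> \<exists>a b. a \<noteq> 0 \<and> h = {x. inner a x \<le> b}"
    using assms by (auto simp: polyhedron_def)
  then obtain f g where fg: "\<And>h. h \<in> H \<Longrightarrow> h = {x. inner (f h) x \<le> g h}"
    by metis
  show thesis
  proof (rule that)
    show "finite ((\<lambda>h. (f h, g h)) ` H)" using H by simp
    show "D = {x. \<forall>(a, b)\<in>(\<lambda>h. (f h, g h)) ` H. inner a x \<le> b}"
      using H(2) fg by auto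
  qed
qed

text \<open>Constraints inactive at \<open>d\<close> stay strict on a ball, of common radius because
  there are finitely many; the active ones restrict only the direction \<open>t\<close>.\<close>

lemma halfspaces_local:
  assumes I: "finite I" and d: "\<forall>(a, b)\<in>I. inner a d \<le> b"
  obtains \<rho> where "\<rho> > 0"
    "\<And>t. norm t < \<rho> \<Longrightarrow> \<forall>(a, b)\<in>I. inner a d = b \<longrightarrow> inner a t \<le> 0 \<Longrightarrow> \<forall>(a, b)\<in>I. inner a (d + t) \<le> b"
proof -
  have "\<forall>\<^sub>F t in nhds (0::'a). inner a d = b \<or> inner a (d + t) < b" if "(a, b) \<in> I" for a b
  proof (cases "inner a d = b")
    case False
    then have "inner a (d + 0) < b" using d that by force
    moreover have "((\<lambda>t. inner a (d + t)) \<longlongrightarrow> inner a (d + 0)) (nhds 0)"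
      by (intro tendsto_intros filterlim_ident)
    ultimately have "\<forall>\<^sub>F t in nhds 0. inner a (d + t) < b"
      by (rule order_tendstoD(2)[rotated])
    then show ?thesis by (rule eventually_mono) auto
  qed simp
  then have "\<forall>\<^sub>F t in nhds (0::'a). \<forall>ab\<in>I. inner (fst ab) d = snd ab \<or> inner (fst ab) (d + t) < snd ab"
    using I by (intro eventually_ball_finite) auto
  then obtain \<rho> where "\<rho> > 0"
    and \<rho>: "\<And>t. norm t < \<rho> \<Longrightarrow> \<forall>ab\<in>I. inner (fst ab) d = snd ab \<or> inner (fst ab) (d + t) < snd ab"
    by (auto simp: eventually_nhds_metric)
  then show thesis
    by (intro that[of \<rho>]) (fastforce simp: inner_add_right)+
qed

lemma exists_pos_scale:
  fixes v :: "'a::real_normed_vector"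
  assumes "\<rho> > 0"
  obtains s where "s > 0" "norm (s *\<^sub>R v) < \<rho>"
proof -
  \<comment> \<open>The \<open>+ 1\<close> covers \<open>v = 0\<close>.\<close>
  define s where "s = \<rho> / (norm v + 1)"
  have pos: "norm v + 1 > 0" by (simp add: add_nonneg_pos)
  then have s: "s > 0" using assms by (simp add: s_def)
  have "s * norm v < s * (norm v + 1)" using s by simp
  also have "\<dots> = \<rho>" using pos by (simp add: s_def)
  finally show thesis using s that by simp
qed

lemma halfspaces_feasible_direction:
  assumes I: "finite I" and d: "\<forall>(a, b)\<in>I. inner a d \<le> b"
    and v: "\<forall>(a, b)\<in>I. inner a d = b \<longrightarrow> inner a v \<le> 0"
  obtains e where "e > 0" "\<forall>(a, b)\<in>I. inner a (d + e *\<^sub>R v) \<le> b"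
proof -
  obtain \<rho> where \<rho>: "\<rho> > 0"
    "\<And>t. norm t < \<rho> \<Longrightarrow> \<forall>(a, b)\<in>I. inner a d = b \<longrightarrow> inner a t \<le> 0 \<Longrightarrow> \<forall>(a, b)\<in>I. inner a (d + t) \<le> b"
    using halfspaces_local[OF I d] by blast
  obtain e where e: "e > 0" "norm (e *\<^sub>R v) < \<rho>"
    using exists_pos_scale[OF \<rho>(1)] .
  moreover have "\<forall>(a, b)\<in>I. inner a d = b \<longrightarrow> inner a (e *\<^sub>R v) \<le> 0"
    using v e(1) by (auto simp: mult_le_0_iff)
  ultimately show thesis using \<rho>(2)[OF e(2)] e(1) that by blast
qed

text \<open>The right-hand side is a closed cone containing all differences \<open>y - d\<close>;
  conversely each of its elements is a positive multiple of such a difference, since a short move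
  along it violates no constraint.\<close>

lemma tangent_cone_halfspaces:
  fixes D :: "'a::euclidean_space set"
  assumes I: "finite I" and D: "D = {x. \<forall>(a, b)\<in>I. inner a x \<le> b}" and d: "d \<in> D"
  shows "tangent_cone D d = {v. \<forall>(a, b)\<in>I. inner a d = b \<longrightarrow> inner a v \<le> 0}" (is "_ = ?R")
proof -
  have R: "?R = (\<Inter>ab\<in>{ab\<in>I. inner (fst ab) d = snd ab}. {v. inner (fst ab) v \<le> 0})"
    by auto
  have "closed ?R"
    unfolding R by (intro closed_INT ballI closed_halfspace_le)
  moreover have "cone ?R"
    by (auto simp: cone_def mult_le_0_iff)
  then have "cone hull ((\<lambda>y. y - d) ` D) \<subseteq> ?R"
    by (intro hull_minimal) (auto simp: D inner_diff_right)
  ultimately have "closure (cone hull ((\<lambda>y. y - d) ` D)) \<subseteq> ?R"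
    by (rule closure_minimal[rotated])
  moreover have "v \<in> closure (cone hull ((\<lambda>y. y - d) ` D))" if v: "v \<in> ?R" for v
  proof -
    have dd: "\<forall>(a, b)\<in>I. inner a d \<le> b" using d D by auto
    obtain e where e: "e > 0" "\<forall>(a, b)\<in>I. inner a (d + e *\<^sub>R v) \<le> b"
      using halfspaces_feasible_direction[OF I dd] v by blast
    then have "d + e *\<^sub>R v \<in> D" by (simp add: D)
    then have "(d + e *\<^sub>R v) - d \<in> cone hull ((\<lambda>y. y - d) ` D)"
      by (intro hull_inc) blast
    then have "(1 / e) *\<^sub>R ((d + e *\<^sub>R v) - d) \<in> cone hull ((\<lambda>y. y - d) ` D)"
      using e(1) by (intro mem_cone cone_cone_hull) auto
    moreover have "(1 / e) *\<^sub>R ((d + e *\<^sub>R v) - d) = v"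
      using e(1) by simp
    ultimately show ?thesis
      using closure_subset by auto
  qed
  ultimately show ?thesis
    using d by (auto simp: tangent_cone_def)
qed

lemma polyhedron_feasible_direction:
  fixes D :: "'a::euclidean_space set"
  assumes "polyhedron D" "d \<in> D" "v \<in> tangent_cone D d"
  obtains e where "e > 0" "d + e *\<^sub>R v \<in> D"
proof -
  obtain I where I: "finite I" "D = {x. \<forall>(a, b)\<in>I. inner a x \<le> b}"
    using polyhedron_halfspaces[OF assms(1)] .
  have "\<forall>(a, b)\<in>I. inner a d \<le> b" using assms(2) I by auto
  moreover have "\<forall>(a, b)\<in>I. inner a d = b \<longrightarrow> inner a v \<le> 0"
    using assms(3) by (simp add: tangent_cone_halfspaces[OF I assms(2)])
  ultimately obtain e where "e > 0" "\<forall>(a, b)\<in>I. inner a (d + e *\<^sub>R v) \<le> b"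
    using halfspaces_feasible_direction[OF I(1)] by blast
  then show thesis
    using that I(2) by blast
qed

text \<open>For a polyhedral set the tangent cone is not merely a first-order approximation:
  \<open>D\<close> contains a whole neighbourhood of \<open>d\<close> in
  \<open>d + tangent_cone D d\<close>. Later this turns small tangent displacements into feasible
  points.\<close>

lemma polyhedron_local_cone:
  fixes D :: "'a::euclidean_space set"
  assumes "polyhedron D" "d \<in> D"
  obtains \<rho> where "\<rho> > 0" "\<And>t. t \<in> tangent_cone D d \<Longrightarrow> norm t < \<rho> \<Longrightarrow> d + t \<in> D"
proof -
  obtain I where I: "finite I" "D = {x. \<forall>(a, b)\<in>I. inner a x \<le> b}"
    using polyhedron_halfspaces[OF assms(1)] .
  have dd: "\<forall>(a, b)\<in>I. inner a d \<le> b" using assms(2) I by auto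
  obtain \<rho> where "\<rho> > 0"
    "\<And>t. norm t < \<rho> \<Longrightarrow> \<forall>(a, b)\<in>I. inner a d = b \<longrightarrow> inner a t \<le> 0 \<Longrightarrow> \<forall>(a, b)\<in>I. inner a (d + t) \<le> b"
    using halfspaces_local[OF I(1) dd] by blast
  then show thesis
    by (intro that[of \<rho>]) (auto simp: tangent_cone_halfspaces[OF I assms(2)], auto simp: I(2))
qed

lemma diff_mem_tangent_cone:
  assumes "d \<in> D" "y \<in> D"
  shows "y - d \<in> tangent_cone D d"
  using assms closure_subset hull_inc[of "y - d" "(\<lambda>y. y - d) ` D" cone]
  by (auto simp: tangent_cone_def)

lemma mem_normal_coneD: "l \<in> normal_cone D d \<Longrightarrow> y \<in> D \<Longrightarrow> inner l (y - d) \<le> 0"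
  by (auto simp: normal_cone_def split: if_splits)

text \<open>Polarity of the two cones. For the harder direction it suffices to test with the active
  constraint normals, which are themselves elements of the normal cone.\<close>

lemma tangent_cone_iff_normal_cone:
  fixes D :: "'a::euclidean_space set"
  assumes "polyhedron D" "d \<in> D"
  shows "v \<in> tangent_cone D d \<longleftrightarrow> (\<forall>l\<in>normal_cone D d. inner l v \<le> 0)"
proof
  assume "v \<in> tangent_cone D d"
  then obtain e where e: "e > 0" "d + e *\<^sub>R v \<in> D"
    using polyhedron_feasible_direction assms by blast
  then have "e * inner l v \<le> 0" if "l \<in> normal_cone D d" for l
    using mem_normal_coneD[OF that e(2)] by simp
  then show "\<forall>l\<in>normal_cone D d. inner l v \<le> 0"
    using e(1) by (auto simp: mult_le_0_iff)
next
  assume *: "\<forall>l\<in>normal_cone D d. inner l v \<le> 0"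
  obtain I where I: "finite I" "D = {x. \<forall>(a, b)\<in>I. inner a x \<le> b}"
    using polyhedron_halfspaces[OF assms(1)] .
  have "a \<in> normal_cone D d" if "(a, b) \<in> I" "inner a d = b" for a b
    using that I(2) assms(2) by (auto simp: normal_cone_def inner_diff_right)
  then show "v \<in> tangent_cone D d"
    using * by (auto simp: tangent_cone_halfspaces[OF I assms(2)])
qed

lemma polyhedron_tangent_cone:
  fixes D :: "'a::euclidean_space set"
  assumes "polyhedron D" "d \<in> D"
  shows "polyhedron (tangent_cone D d)"
proof -
  obtain I where I: "finite I" "D = {x. \<forall>(a, b)\<in>I. inner a x \<le> b}"
    using polyhedron_halfspaces[OF assms(1)] .
  have "tangent_cone D d = (\<Inter>ab\<in>{ab\<in>I. inner (fst ab) d = snd ab}. {v. inner (fst ab) v \<le> 0})"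
    by (auto simp: tangent_cone_halfspaces[OF I assms(2)])
  also have "polyhedron \<dots>"
    using I(1) by (intro polyhedron_Inter) (auto intro: polyhedron_halfspace_le)
  finally show ?thesis .
qed

text \<open>For \<open>y \<in> D\<close> both \<open>e - d\<close> and \<open>y - d\<close> are
  tangent at \<open>d\<close>, so \<open>e + s (y - d)\<close> belongs to \<open>D\<close> for small
  \<open>s > 0\<close>. A normal at \<open>e\<close> tested at this point satisfies the inequality
  required at \<open>d\<close>.\<close>

lemma normal_cone_locally_subset:
  fixes D :: "'a::euclidean_space set"
  assumes "polyhedron D" "d \<in> D"
  obtains \<rho> where "\<rho> > 0" "\<And>t. t \<in> tangent_cone D d \<Longrightarrow> norm t < \<rho> \<Longrightarrow> d + t \<in> D"
    "\<And>e. e \<in> D \<Longrightarrow> norm (e - d) < \<rho> \<Longrightarrow> normal_cone D e \<subseteq> normal_cone D d"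
proof -
  obtain \<rho> where \<rho>: "\<rho> > 0" "\<And>t. t \<in> tangent_cone D d \<Longrightarrow> norm t < \<rho> \<Longrightarrow> d + t \<in> D"
    using polyhedron_local_cone[OF assms] by blast
  have "inner l (y - d) \<le> 0" if e: "e \<in> D" "norm (e - d) < \<rho>" and l: "l \<in> normal_cone D e" and y: "y \<in> D"
    for e l y
  proof -
    obtain s where s: "s > 0" "norm (s *\<^sub>R (y - d)) < \<rho> - norm (e - d)"
      using exists_pos_scale[of "\<rho> - norm (e - d)" "y - d"] e(2) by auto
    then have "norm ((e - d) + s *\<^sub>R (y - d)) < \<rho>"
      using norm_triangle_ineq[of "e - d" "s *\<^sub>R (y - d)"] by linarith
    moreover have "(e - d) + s *\<^sub>R (y - d) \<in> tangent_cone D d"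
      using diff_mem_tangent_cone[OF assms(2) e(1)] diff_mem_tangent_cone[OF assms(2) y] s
      by (auto simp: tangent_cone_iff_normal_cone[OF assms] inner_add_right
          intro!: add_nonpos_nonpos mult_nonneg_nonpos)
    ultimately have "d + ((e - d) + s *\<^sub>R (y - d)) \<in> D" by (rule \<rho>(2)[rotated])
    then have "inner l (s *\<^sub>R (y - d)) \<le> 0"
      using mem_normal_coneD[OF l] by fastforce
    then show ?thesis using s by (simp add: mult_le_0_iff)
  qed
  then show thesis
    using that[OF \<rho>] assms(2) by (auto simp: normal_cone_def split: if_splits)
qed

lemma lin_tangent_cone:
  fixes D :: "'a::euclidean_space set"
  assumes "polyhedron D" "d \<in> D"
  shows "lin (tangent_cone D d) = orthogonal_comp (normal_cone D d)"
  unfolding lin_def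
proof (rule Greatest_equality)
  show "subspace (orthogonal_comp (normal_cone D d)) \<and> orthogonal_comp (normal_cone D d) \<subseteq> tangent_cone D d"
    using subspace_orthogonal_comp by (auto simp: tangent_cone_iff_normal_cone[OF assms]
        orthogonal_comp_def Linear_Algebra.orthogonal_def)
  fix L assume L: "subspace L \<and> L \<subseteq> tangent_cone D d"
  have "inner l v = 0" if "v \<in> L" "l \<in> normal_cone D d" for l v
  proof -
    have "v \<in> tangent_cone D d" "- v \<in> tangent_cone D d"
      using L that subspace_neg by auto
    then have "inner l v \<le> 0" "inner l (- v) \<le> 0"
      using that(2) by (auto simp: tangent_cone_iff_normal_cone[OF assms])
    then show ?thesis by simp
  qed
  then show "L \<subseteq> orthogonal_comp (normal_cone D d)"
    by (auto simp: orthogonal_comp_def Linear_Algebra.orthogonal_def)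
qed

lemma orthogonal_comp_span: "orthogonal_comp (span S) = orthogonal_comp S"
proof (rule equalityI)
  show "orthogonal_comp (span S) \<subseteq> orthogonal_comp S"
    by (intro orthogonal_comp_anti_mono span_superset)
  show "orthogonal_comp S \<subseteq> orthogonal_comp (span S)"
    unfolding orthogonal_comp_def by (blast intro: orthogonal_commute[THEN iffD1] orthogonal_to_span)
qed

lemma dim_orthogonal_comp:
  fixes S :: "'a::euclidean_space set"
  shows "dim (orthogonal_comp S) + dim S = DIM('a)"
proof -
  have "orthogonal_comp S = {y \<in> UNIV. \<forall>x\<in>span S. Linear_Algebra.orthogonal x y}"
    using orthogonal_comp_span[of S] by (simp add: orthogonal_comp_def)
  then show ?thesis
    using dim_subspace_orthogonal_to_vectors[of "span S" UNIV] by simp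
qed

text \<open>The sum of all active constraint normals serves as \<open>\<nu>\<close>, a relative
  interior point of the normal cone. If \<open>v\<close> is tangent and orthogonal to the sum, each
  nonpositive summand vanishes, so \<open>- v\<close> is tangent as well.\<close>

lemma normal_cone_strict:
  fixes D :: "'a::euclidean_space set"
  assumes "polyhedron D" "d \<in> D"
  obtains \<nu> where "\<nu> \<in> normal_cone D d"
    "tangent_cone D d \<inter> orthogonal_comp {\<nu>} = orthogonal_comp (normal_cone D d)"
proof -
  obtain I where I: "finite I" "D = {x. \<forall>(a, b)\<in>I. inner a x \<le> b}"
    using polyhedron_halfspaces[OF assms(1)] .
  let ?A = "{ab\<in>I. inner (fst ab) d = snd ab}"
  define \<nu> where "\<nu> = (\<Sum>ab\<in>?A. fst ab)"
  have act: "fst ab \<in> normal_cone D d" if "ab \<in> ?A" for ab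
    using that I(2) assms(2) by (auto simp: normal_cone_def inner_diff_right)
  have \<nu>: "\<nu> \<in> normal_cone D d"
    using assms(2) act unfolding normal_cone_def \<nu>_def by (auto simp: inner_sum_left intro!: sum_nonpos)
  have "inner l v = 0" if v: "v \<in> tangent_cone D d" "inner \<nu> v = 0" and l: "l \<in> normal_cone D d" for l v
  proof -
    have nonpos: "\<forall>ab\<in>?A. inner (fst ab) v \<le> 0"
      using v(1) act by (auto simp: tangent_cone_iff_normal_cone[OF assms])
    have "(\<Sum>ab\<in>?A. - inner (fst ab) v) = 0"
      using v(2) by (simp add: \<nu>_def inner_sum_left sum_negf)
    then have "\<forall>ab\<in>?A. inner (fst ab) v = 0"
      using nonpos I(1) by (subst (asm) sum_nonneg_eq_0_iff) auto
    then have "- v \<in> tangent_cone D d"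
      by (auto simp: tangent_cone_halfspaces[OF I assms(2)])
    then show ?thesis
      using v(1) l by (auto simp: tangent_cone_iff_normal_cone[OF assms] intro: antisym)
  qed
  moreover have "orthogonal_comp (normal_cone D d) \<subseteq> tangent_cone D d"
    by (auto simp: tangent_cone_iff_normal_cone[OF assms] orthogonal_comp_def Linear_Algebra.orthogonal_def)
  ultimately show thesis
    using that[OF \<nu>] \<nu> by (auto simp: orthogonal_comp_def Linear_Algebra.orthogonal_def)
qed

section \<open>Faces of critical cones\<close>

lemma mem_orthogonal_comp_singleton: "v \<in> orthogonal_comp {l} \<longleftrightarrow> inner l v = 0"
  by (simp add: orthogonal_comp_def Linear_Algebra.orthogonal_def)

lemma polyhedron_critical_cone:
  fixes D :: "(real^'s) set"
  assumes "polyhedron D" "d \<in> D"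
  shows "polyhedron (critical_cone D d l)"
proof -
  have "critical_cone D d l = tangent_cone D d \<inter> {v. inner l v = 0}"
    by (auto simp: critical_cone_def mem_orthogonal_comp_singleton)
  then show ?thesis
    by (simp add: polyhedron_tangent_cone[OF assms] polyhedron_hyperplane)
qed

lemma cone_face_imp_face_of:
  assumes "convex K" "cone_face K E"
  shows "E face_of K"
proof -
  obtain \<nu> where \<nu>: "\<nu> \<in> polar_cone K" "E = K \<inter> orthogonal_comp {\<nu>}"
    using assms(2) by (auto simp: cone_face_def)
  then have "E = K \<inter> {x. inner \<nu> x = 0}"
    by (auto simp: mem_orthogonal_comp_singleton)
  with \<nu>(1) show ?thesis
    using face_of_Int_supporting_hyperplane_le[OF assms(1), of \<nu> 0] by (auto simp: polar_cone_def)
qed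

text \<open>Faces of a polyhedron are exposed, and \<open>0 \<in> E\<close> forces the exposing
  hyperplane through the origin. The detour over \<open>face_of\<close> makes transitivity and
  finiteness of faces available.\<close>

lemma face_of_imp_cone_face:
  assumes "polyhedron K" "E face_of K" "0 \<in> E"
  shows "cone_face K E"
proof -
  have "E exposed_face_of K" using assms exposed_face_of_polyhedron by blast
  then obtain a b where ab: "K \<subseteq> {x. inner a x \<le> b}" "E = K \<inter> {x. inner a x = b}"
    by (auto simp: exposed_face_of_def)
  moreover have "b = 0" using ab assms(3) by auto
  ultimately show ?thesis
    by (auto simp: cone_face_def polar_cone_def mem_orthogonal_comp_singleton intro!: bexI[of _ a])
qed

lemma finite_cone_faces:
  assumes "polyhedron K"
  shows "finite {E. cone_face K E}"
  by (rule finite_subset[OF _ finite_polyhedron_faces[OF assms]])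
     (auto intro: cone_face_imp_face_of polyhedron_imp_convex assms)

text \<open>For \<open>v\<close> in the lineality space of the tangent cone both \<open>v\<close>
  and \<open>- v\<close> are critical, hence every functional in the polar of the critical cone
  vanishes at \<open>v\<close>.\<close>

lemma orthogonal_normal_cone_subset_cone_face:
  fixes D :: "(real^'s) set"
  assumes D: "polyhedron D" "d \<in> D" and l: "l \<in> normal_cone D d"
    and E: "cone_face (critical_cone D d l) E"
  shows "orthogonal_comp (normal_cone D d) \<subseteq> E"
proof
  fix v assume "v \<in> orthogonal_comp (normal_cone D d)"
  then have "\<forall>m\<in>normal_cone D d. inner m v = 0"
    by (simp add: orthogonal_comp_def Linear_Algebra.orthogonal_def)
  then have v: "v \<in> critical_cone D d l" and v': "- v \<in> critical_cone D d l"
    using l by (auto simp: critical_cone_def tangent_cone_iff_normal_cone[OF D] mem_orthogonal_comp_singleton)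
  obtain \<nu> where \<nu>: "\<nu> \<in> polar_cone (critical_cone D d l)" "E = critical_cone D d l \<inter> orthogonal_comp {\<nu>}"
    using E unfolding cone_face_def by blast
  have "inner \<nu> v \<le> 0" "inner \<nu> (- v) \<le> 0"
    using \<nu>(1) v v' unfolding polar_cone_def by blast+
  then show "v \<in> E" using v \<nu>(2) by (simp add: mem_orthogonal_comp_singleton)
qed

text \<open>Nondegeneracy bounds the adjoint Jacobian from below on
  \<open>span (normal_cone D d)\<close> only; this inclusion makes the bound available for the
  subspace \<open>M\<close> of every face.\<close>

lemma orthogonal_cone_face_subset_span:
  fixes D :: "(real^'s) set"
  assumes "polyhedron D" "d \<in> D" "l \<in> normal_cone D d" "cone_face (critical_cone D d l) E"
  shows "orthogonal_comp (span E) \<subseteq> span (normal_cone D d)"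
proof -
  have "orthogonal_comp (span E) \<subseteq> orthogonal_comp (orthogonal_comp (normal_cone D d))"
    using orthogonal_comp_anti_mono orthogonal_normal_cone_subset_cone_face[OF assms]
    by (simp add: orthogonal_comp_span)
  also have "\<dots> = span (normal_cone D d)"
    using orthogonal_comp_self[of "span (normal_cone D d)"] by (simp add: orthogonal_comp_span)
  finally show ?thesis .
qed

text \<open>This is the smallest face, the one that Algorithm A uses implicitly: the orthogonal
  complement of its span is \<open>span (normal_cone D d)\<close>, the range of the matrix
  \<open>W\<close> of the algorithm.\<close>

lemma cone_face_lineality:
  fixes D :: "(real^'s) set"
  assumes D: "polyhedron D" "d \<in> D" and l: "l \<in> normal_cone D d"
  shows "cone_face (critical_cone D d l) (orthogonal_comp (normal_cone D d))"
proof -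
  obtain \<nu> where \<nu>: "\<nu> \<in> normal_cone D d"
    "tangent_cone D d \<inter> orthogonal_comp {\<nu>} = orthogonal_comp (normal_cone D d)"
    using normal_cone_strict[OF D] .
  have "\<nu> \<in> polar_cone (critical_cone D d l)"
    using \<nu>(1) by (auto simp: polar_cone_def critical_cone_def tangent_cone_iff_normal_cone[OF D])
  moreover have "orthogonal_comp (normal_cone D d) \<subseteq> orthogonal_comp {l}"
    using l by (intro orthogonal_comp_anti_mono) auto
  then have "critical_cone D d l \<inter> orthogonal_comp {\<nu>} = orthogonal_comp (normal_cone D d)"
    using \<nu>(2) by (auto simp: critical_cone_def)
  ultimately show ?thesis
    by (auto simp: cone_face_def)
qed

text \<open>The critical cone is a face of the tangent cone, and there are finitely many faces. One
  that is not orthogonal to \<open>l0\<close> contains some \<open>v\<close> with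
  \<open><l0, v> \<noteq> 0\<close>; this persists for \<open>l\<close> near \<open>l0\<close>, so
  such a face cannot be the critical cone of \<open>l\<close>.\<close>

lemma critical_cone_multiplier_near:
  fixes D :: "(real^'s) set"
  assumes D: "polyhedron D" "d \<in> D"
  obtains \<rho> where "\<rho> > 0"
    "\<And>l. l \<in> normal_cone D d \<Longrightarrow> norm (l - l0) < \<rho> \<Longrightarrow> critical_cone D d l \<subseteq> orthogonal_comp {l0}"
proof -
  let ?T = "tangent_cone D d"
  let ?N = "{E. cone_face ?T E \<and> \<not> E \<subseteq> orthogonal_comp {l0}}"
  have "\<forall>\<^sub>F l in nhds l0. \<not> E \<subseteq> orthogonal_comp {l}" if E: "E \<in> ?N" for E
  proof -
    obtain v where v: "v \<in> E" "inner l0 v \<noteq> 0"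
      using E mem_orthogonal_comp_singleton by blast
    have "((\<lambda>l. inner l v) \<longlongrightarrow> inner l0 v) (nhds l0)"
      by (intro tendsto_intros filterlim_ident)
    then have "\<forall>\<^sub>F l in nhds l0. inner l v \<noteq> 0"
      using v(2) by (rule tendsto_imp_eventually_ne)
    then show ?thesis
      by (rule eventually_mono) (use v(1) in \<open>auto simp: mem_orthogonal_comp_singleton\<close>)
  qed
  moreover have "finite ?N"
    by (rule finite_subset[OF _ finite_cone_faces[OF polyhedron_tangent_cone[OF D]]]) auto
  ultimately have "\<forall>\<^sub>F l in nhds l0. \<forall>E\<in>?N. \<not> E \<subseteq> orthogonal_comp {l}"
    by (intro eventually_ball_finite) auto
  then obtain \<rho> where \<rho>: "\<rho> > 0" "\<And>l E. norm (l - l0) < \<rho> \<Longrightarrow> E \<in> ?N \<Longrightarrow> \<not> E \<subseteq> orthogonal_comp {l}"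
    by (auto simp: eventually_nhds_metric dist_norm)
  show thesis
  proof (rule that[OF \<rho>(1)])
    fix l assume l: "l \<in> normal_cone D d" "norm (l - l0) < \<rho>"
    have "l \<in> polar_cone ?T"
      using l(1) by (auto simp: polar_cone_def tangent_cone_iff_normal_cone[OF D])
    then have "cone_face ?T (critical_cone D d l)"
      by (auto simp: cone_face_def critical_cone_def)
    moreover have "critical_cone D d l \<subseteq> orthogonal_comp {l}"
      by (auto simp: critical_cone_def)
    ultimately show "critical_cone D d l \<subseteq> orthogonal_comp {l0}"
      using \<rho>(2)[OF l(2)] by blast
  qed
qed

text \<open>Close to the reference point the critical cone is \<open>E\<^sub>1 + \<real> (d - d\<^sub>0)\<close> with a face \<open>E\<^sub>1\<close> of the
  reference critical cone that contains \<open>d - d\<^sub>0\<close>, so that intersecting its faces with the tangent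
  cone at \<open>d\<^sub>0\<close> does not change their spans.\<close>

lemma cone_face_near:
  fixes D :: "(real^'s) set"
  assumes D: "polyhedron D" "d0 \<in> D" "d \<in> D"
    and sub: "normal_cone D d \<subseteq> normal_cone D d0" and l: "l \<in> normal_cone D d"
    and l0: "critical_cone D d0 l \<subseteq> orthogonal_comp {l0}" "l0 \<in> normal_cone D d0"
    and E: "cone_face (critical_cone D d l) E"
  shows "d - d0 \<in> E" "\<exists>E'. cone_face (critical_cone D d0 l0) E' \<and> span E' = span E"
    "E \<subseteq> orthogonal_comp {l}" "E \<subseteq> orthogonal_comp {l0}"
proof -
  let ?K = "critical_cone D d l" and ?TB = "tangent_cone D d0" and ?KB = "critical_cone D d0 l0"
  define t where "t = d - d0"
  obtain \<nu> where \<nu>: "\<nu> \<in> polar_cone ?K" "E = ?K \<inter> orthogonal_comp {\<nu>}"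
    using E unfolding cone_face_def by blast
  \<comment> \<open>A normal at \<open>d\<close> tested at \<open>d0\<close> gives one inequality;
    the same vector, being normal at \<open>d0\<close>, tested at \<open>d\<close> gives the
    other.\<close>
  have t0: "inner m t = 0" if "m \<in> normal_cone D d" for m
    using mem_normal_coneD[OF that D(2)] mem_normal_coneD[OF subsetD[OF sub that] D(3)]
    by (simp add: t_def inner_diff_right)
  have T0: "?TB \<subseteq> tangent_cone D d"
    using sub tangent_cone_iff_normal_cone[OF D(1,2)] tangent_cone_iff_normal_cone[OF D(1,3)] by blast
  have tT: "t \<in> ?TB" unfolding t_def by (rule diff_mem_tangent_cone[OF D(2,3)])
  have "t \<in> orthogonal_comp (normal_cone D d)"
    using t0 by (simp add: orthogonal_comp_def Linear_Algebra.orthogonal_def)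
  then have tE: "t \<in> E"
    using orthogonal_normal_cone_subset_cone_face[OF D(1,3) l E] by blast
  then show "d - d0 \<in> E" by (simp add: t_def)
  show El: "E \<subseteq> orthogonal_comp {l}"
    using \<nu>(2) by (auto simp: critical_cone_def)
  define E' where "E' = E \<inter> ?TB"
  \<comment> \<open>Orthogonality to \<open>l0\<close> comes for free from \<open>l0(1)\<close>, so
    the critical cone of \<open>l\<close> at \<open>d0\<close> is the part of \<open>?KB\<close> on
    which the nonpositive functional \<open>l\<close> vanishes, hence a face of
    \<open>?KB\<close>.\<close>
  have F1: "critical_cone D d0 l = ?KB \<inter> {v. inner l v = 0}"
    using l0(1) by (auto simp: critical_cone_def mem_orthogonal_comp_singleton)
  have E'eq: "E' = critical_cone D d0 l \<inter> {v. inner \<nu> v = 0}"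
    using \<nu>(2) T0 by (auto simp: E'_def critical_cone_def mem_orthogonal_comp_singleton)
  have lK0: "inner l v \<le> 0" if "v \<in> ?KB" for v
    using that l sub tangent_cone_iff_normal_cone[OF D(1,2)] by (auto simp: critical_cone_def)
  have conv: "convex (critical_cone D d0 m)" for m
    by (intro polyhedron_imp_convex polyhedron_critical_cone D)
  have "critical_cone D d0 l face_of ?KB"
    unfolding F1 using lK0 by (intro face_of_Int_supporting_hyperplane_le conv) auto
  moreover have "E' face_of critical_cone D d0 l"
    unfolding E'eq using \<nu>(1) T0
    by (intro face_of_Int_supporting_hyperplane_le conv) (auto simp: polar_cone_def critical_cone_def)
  ultimately have "E' face_of ?KB"
    by (blast intro: face_of_trans)
  moreover have "0 \<in> E'"
    using tangent_cone_iff_normal_cone[OF D(1,2)] by (simp add: E'eq critical_cone_def mem_orthogonal_comp_singleton)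
  ultimately have "cone_face ?KB E'"
    by (intro face_of_imp_cone_face polyhedron_critical_cone D)
  moreover have "span E' = span E"
  proof (rule subset_antisym)
    show "span E' \<subseteq> span E" by (rule span_mono) (simp add: E'_def)
    have "v \<in> span E'" if v: "v \<in> E" for v
    proof -
      have "v \<in> tangent_cone D d" using v \<nu>(2) by (simp add: critical_cone_def)
      \<comment> \<open>Although \<open>v\<close> need not be tangent at \<open>d0\<close>, the
        vector \<open>t + e v\<close> is, as the difference of \<open>d + e v \<in> D\<close> and
        \<open>d0\<close>. Subtracting \<open>t \<in> E'\<close> recovers \<open>v\<close> up to
        scaling.\<close>
      then obtain e where e: "e > 0" "d + e *\<^sub>R v \<in> D"
        using polyhedron_feasible_direction[OF D(1,3)] by blast
      have "(d + e *\<^sub>R v) - d0 \<in> ?TB"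
        by (rule diff_mem_tangent_cone[OF D(2) e(2)])
      moreover have "inner l v = 0" "inner \<nu> v = 0" "inner l t = 0" "inner \<nu> t = 0"
        using v tE El \<nu>(2) by (auto simp: mem_orthogonal_comp_singleton)
      ultimately have "t + e *\<^sub>R v \<in> E'"
        by (simp add: E'eq critical_cone_def mem_orthogonal_comp_singleton inner_add_right t_def algebra_simps)
      moreover have "t \<in> E'" using tE tT by (simp add: E'_def)
      ultimately have "(1 / e) *\<^sub>R ((t + e *\<^sub>R v) - t) \<in> span E'"
        by (intro span_scale span_diff span_base)
      then show ?thesis using e(1) by simp
    qed
    then show "span E \<subseteq> span E'" by (intro span_minimal) auto
  qed
  ultimately show ex: "\<exists>E'. cone_face ?KB E' \<and> span E' = span E" by blast
  have "E \<subseteq> span E'" using \<open>span E' = span E\<close> span_superset by blast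
  also have "span E' \<subseteq> orthogonal_comp {l0}"
    by (intro span_minimal subspace_orthogonal_comp) (use l0(1) E'eq in auto)
  finally show "E \<subseteq> orthogonal_comp {l0}" .
qed

section \<open>Local convergence of Newton-type methods\<close>

text \<open>The factor 1/2 keeps every run in the initial ball and makes it converge, so
  \<open>ex\<close> applies at each iterate reached; arbitrarily small factors along the tail give
  the little-o estimate.\<close>

lemma locally_superlinearI:
  fixes xbar :: "'a::real_normed_vector"
  assumes contr: "\<And>\<epsilon>. \<epsilon> > 0 \<Longrightarrow>
      \<exists>\<delta>>0. \<forall>x y. norm (x - xbar) < \<delta> \<longrightarrow> step x y \<longrightarrow> norm (y - xbar) \<le> \<epsilon> * norm (x - xbar)"
    and ex: "\<exists>\<delta>>0. \<forall>x. norm (x - xbar) < \<delta> \<longrightarrow> \<not> stop x \<longrightarrow> (\<exists>y. step x y)"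
  shows "locally_superlinear stop step xbar"
proof -
  obtain \<delta>1 where d1: "\<delta>1 > 0"
    "\<And>x y. norm (x - xbar) < \<delta>1 \<Longrightarrow> step x y \<Longrightarrow> norm (y - xbar) \<le> 1 / 2 * norm (x - xbar)"
    using contr[of "1 / 2"] by auto
  obtain \<delta>2 where d2: "\<delta>2 > 0" "\<And>x. norm (x - xbar) < \<delta>2 \<Longrightarrow> \<not> stop x \<Longrightarrow> \<exists>y. step x y"
    using ex by blast
  define \<delta> where "\<delta> = min \<delta>1 \<delta>2"
  have near: "norm (X k - xbar) \<le> (1 / 2) ^ k * norm (X 0 - xbar)"
    if "X 0 \<in> ball xbar \<delta>" "iterates_upto stop step X k" for X k
    using that(2)
  proof (induction k)
    case (Suc k)
    then have IH: "norm (X k - xbar) \<le> (1 / 2) ^ k * norm (X 0 - xbar)"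
      and st: "step (X k) (X (Suc k))"
      by (auto simp: iterates_upto_def)
    have "(1 / 2) ^ k * norm (X 0 - xbar) \<le> 1 * norm (X 0 - xbar)"
      by (intro mult_right_mono power_le_one) auto
    then have "norm (X k - xbar) < \<delta>1"
      using IH that(1) by (auto simp: \<delta>_def dist_norm norm_minus_commute)
    then show ?case
      using d1(2)[OF _ st] IH by simp
  qed simp
  have small: "norm (X k - xbar) < \<delta>" if "X 0 \<in> ball xbar \<delta>" "iterates_upto stop step X k" for X k
  proof -
    have "(1 / 2) ^ k * norm (X 0 - xbar) \<le> 1 * norm (X 0 - xbar)"
      by (intro mult_right_mono power_le_one) auto
    then show ?thesis
      using near[OF that] that(1) by (auto simp: dist_norm norm_minus_commute)
  qed
  show ?thesis
    unfolding locally_superlinear_def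
  proof (intro exI[of _ "ball xbar \<delta>"] conjI allI impI)
    show "xbar \<in> ball xbar \<delta>" using d1 d2 by (simp add: \<delta>_def)
  next
    fix X k assume "X 0 \<in> ball xbar \<delta> \<and> iterates_upto stop step X k \<and> \<not> stop (X k)"
    then show "\<exists>y. step (X k) y"
      using small[of X k] d2(2)[of "X k"] by (auto simp: \<delta>_def)
  next
    fix X assume X: "X 0 \<in> ball xbar \<delta> \<and> (\<forall>k. iterates_upto stop step X k)"
    have "(\<lambda>k. (1 / 2) ^ k * norm (X 0 - xbar)) \<longlonglongrightarrow> 0 * norm (X 0 - xbar)"
      by (intro tendsto_mult tendsto_const LIMSEQ_power_zero) auto
    then have "(\<lambda>k. (1 / 2) ^ k * norm (X 0 - xbar)) \<longlonglongrightarrow> 0" by simp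
    moreover have "norm (X k - xbar) \<le> (1 / 2) ^ k * norm (X 0 - xbar)" for k
      using near[of X k] X by blast
    ultimately have "(\<lambda>k. X k - xbar) \<longlonglongrightarrow> 0"
      by (rule Lim_null_comparison[OF always_eventually[OF allI], rotated])
    then have lim: "X \<longlonglongrightarrow> xbar"
      by (simp add: LIM_zero_iff)
    moreover have "(\<lambda>k. norm (X (Suc k) - xbar)) \<in> o(\<lambda>k. norm (X k - xbar))"
    proof (rule landau_o.smallI)
      fix c :: real assume "c > 0"
      then obtain \<eta> where \<eta>: "\<eta> > 0"
        "\<And>x y. norm (x - xbar) < \<eta> \<Longrightarrow> step x y \<Longrightarrow> norm (y - xbar) \<le> c * norm (x - xbar)"
        using contr by blast
      have "\<forall>\<^sub>F k in sequentially. norm (X k - xbar) < \<eta>"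
        using tendstoD[OF lim \<eta>(1)] by (simp add: dist_norm)
      then show "\<forall>\<^sub>F k in sequentially. norm (norm (X (Suc k) - xbar)) \<le> c * norm (norm (X k - xbar))"
      proof (rule eventually_mono)
        fix k assume k: "norm (X k - xbar) < \<eta>"
        have "step (X k) (X (Suc k))"
          using X unfolding iterates_upto_def by (metis lessI)
        then show "norm (norm (X (Suc k) - xbar)) \<le> c * norm (norm (X k - xbar))"
          using \<eta>(2)[OF k] by simp
      qed
    qed
    ultimately show "superlinear X xbar" by (simp add: superlinear_def)
  qed simp
qed

section \<open>Uniform invertibility and contraction for the general G-semismooth Newton
  method\<close>

lemma compact_injective_blinfuns_bounded_below:
  fixes T :: "('a::euclidean_space \<Rightarrow>\<^sub>L 'a) set"
  assumes "compact T" "\<And>V h. V \<in> T \<Longrightarrow> blinfun_apply V h = 0 \<Longrightarrow> h = 0"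
  obtains c where "c > 0" "\<And>V h. V \<in> T \<Longrightarrow> c * norm h \<le> norm (blinfun_apply V h)"
proof (cases "T = {}")
  case True
  then show thesis using that[of 1] by auto
next
  case False
  let ?S = "T \<times> sphere (0::'a) 1"
  have "compact ?S" using assms(1) by (intro compact_Times) auto
  moreover have "?S \<noteq> {}"
    using False vector_choose_size[of 1, where ?'a = 'a] by force
  moreover have "continuous_on ?S (\<lambda>p. norm (blinfun_apply (fst p) (snd p)))"
    by (intro continuous_intros)
  ultimately obtain p where p: "p \<in> ?S" 
    "\<And>q. q \<in> ?S \<Longrightarrow> norm (blinfun_apply (fst p) (snd p)) \<le> norm (blinfun_apply (fst q) (snd q))"
    using continuous_attains_inf[of ?S] by blast
  define c where "c = norm (blinfun_apply (fst p) (snd p))"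
  have "c > 0"
    using p(1) assms(2)[of "fst p" "snd p"] by (auto simp: c_def)
  moreover have "c * norm h \<le> norm (blinfun_apply V h)" if "V \<in> T" for V h
  proof (cases "h = 0")
    case False
    have "c \<le> norm (blinfun_apply V ((1 / norm h) *\<^sub>R h))"
      using p(2)[of "(V, (1 / norm h) *\<^sub>R h)"] that False by (simp add: c_def)
    also have "\<dots> = norm (blinfun_apply V h) / norm h"
      by (simp add: blinfun.scaleR_right)
    finally show ?thesis using False by (simp add: field_simps)
  qed simp
  ultimately show thesis using that by blast
qed

text \<open>By compactness and outer semicontinuity all operators that the method may use near the
  solution are uniformly bounded below, and the new error is controlled by the semismoothness
  remainder.\<close>

lemma gss_newton_local:
  fixes xbar :: "'a::euclidean_space"
  assumes hyps: "gss_newton_hyps \<Omega> H T xbar" and \<rho>: "\<rho> \<ge> 0"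
  obtains c where "c > 0"
    "\<And>\<epsilon>. \<epsilon> > 0 \<Longrightarrow> \<exists>\<delta>>0. \<forall>x. norm (x - xbar) < \<delta> \<longrightarrow> x \<in> \<Omega> \<and>
       (\<forall>V. dist_le V (T x) (\<rho> * norm (H x)) \<longrightarrow>
          (\<forall>h. c * norm h \<le> norm (blinfun_apply V h)) \<and>
          norm (H x - blinfun_apply V (x - xbar)) \<le> \<epsilon> * norm (x - xbar))"
proof -
  have op: "open \<Omega>" "xbar \<in> \<Omega>" and H0: "H xbar = 0" and lip: "locally_lipschitz_on \<Omega> H"
    and semi: "G_semismooth_at \<Omega> H T xbar" and cpt: "\<And>x. x \<in> \<Omega> \<Longrightarrow> compact (T x)"
    and osc: "outer_semicont_at \<Omega> T xbar"
    and inv: "\<And>V. V \<in> T xbar \<Longrightarrow> \<exists>V'. V o\<^sub>L V' = id_blinfun \<and> V' o\<^sub>L V = id_blinfun"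
    using hyps by (auto simp: gss_newton_hyps_def)
  have inj: "h = 0" if "V \<in> T xbar" "blinfun_apply V h = 0" for V h
  proof -
    obtain V' where "V' o\<^sub>L V = id_blinfun" using inv[OF \<open>V \<in> T xbar\<close>] by blast
    then have "blinfun_apply V' (blinfun_apply V h) = h"
      by (metis blinfun_apply_blinfun_compose blinfun_apply_id_blinfun id_apply)
    then show ?thesis using that(2) by simp
  qed
  obtain c where c: "c > 0" "\<And>V h. V \<in> T xbar \<Longrightarrow> c * norm h \<le> norm (blinfun_apply V h)"
    by (rule compact_injective_blinfuns_bounded_below[OF cpt[OF op(2)]]) (auto intro: inj)
  obtain r L where r: "r > 0" "L-lipschitz_on (cball xbar r \<inter> \<Omega>) H"
    using lip op(2) by (auto simp: locally_lipschitz_on_def)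
  have L0: "L \<ge> 0" using r(2) by (rule lipschitz_on_nonneg)
  obtain s where s: "s > 0" "ball xbar s \<subseteq> \<Omega>" using op by (meson open_contains_ball)
  have HL: "norm (H x) \<le> L * norm (x - xbar)" if "norm (x - xbar) < min r s" for x
  proof -
    have "x \<in> cball xbar r \<inter> \<Omega>" "xbar \<in> cball xbar r \<inter> \<Omega>"
      using that s r op by (auto simp: dist_norm norm_minus_commute)
    then have "dist (H x) (H xbar) \<le> L * dist x xbar"
      using r(2) by (auto simp: lipschitz_on_def)
    then show ?thesis by (simp add: H0 dist_norm)
  qed
  \<comment> \<open>Two deviations of \<open>c / 4\<close> add up to \<open>c / 2\<close>: from the
    operator used to the nearest element of \<open>T x\<close>, and from there to
    \<open>T xbar\<close>. Half of the lower bound \<open>c\<close> survives.\<close>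
  obtain \<delta>1 where \<delta>1: "\<delta>1 > 0"
    "\<And>x. x \<in> \<Omega> \<Longrightarrow> norm (x - xbar) \<le> \<delta>1 \<Longrightarrow> T x \<subseteq> (\<Union>V\<in>T xbar. cball V (c / 4))"
    using osc c(1) unfolding outer_semicont_at_def by (metis divide_pos_pos zero_less_numeral)
  show thesis
  proof (rule that[of "c / 2"])
    fix \<epsilon> :: real assume \<epsilon>: "\<epsilon> > 0"
    obtain \<delta>2 where \<delta>2: "\<delta>2 > 0" "\<And>h V. norm h \<le> \<delta>2 \<Longrightarrow> xbar + h \<in> \<Omega> \<Longrightarrow> V \<in> T (xbar + h) \<Longrightarrow>
        norm (H (xbar + h) - H xbar - blinfun_apply V h) \<le> \<epsilon> / 2 * norm h"
      using semi \<epsilon> unfolding G_semismooth_at_def by (meson half_gt_zero)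
    \<comment> \<open>The Lipschitz bound turns the admissible error
      \<open>\<rho> * norm (H x)\<close> into \<open>\<rho> * L * norm (x - xbar)\<close>, which
      this radius keeps below \<open>c / 4\<close> and \<open>\<epsilon> / 2\<close>; the
      \<open>+ 1\<close> avoids a zero denominator.\<close>
    define \<delta>3 where "\<delta>3 = min (c / 4) (\<epsilon> / 2) / (\<rho> * L + 1)"
    have pos: "\<rho> * L + 1 > 0" using \<rho> L0 by (simp add: add_nonneg_pos)
    have \<delta>3: "\<delta>3 > 0" using c(1) \<epsilon> pos by (simp add: \<delta>3_def)
    define \<delta> where "\<delta> = Min {r, s, \<delta>1, \<delta>2, \<delta>3}"
    show "\<exists>\<delta>>0. \<forall>x. norm (x - xbar) < \<delta> \<longrightarrow> x \<in> \<Omega> \<and>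
       (\<forall>V. dist_le V (T x) (\<rho> * norm (H x)) \<longrightarrow>
          (\<forall>h. c / 2 * norm h \<le> norm (blinfun_apply V h)) \<and>
          norm (H x - blinfun_apply V (x - xbar)) \<le> \<epsilon> * norm (x - xbar))"
    proof (intro exI[of _ \<delta>] conjI allI impI)
      show "\<delta> > 0" using r s \<delta>1 \<delta>2 \<delta>3 by (simp add: \<delta>_def)
      fix x assume "norm (x - xbar) < \<delta>"
      then have x: "norm (x - xbar) < r" "norm (x - xbar) < s" "norm (x - xbar) < \<delta>1"
          "norm (x - xbar) < \<delta>2" "norm (x - xbar) < \<delta>3"
        by (auto simp: \<delta>_def)
      show x\<Omega>: "x \<in> \<Omega>" using s x(2) by (auto simp: dist_norm norm_minus_commute)
      fix V assume V: "dist_le V (T x) (\<rho> * norm (H x))"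
      have "closed (T x)" "T x \<noteq> {}" using V cpt[OF x\<Omega>] by (auto simp: dist_le_def compact_imp_closed)
      then obtain V0 where V0: "V0 \<in> T x" "infdist V (T x) = dist V V0"
        using infdist_attains_inf by blast
      have "norm (V - V0) \<le> \<rho> * norm (H x)"
        using V V0 by (simp add: dist_le_def dist_norm)
      also have "\<dots> \<le> \<rho> * (L * norm (x - xbar))"
        using HL x \<rho> by (intro mult_left_mono) auto
      also have "\<dots> = (\<rho> * L) * norm (x - xbar)" by simp
      also have "\<dots> \<le> (\<rho> * L + 1) * \<delta>3"
        using x(5) pos by (intro mult_mono) auto
      also have "\<dots> = min (c / 4) (\<epsilon> / 2)" using pos by (simp add: \<delta>3_def)
      finally have VV: "norm (V - V0) \<le> c / 4" "norm (V - V0) \<le> \<epsilon> / 2" by auto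
      obtain V1 where V1: "V1 \<in> T xbar" "norm (V1 - V0) \<le> c / 4"
        using \<delta>1(2)[OF x\<Omega>] x(3) V0(1) by (fastforce simp: dist_norm)
      show "c / 2 * norm h \<le> norm (blinfun_apply V h)" for h
      proof -
        have "c * norm h \<le> norm (blinfun_apply V1 h)" by (rule c(2)[OF V1(1)])
        also have "\<dots> \<le> norm (blinfun_apply V h) + norm (blinfun_apply (V1 - V) h)"
          by (metis blinfun.diff_left norm_triangle_sub)
        also have "norm (blinfun_apply (V1 - V) h) \<le> c / 2 * norm h"
        proof -
          have "norm (V1 - V) \<le> c / 2"
            using V1(2) VV(1) norm_triangle_ineq4[of "V1 - V0" "V - V0"] by simp
          then show ?thesis
            using norm_blinfun[of "V1 - V" h] by (meson mult_right_mono norm_ge_zero order_trans)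
        qed
        finally show ?thesis by simp
      qed
      have "norm (H x - blinfun_apply V (x - xbar))
          \<le> norm (H x - blinfun_apply V0 (x - xbar)) + norm (blinfun_apply (V - V0) (x - xbar))"
        using norm_triangle_ineq4[of "H x - blinfun_apply V0 (x - xbar)" "blinfun_apply (V - V0) (x - xbar)"]
        by (simp add: blinfun.diff_left)
      also have "norm (H x - blinfun_apply V0 (x - xbar)) \<le> \<epsilon> / 2 * norm (x - xbar)"
        using \<delta>2(2)[of "x - xbar" V0] x(4) V0(1) x\<Omega> by (simp add: H0)
      also have "norm (blinfun_apply (V - V0) (x - xbar)) \<le> \<epsilon> / 2 * norm (x - xbar)"
        using norm_blinfun[of "V - V0" "x - xbar"] VV(2) by (meson mult_right_mono norm_ge_zero order_trans)
      finally show "norm (H x - blinfun_apply V (x - xbar)) \<le> \<epsilon> * norm (x - xbar)" by simp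
    qed
  qed (use c(1) in simp)
qed

text \<open>The identity \<open>V (y - xbar) = - (H x - V (x - xbar))\<close> and the lower bound
  \<open>c\<close> for \<open>V\<close> turn the linearization error at \<open>x\<close> into a
  bound for the new error; the former is requested with \<open>\<epsilon> * c\<close> to absorb the
  division by \<open>c\<close>.\<close>

lemma gss_newton_contraction:
  fixes xbar :: "'a::euclidean_space"
  assumes hyps: "gss_newton_hyps \<Omega> H T xbar" and \<rho>: "\<rho> \<ge> 0" and \<epsilon>: "\<epsilon> > 0"
  shows "\<exists>\<delta>>0. \<forall>x y. norm (x - xbar) < \<delta> \<longrightarrow> gss_newton_step \<Omega> H T \<rho> x y \<longrightarrow>
      norm (y - xbar) \<le> \<epsilon> * norm (x - xbar)"
proof -
  obtain c where c: "c > 0"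
    "\<And>\<epsilon>. \<epsilon> > 0 \<Longrightarrow> \<exists>\<delta>>0. \<forall>x. norm (x - xbar) < \<delta> \<longrightarrow> x \<in> \<Omega> \<and>
       (\<forall>V. dist_le V (T x) (\<rho> * norm (H x)) \<longrightarrow>
          (\<forall>h. c * norm h \<le> norm (blinfun_apply V h)) \<and>
          norm (H x - blinfun_apply V (x - xbar)) \<le> \<epsilon> * norm (x - xbar))"
    using gss_newton_local[OF hyps \<rho>] by blast
  obtain \<delta> where \<delta>: "\<delta> > 0" "\<And>x V. norm (x - xbar) < \<delta> \<Longrightarrow> dist_le V (T x) (\<rho> * norm (H x)) \<Longrightarrow>
      (\<forall>h. c * norm h \<le> norm (blinfun_apply V h)) \<and>
      norm (H x - blinfun_apply V (x - xbar)) \<le> \<epsilon> * c * norm (x - xbar)"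
    using c(2)[of "\<epsilon> * c"] c(1) \<epsilon> by auto
  have "norm (y - xbar) \<le> \<epsilon> * norm (x - xbar)"
    if x: "norm (x - xbar) < \<delta>" and st: "gss_newton_step \<Omega> H T \<rho> x y" for x y
  proof -
    obtain V \<Delta> where V: "dist_le V (T x) (\<rho> * norm (H x))" "blinfun_apply V \<Delta> = - H x" "y = x + \<Delta>"
      using st by (auto simp: gss_newton_step_def)
    have "blinfun_apply V (y - xbar) = - (H x - blinfun_apply V (x - xbar))"
      by (simp add: V(2,3) blinfun.diff_right blinfun.add_right algebra_simps)
    then have "c * norm (y - xbar) \<le> c * (\<epsilon> * norm (x - xbar))"
      using \<delta>(2)[OF x V(1)] by (metis mult.assoc mult.commute norm_minus_cancel order_trans)
    then show ?thesis using c(1) by (rule mult_left_le_imp_le)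
  qed
  then show ?thesis using \<delta>(1) by blast
qed

section \<open>Smooth data\<close>

text \<open>The Hilbert space adjoint, in coordinates. Unlike the matrix \<open>grad\<close>, it is
  a bounded bilinear expression in operator and vector, so that norm estimates and the product rule
  apply to \<open>\<nabla>G x l\<close>.\<close>

definition adj :: "('a::euclidean_space \<Rightarrow>\<^sub>L 'b::real_inner) \<Rightarrow> 'b \<Rightarrow> 'a" where
  "adj B l = (\<Sum>i\<in>Basis. inner l (blinfun_apply B i) *\<^sub>R i)"

lemma inner_adj: "inner (adj B l) u = inner l (blinfun_apply B u)"
proof -
  have "inner l (blinfun_apply B u) = inner l (blinfun_apply B (\<Sum>i\<in>Basis. inner u i *\<^sub>R i))"
    by (simp add: euclidean_representation)
  also have "\<dots> = (\<Sum>i\<in>Basis. inner u i * inner l (blinfun_apply B i))"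
    by (simp add: blinfun.sum_right blinfun.scaleR_right inner_sum_right del: euclidean_representation)
  finally show ?thesis
    by (simp add: adj_def inner_sum_left inner_commute[of u] mult.commute)
qed

lemma adj_unique:
  assumes "\<And>u. inner v u = inner l (blinfun_apply B u)"
  shows "adj B l = v"
proof -
  have "\<forall>u. inner (adj B l) u = inner v u"
    by (simp add: assms inner_adj)
  then show ?thesis by (simp only: vector_eq_rdot)
qed

lemma norm_adj: "norm (adj B l) \<le> norm B * norm l"
proof (cases "adj B l = 0")
  case False
  have "norm (adj B l) * norm (adj B l) = inner l (blinfun_apply B (adj B l))"
    by (metis inner_adj power2_eq_square power2_norm_eq_inner)
  also have "\<dots> \<le> norm l * norm (blinfun_apply B (adj B l))"
    by (rule norm_cauchy_schwarz)
  also have "\<dots> \<le> norm l * (norm B * norm (adj B l))"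
    by (intro mult_left_mono norm_blinfun norm_ge_zero)
  finally have "norm (adj B l) * norm (adj B l) \<le> (norm B * norm l) * norm (adj B l)"
    by (simp add: mult_ac)
  then show ?thesis using False by simp
qed simp

interpretation adj: bounded_bilinear "adj :: ('a::euclidean_space \<Rightarrow>\<^sub>L 'b::real_inner) \<Rightarrow> 'b \<Rightarrow> 'a"
proof
  show "\<exists>K. \<forall>(a::'a \<Rightarrow>\<^sub>L 'b) b. norm (adj a b) \<le> norm a * norm b * K"
    by (intro exI[of _ 1]) (simp add: norm_adj)
qed (rule adj_unique; simp add: inner_adj inner_add_left inner_add_right blinfun.add_left
    blinfun.scaleR_left)+

lemma Jac_mult:
  assumes "(f has_derivative f') (at x)"
  shows "Jac f x *v h = f' h"
proof -
  have "linear f'" using assms has_derivative_linear by blast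
  then show ?thesis
    by (simp add: Jac_def jacobian_def matrix_works flip: frechet_derivative_at[OF assms])
qed

lemma grad_mult:
  assumes "(f has_derivative blinfun_apply f') (at x)"
  shows "grad f x *v l = adj f' l"
  by (rule adj_unique[symmetric]) (simp add: grad_def inner_transpose_mult Jac_mult[OF assms])

text \<open>The derivative is taken at the moving point \<open>x\<close>, as semismoothness
  requires; continuity of \<open>f'\<close> at \<open>a\<close> pays for the exchange.\<close>

lemma taylor_at_moving_point:
  fixes f :: "'a::real_normed_vector \<Rightarrow> 'b::real_normed_vector" and f' :: "'a \<Rightarrow> 'a \<Rightarrow>\<^sub>L 'b"
  assumes "(f has_derivative blinfun_apply (f' a)) (at a)" "isCont f' a" "\<epsilon> > 0"
  shows "\<forall>\<^sub>F x in nhds a. norm (f x - f a - blinfun_apply (f' x) (x - a)) \<le> \<epsilon> * norm (x - a)"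
proof -
  obtain \<delta> where \<delta>: "\<delta> > 0"
      "\<And>x. norm (x - a) < \<delta> \<Longrightarrow> norm (f x - f a - blinfun_apply (f' a) (x - a)) \<le> \<epsilon> / 2 * norm (x - a)"
    using assms(1,3) unfolding has_derivative_at_alt by (meson half_gt_zero)
  then have "\<forall>\<^sub>F x in nhds a. norm (f x - f a - blinfun_apply (f' a) (x - a)) \<le> \<epsilon> / 2 * norm (x - a)"
    by (auto simp: eventually_nhds_metric dist_norm)
  moreover have "\<forall>\<^sub>F x in nhds a. norm (f' x - f' a) < \<epsilon> / 2"
    using assms(2,3) tendstoD[of f' "f' a" "nhds a" "\<epsilon> / 2"]
    by (simp add: dist_norm continuous_at_imp_continuous_within isCont_def tendsto_nhds_iff)
  ultimately show ?thesis
  proof eventually_elim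
    case (elim x)
    have "norm (blinfun_apply (f' x - f' a) (x - a)) \<le> \<epsilon> / 2 * norm (x - a)"
      using norm_blinfun[of "f' x - f' a" "x - a"] elim(2)
      by (meson less_imp_le mult_right_mono norm_ge_zero order_trans)
    moreover have eq: "f x - f a - blinfun_apply (f' x) (x - a)
        = (f x - f a - blinfun_apply (f' a) (x - a)) - blinfun_apply (f' x - f' a) (x - a)"
      by (simp add: blinfun.diff_left)
    ultimately show ?case
      unfolding eq using elim(1) norm_triangle_ineq4[of "f x - f a - blinfun_apply (f' a) (x - a)"
          "blinfun_apply (f' x - f' a) (x - a)"] by simp
  qed
qed

lemma C1_bound_on_cball:
  fixes f :: "'a::euclidean_space \<Rightarrow> 'b::real_normed_vector" and f' :: "'a \<Rightarrow> 'a \<Rightarrow>\<^sub>L 'b"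
  assumes "\<And>x. (f has_derivative blinfun_apply (f' x)) (at x)" "continuous_on UNIV f'"
  obtains C where "C > 0" "\<And>x. x \<in> cball a r \<Longrightarrow> norm (f' x) \<le> C"
    "\<And>x y. x \<in> cball a r \<Longrightarrow> y \<in> cball a r \<Longrightarrow> norm (f x - f y) \<le> C * norm (x - y)"
proof -
  have "compact (f' ` cball a r)"
    by (intro compact_continuous_image continuous_on_subset[OF assms(2)]) auto
  then obtain C where C: "C > 0" "\<And>x. x \<in> cball a r \<Longrightarrow> norm (f' x) \<le> C"
    using compact_imp_bounded[of "f' ` cball a r"] unfolding bounded_pos by auto
  moreover have "norm (f x - f y) \<le> C * norm (x - y)" if "x \<in> cball a r" "y \<in> cball a r" for x y
    by (rule differentiable_bound[of "cball a r" f "\<lambda>x. blinfun_apply (f' x)"])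
       (use C(2) that in \<open>auto simp: norm_blinfun.rep_eq[symmetric] intro: has_derivative_at_withinI assms(1)\<close>)
  ultimately show thesis using that by blast
qed

text \<open>Derivatives are parameters with values in bounded linear maps, whose norm carries the
  continuity and Lipschitz estimates; \<open>xbar\<close> fixes the ball on which these are
  uniform.\<close>

locale smooth_data =
  fixes F :: "real^'n \<Rightarrow> real^'n" and G :: "real^'n \<Rightarrow> real^'s"
    and f' :: "real^'n \<Rightarrow> (real^'n) \<Rightarrow>\<^sub>L (real^'n)"
    and g' :: "real^'n \<Rightarrow> (real^'n) \<Rightarrow>\<^sub>L (real^'s)"
    and g'' :: "real^'n \<Rightarrow> (real^'n) \<Rightarrow>\<^sub>L ((real^'n) \<Rightarrow>\<^sub>L (real^'s))"
    and xbar :: "real^'n"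
  assumes F': "\<And>x. (F has_derivative blinfun_apply (f' x)) (at x)" and f'_cont: "continuous_on UNIV f'"
    and G': "\<And>x. (G has_derivative blinfun_apply (g' x)) (at x)"
    and G'': "\<And>x. (g' has_derivative blinfun_apply (g'' x)) (at x)" and g''_cont: "continuous_on UNIV g''"
begin

lemma Jac_G: "Jac G x *v u = blinfun_apply (g' x) u"
  by (rule Jac_mult[OF G'])

lemma grad_G: "grad G x *v l = adj (g' x) l"
  by (rule grad_mult[OF G'])

lemma dLag_mult: "dLag F G l x *v h = blinfun_apply (f' x) h + adj (blinfun_apply (g'' x) h) l"
proof -
  have "((\<lambda>x. F x + adj (g' x) l) has_derivative (\<lambda>h. blinfun_apply (f' x) h + adj (blinfun_apply (g'' x) h) l)) (at x)"
    using has_derivative_add[OF F' adj.FDERIV[OF G'' has_derivative_const[of l]]] by (simp add: adj.zero_right)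
  moreover have "Lag F G l = (\<lambda>x. F x + adj (g' x) l)"
    by (simp add: Lag_def grad_G fun_eq_iff)
  ultimately show ?thesis by (simp add: dLag_def Jac_mult)
qed

lemma lin_G_eq: "lin_G G u x = G x + blinfun_apply (g' x) u"
  by (simp add: lin_G_def Jac_G)

text \<open>The second summand, of order \<open>norm u * norm h\<close>, is the one that Algorithm A
  leaves out.\<close>

lemma Jac_lin_G_mult:
  "Jac (lin_G G u) x *v h = blinfun_apply (g' x) h + blinfun_apply (blinfun_apply (g'' x) h) u"
proof -
  have "((\<lambda>x. G x + blinfun_apply (g' x) u) has_derivative
      (\<lambda>h. blinfun_apply (g' x) h + blinfun_apply (blinfun_apply (g'' x) h) u)) (at x)"
    using has_derivative_add[OF G' blinfun.FDERIV[OF G'' has_derivative_const[of u]]]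
    by (simp add: blinfun.zero_right)
  moreover have "lin_G G u = (\<lambda>x. G x + blinfun_apply (g' x) u)"
    by (simp add: lin_G_eq fun_eq_iff)
  ultimately show ?thesis by (simp add: Jac_mult)
qed

lemma g'_cont: "continuous_on UNIV g'"
  using has_derivative_continuous[OF G''] by (simp add: continuous_on_eq_continuous_at)

lemma uniform_bounds:
  obtains C where "C > 0"
    "\<And>x. x \<in> cball xbar 1 \<Longrightarrow> norm (f' x) \<le> C \<and> norm (g' x) \<le> C \<and> norm (g'' x) \<le> C"
    "\<And>x y. x \<in> cball xbar 1 \<Longrightarrow> y \<in> cball xbar 1 \<Longrightarrow> norm (F x - F y) \<le> C * norm (x - y)
       \<and> norm (G x - G y) \<le> C * norm (x - y) \<and> norm (g' x - g' y) \<le> C * norm (x - y)"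
proof -
  obtain C1 where C1: "C1 > 0" "\<And>x. x \<in> cball xbar 1 \<Longrightarrow> norm (f' x) \<le> C1"
    "\<And>x y. x \<in> cball xbar 1 \<Longrightarrow> y \<in> cball xbar 1 \<Longrightarrow> norm (F x - F y) \<le> C1 * norm (x - y)"
    using C1_bound_on_cball[OF F' f'_cont] by blast
  obtain C2 where C2: "C2 > 0" "\<And>x. x \<in> cball xbar 1 \<Longrightarrow> norm (g' x) \<le> C2"
    "\<And>x y. x \<in> cball xbar 1 \<Longrightarrow> y \<in> cball xbar 1 \<Longrightarrow> norm (G x - G y) \<le> C2 * norm (x - y)"
    using C1_bound_on_cball[OF G' g'_cont] by blast
  obtain C3 where C3: "C3 > 0" "\<And>x. x \<in> cball xbar 1 \<Longrightarrow> norm (g'' x) \<le> C3"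
    "\<And>x y. x \<in> cball xbar 1 \<Longrightarrow> y \<in> cball xbar 1 \<Longrightarrow> norm (g' x - g' y) \<le> C3 * norm (x - y)"
    using C1_bound_on_cball[OF G'' g''_cont] by blast
  have le: "C1 * norm z \<le> (C1 + C2 + C3) * norm z" "C2 * norm z \<le> (C1 + C2 + C3) * norm z"
    "C3 * norm z \<le> (C1 + C2 + C3) * norm z" for z :: "real^'n"
    using C1(1) C2(1) C3(1) by (auto intro!: mult_right_mono)
  show thesis
  proof (rule that[of "C1 + C2 + C3"])
    fix x assume x: "x \<in> cball xbar 1"
    show "norm (f' x) \<le> C1 + C2 + C3 \<and> norm (g' x) \<le> C1 + C2 + C3 \<and> norm (g'' x) \<le> C1 + C2 + C3"
      using C1(1) C2(1) C3(1) C1(2)[OF x] C2(2)[OF x] C3(2)[OF x] by simp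
    fix y assume y: "y \<in> cball xbar 1"
    show "norm (F x - F y) \<le> (C1 + C2 + C3) * norm (x - y)
       \<and> norm (G x - G y) \<le> (C1 + C2 + C3) * norm (x - y) \<and> norm (g' x - g' y) \<le> (C1 + C2 + C3) * norm (x - y)"
      using C1(3)[OF x y] C2(3)[OF x y] C3(3)[OF x y] le[of "x - y"] by (meson order_trans)
  qed (use C1 C2 C3 in simp)
qed

lemma derivatives_near:
  assumes "\<epsilon> > 0"
  shows "\<forall>\<^sub>F x in nhds xbar. norm (f' x - f' xbar) \<le> \<epsilon>" "\<forall>\<^sub>F x in nhds xbar. norm (g' x - g' xbar) \<le> \<epsilon>"
    "\<forall>\<^sub>F x in nhds xbar. norm (g'' x - g'' xbar) \<le> \<epsilon>"
proof -
  have "\<forall>\<^sub>F x in nhds xbar. norm (h x - h xbar) \<le> \<epsilon>" if "continuous_on UNIV h"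
    for h :: "real^'n \<Rightarrow> 'c::real_normed_vector"
  proof -
    have "isCont h xbar" using that by (simp add: continuous_on_eq_continuous_at)
    then have "\<forall>\<^sub>F x in nhds xbar. dist (h x) (h xbar) < \<epsilon>"
      using assms by (intro tendstoD) (simp_all add: isCont_def tendsto_nhds_iff)
    then show ?thesis by (rule eventually_mono) (simp add: dist_norm)
  qed
  then show "\<forall>\<^sub>F x in nhds xbar. norm (f' x - f' xbar) \<le> \<epsilon>" "\<forall>\<^sub>F x in nhds xbar. norm (g' x - g' xbar) \<le> \<epsilon>"
    "\<forall>\<^sub>F x in nhds xbar. norm (g'' x - g'' xbar) \<le> \<epsilon>"
    using f'_cont g'_cont g''_cont by blast+
qed

lemma taylor_near:
  assumes "\<epsilon> > 0"
  shows "\<forall>\<^sub>F x in nhds xbar. norm (F x - F xbar - blinfun_apply (f' x) (x - xbar)) \<le> \<epsilon> * norm (x - xbar)"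
    "\<forall>\<^sub>F x in nhds xbar. norm (G x - G xbar - blinfun_apply (g' x) (x - xbar)) \<le> \<epsilon> * norm (x - xbar)"
    "\<forall>\<^sub>F x in nhds xbar. norm (g' x - g' xbar - blinfun_apply (g'' x) (x - xbar)) \<le> \<epsilon> * norm (x - xbar)"
  using f'_cont g'_cont g''_cont assms
  by (auto intro!: taylor_at_moving_point F' G' G'' simp: continuous_on_eq_continuous_at)

end

section \<open>The approximation step\<close>

lemma closed_injective_linear_image_on_span:
  fixes f :: "'a::euclidean_space \<Rightarrow> 'b::euclidean_space"
  assumes f: "linear f" "inj_on f (span S)" and S: "closed S"
  shows "closed (f ` S)"
proof -
  obtain g where g: "linear g" "\<And>x. x \<in> span S \<Longrightarrow> g (f x) = x"
    using linear_inj_on_left_inverse[OF f] by blast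
  have "f ` S = f ` span S \<inter> g -` S"
    using g(2) by (auto simp: span_base)
  moreover have "closed (f ` span S)"
    by (intro closed_subspace linear_subspace_image f subspace_span)
  moreover have "closed (g -` S)"
    using continuous_closed_vimage[OF S] g(1) linear_continuous_at linear_conv_bounded_linear by blast
  ultimately show ?thesis by auto
qed

lemma normal_cone_closed_convex_cone:
  shows "closed (normal_cone D d)" "convex (normal_cone D d)"
    "l \<in> normal_cone D d \<Longrightarrow> r \<ge> 0 \<Longrightarrow> r *\<^sub>R l \<in> normal_cone D d"
    "d \<in> D \<Longrightarrow> 0 \<in> normal_cone D d"
proof -
  have eq: "normal_cone D d = (if d \<in> D then \<Inter>y\<in>D. {l. inner (y - d) l \<le> 0} else {})"
    by (auto simp: normal_cone_def inner_commute)
  show "closed (normal_cone D d)" unfolding eq by (auto intro!: closed_INT closed_halfspace_le)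
  show "convex (normal_cone D d)" unfolding eq by (auto intro!: convex_INT convex_halfspace_le)
qed (auto simp: normal_cone_def mult_nonneg_nonpos split: if_splits)

context smooth_data
begin

lemma feasible_set_closed_convex:
  assumes D: "polyhedron D"
  shows "closed {u. lin_G G u x \<in> D}" "convex {u. lin_G G u x \<in> D}"
proof -
  let ?C = "{u. lin_G G u x \<in> D}"
  have C: "?C = (\<lambda>u. G x + blinfun_apply (g' x) u) -` D" by (auto simp: lin_G_eq)
  show "closed ?C" unfolding C
    by (intro continuous_closed_vimage polyhedron_imp_closed D continuous_intros)
  show "convex ?C"
    using polyhedron_imp_convex[OF D] unfolding convex_def
  proof (intro ballI allI impI, goal_cases)
    case (1 a b s t)
    have "lin_G G (s *\<^sub>R a + t *\<^sub>R b) x = s *\<^sub>R lin_G G a x + t *\<^sub>R lin_G G b x"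
      using 1(6) by (simp add: lin_G_eq blinfun.add_right blinfun.scaleR_right algebra_simps
          flip: scaleR_add_left)
    then show ?case using 1 by simp
  qed
qed

text \<open>Up to a constant the objective is half the squared distance to \<open>- F x\<close>, so
  a solution is a projection of \<open>- F x\<close> onto a closed convex set and the inequality is
  the one that characterizes projections.\<close>

lemma qp_solution_iff:
  assumes D: "polyhedron D"
  shows "qp_solution F G D x u \<longleftrightarrow>
    lin_G G u x \<in> D \<and> (\<forall>v. lin_G G v x \<in> D \<longrightarrow> inner (u + F x) (v - u) \<ge> 0)"
proof -
  define q where "q u = (norm u)\<^sup>2 / 2 + inner (F x) u" for u
  let ?C = "{u. lin_G G u x \<in> D}"
  have expand: "q v = q u + inner (u + F x) (v - u) + (norm (v - u))\<^sup>2 / 2" for u v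
    by (simp add: q_def power2_norm_eq_inner inner_add_left inner_add_right inner_diff_left inner_diff_right inner_commute field_simps)
  note feasible_set_closed_convex[OF D, of x]
  moreover have dist_le_iff: "dist (- F x) u \<le> dist (- F x) v \<longleftrightarrow> q u \<le> q v" for u v
  proof -
    have sq: "(dist (- F x) w)\<^sup>2 = 2 * q w + (norm (F x))\<^sup>2" for w
      by (simp add: q_def dist_norm power2_norm_eq_inner inner_add_left inner_diff_left inner_diff_right inner_commute)
    have le: "dist (- F x) u \<le> dist (- F x) v \<longleftrightarrow> (dist (- F x) u)\<^sup>2 \<le> (dist (- F x) v)\<^sup>2"
      using abs_le_square_iff[of "dist (- F x) u" "dist (- F x) v"] by (simp only: abs_of_nonneg zero_le_dist)
    show ?thesis unfolding le sq by simp
  qed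
  ultimately have VI: "inner (- F x - u) (v - u) \<le> 0"
    if "u \<in> ?C" "v \<in> ?C" "\<forall>z\<in>?C. q u \<le> q z" for u v
    using that by (intro any_closest_point_dot[of ?C]) (simp_all only: dist_le_iff simp_thms Ball_def)
  have "inner (u + F x) (v - u) \<ge> 0" if "lin_G G u x \<in> D" "lin_G G v x \<in> D" "\<forall>z\<in>?C. q u \<le> q z" for v
    using VI[of u v] that by (simp add: inner_diff_left inner_add_left)
  moreover have "q u \<le> q v" if "inner (u + F x) (v - u) \<ge> 0" for v
    using that expand[of v u] by simp
  ultimately show ?thesis
    unfolding qp_solution_def is_arg_min_def q_def[symmetric] by (auto simp: not_less)
qed

lemma qp_solution_ex1:
  assumes D: "polyhedron D" and v: "lin_G G v x \<in> D"
  shows "\<exists>!u. qp_solution F G D x u"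
proof (rule ex_ex1I)
  let ?C = "{u. lin_G G u x \<in> D}"
  define u where "u = closest_point ?C (- F x)"
  have "u \<in> ?C"
    unfolding u_def using v by (intro closest_point_in_set feasible_set_closed_convex D) auto
  moreover have VI: "inner (- F x - u) (w - u) \<le> 0" if "w \<in> ?C" for w
    unfolding u_def using that by (intro closest_point_dot feasible_set_closed_convex D)
  have "inner (u + F x) (w - u) \<ge> 0" if "lin_G G w x \<in> D" for w
    using VI[of w] that
    by (simp add: inner_diff_left inner_add_left)
  ultimately show "\<exists>u. qp_solution F G D x u"
    by (auto simp: qp_solution_iff[OF D])
next
  fix u w assume "qp_solution F G D x u" "qp_solution F G D x w"
  then have "inner (u + F x) (w - u) \<ge> 0" "inner (w + F x) (u - w) \<ge> 0"
    by (auto simp: qp_solution_iff[OF D])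
  then have "inner (u - w) (u - w) \<le> 0"
    by (simp add: inner_add_left inner_diff_left inner_diff_right)
  then show "u = w"
    by (metis antisym inner_ge_zero inner_eq_zero_iff right_minus_eq)
qed

lemma qp_multiplier_imp_solution:
  assumes D: "polyhedron D" and l: "qp_multiplier F G D x u l"
  shows "qp_solution F G D x u"
proof -
  have "u + F x = - adj (g' x) l"
    using l by (simp add: qp_multiplier_def grad_G eq_neg_iff_add_eq_0)
  then have "inner (u + F x) (v - u) = - inner l (lin_G G v x - lin_G G u x)" for v
    by (simp add: inner_adj lin_G_eq blinfun.diff_right)
  then show ?thesis
    using l mem_normal_coneD[of l D "lin_G G u x"]
    by (auto simp: qp_solution_iff[OF D] qp_multiplier_def normal_cone_def split: if_splits)
qed

lemma qp_multiplier_unique: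
  assumes c: "c > 0" "\<And>m. m \<in> span (normal_cone D (lin_G G u x)) \<Longrightarrow> norm (adj (g' x) m) \<ge> c * norm m"
    and "qp_multiplier F G D x u l" "qp_multiplier F G D x u l'"
  shows "l = l'"
proof -
  have "adj (g' x) (l - l') = 0"
    using assms(3,4) by (simp add: qp_multiplier_def grad_G adj.diff_right add_eq_0_iff)
  moreover have "l - l' \<in> span (normal_cone D (lin_G G u x))"
    using assms(3,4) by (intro span_diff span_base) (auto simp: qp_multiplier_def)
  ultimately have "c * norm (l - l') \<le> 0" using c(2) by fastforce
  then show ?thesis using c(1) by (simp add: mult_le_0_iff)
qed

text \<open>Nondegeneracy makes the adjoint Jacobian injective on the span of the normal cone, so
  the image cone is closed. If \<open>- (u + F x)\<close> lay outside, the normal \<open>a\<close>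
  of a separating hyperplane would make \<open>- a\<close> a feasible direction along which the
  variational inequality fails.\<close>

lemma qp_multiplier_exists:
  assumes D: "polyhedron D" and u: "qp_solution F G D x u"
    and c: "c > 0" "\<And>m. m \<in> span (normal_cone D (lin_G G u x)) \<Longrightarrow> norm (adj (g' x) m) \<ge> c * norm m"
  shows "\<exists>l. qp_multiplier F G D x u l"
proof (rule ccontr)
  assume no: "\<not> ?thesis"
  let ?d = "lin_G G u x"
  let ?N = "normal_cone D ?d"
  have d: "?d \<in> D" and VI: "\<And>v. lin_G G v x \<in> D \<Longrightarrow> inner (u + F x) (v - u) \<ge> 0"
    using u by (auto simp: qp_solution_iff[OF D])
  have lin: "linear (adj (g' x))" by (intro bounded_linear.linear adj.bounded_linear_right)
  have "inj_on (adj (g' x)) (span ?N)"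
  proof (rule inj_onI)
    fix a b assume ab: "a \<in> span ?N" "b \<in> span ?N" "adj (g' x) a = adj (g' x) b"
    then have "c * norm (a - b) \<le> 0"
      using c(2)[of "a - b"] by (simp add: span_diff adj.diff_right)
    then show "a = b" using c(1) by (simp add: mult_le_0_iff)
  qed
  then have closed: "closed (adj (g' x) ` ?N)"
    by (intro closed_injective_linear_image_on_span lin normal_cone_closed_convex_cone)
  have conv: "convex (adj (g' x) ` ?N)"
    by (intro convex_linear_image lin normal_cone_closed_convex_cone)
  have "- (u + F x) \<notin> adj (g' x) ` ?N"
  proof
    assume "- (u + F x) \<in> adj (g' x) ` ?N"
    then obtain l where "l \<in> ?N" "- (u + F x) = adj (g' x) l" by blast
    then have "qp_multiplier F G D x u l"
      by (simp add: qp_multiplier_def grad_G flip: \<open>- (u + F x) = adj (g' x) l\<close>)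
    with no show False by blast
  qed
  then obtain a b where ab: "inner a (- (u + F x)) < b" "\<And>y. y \<in> adj (g' x) ` ?N \<Longrightarrow> inner a y > b"
    using separating_hyperplane_closed_point[OF conv closed] by blast
  have b: "b < 0"
    using ab(2)[of 0] normal_cone_closed_convex_cone(4)[OF d] adj.zero_right by (metis image_eqI inner_zero_right)
  have "inner l (blinfun_apply (g' x) (- a)) \<le> 0" if l: "l \<in> ?N" for l
  proof (rule ccontr)
    assume "\<not> ?thesis"
    then have neg: "inner (adj (g' x) l) a < 0" by (simp add: inner_adj blinfun.minus_right)
    \<comment> \<open>Scaled so that \<open><a, adj (g' x) (r l)>\<close> equals \<open>b\<close>,
      against the strict separation.\<close>
    define r where "r = b / inner (adj (g' x) l) a"
    have "r \<ge> 0" using neg b by (simp add: r_def divide_nonpos_neg)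
    then have "inner a (adj (g' x) (r *\<^sub>R l)) > b"
      using ab(2) normal_cone_closed_convex_cone(3)[OF l] by blast
    then show False
      using neg by (simp add: adj.scaleR_right r_def inner_commute)
  qed
  then have "blinfun_apply (g' x) (- a) \<in> tangent_cone D ?d"
    by (simp add: tangent_cone_iff_normal_cone[OF D d])
  then obtain e where e: "e > 0" "?d + e *\<^sub>R blinfun_apply (g' x) (- a) \<in> D"
    using polyhedron_feasible_direction[OF D d] by blast
  then have "lin_G G (u + e *\<^sub>R (- a)) x \<in> D"
    by (simp add: lin_G_eq blinfun.add_right blinfun.scaleR_right blinfun.minus_right blinfun.diff_right add_diff_eq)
  from VI[OF this] have "inner (u + F x) (- a) \<ge> 0"
    using e(1) by (simp add: zero_le_mult_iff mult_le_0_iff)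
  then show False
    using ab(1) b by (simp add: inner_commute[of a] inner_add_left inner_diff_left)
qed

end

text \<open>If \<open>t > c\<close>, then \<open>t + c\<close> is at most \<open>2 t\<close> and one
  factor \<open>t\<close> cancels. It converts the quadratic energy estimates for \<open>S x\<close>
  and for \<open>S x - S y\<close> into linear ones.\<close>

lemma quadratic_bound:
  fixes t :: real
  assumes "0 \<le> t" "0 \<le> p" "0 \<le> b" "0 \<le> c" "t * t \<le> p * t + b * (t + c)"
  shows "t \<le> p + 2 * b + c"
proof (cases "t \<le> c")
  case False
  then have "b * (t + c) \<le> b * (t + t)" using assms by (intro mult_left_mono) auto
  then have "t * t \<le> (p + 2 * b) * t" using assms(5) by (simp add: algebra_simps)
  then have "t \<le> p + 2 * b" using False assms(4) by simp
  then show ?thesis using assms by simp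
qed (use assms in simp)

lemma eventually_norm_diff_less:
  "r > 0 \<Longrightarrow> \<forall>\<^sub>F x in nhds a. norm (x - a) < (r::real)"
  by (auto simp: eventually_nhds_metric dist_norm)

section \<open>Estimates for the approximation step near the reference solution\<close>

locale ge_problem = smooth_data F G f' g' g'' xbar
  for F :: "real^'n \<Rightarrow> real^'n" and G :: "real^'n \<Rightarrow> real^'s" and f' g' g'' xbar +
  fixes D :: "(real^'s) set" and lbar :: "real^'s" and \<gamma> :: real
  assumes D: "polyhedron D"
    and nondeg: "nondegenerate G D \<gamma> xbar (G xbar)"
    and lbar: "lbar \<in> normal_cone D (G xbar)" "Lag F G lbar xbar = 0"
begin

abbreviation "Nbar \<equiv> normal_cone D (G xbar)"
abbreviation "S \<equiv> S_map F G D"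
abbreviation "Lam \<equiv> Lambda_map F G D"

lemma dbar: "G xbar \<in> D"
  using lbar(1) by (auto simp: normal_cone_def split: if_splits)

lemma \<gamma>: "\<gamma> > 0"
  using nondeg by (simp add: nondegenerate_def)

lemma F_xbar: "F xbar = - adj (g' xbar) lbar"
  using lbar(2) by (simp add: Lag_def grad_G eq_neg_iff_add_eq_0)

lemma nondeg_near: "\<forall>\<^sub>F x in nhds xbar. \<forall>m\<in>span Nbar. \<gamma> / 2 * norm m \<le> norm (adj (g' x) m)"
proof -
  have "\<forall>\<^sub>F x in nhds xbar. norm (g' x - g' xbar) \<le> \<gamma> / 2"
    using \<gamma> by (intro derivatives_near) simp
  then show ?thesis
  proof (rule eventually_mono, intro ballI)
    fix x m assume x: "norm (g' x - g' xbar) \<le> \<gamma> / 2" and m: "m \<in> span Nbar"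
    have "\<gamma> * norm m \<le> norm (adj (g' xbar) m)"
      using nondeg m by (simp add: nondegenerate_def grad_G)
    also have "\<dots> \<le> norm (adj (g' x) m) + norm (adj (g' x - g' xbar) m)"
      using norm_triangle_ineq4[of "adj (g' x) m" "adj (g' x - g' xbar) m"] by (simp add: adj.diff_left)
    also have "norm (adj (g' x - g' xbar) m) \<le> \<gamma> / 2 * norm m"
      using norm_adj[of "g' x - g' xbar" m] x by (meson mult_right_mono norm_ge_zero order_trans)
    finally show "\<gamma> / 2 * norm m \<le> norm (adj (g' x) m)" by simp
  qed
qed

text \<open>The point \<open>v = A^T m\<close> is the least-norm solution of
  \<open>W^T (G x + A v - G xbar) = 0\<close>, where \<open>W\<close> spans
  \<open>span Nbar\<close>. The displacement \<open>G x + A v - G xbar\<close> is then orthogonal to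
  \<open>Nbar\<close>, hence tangent, and small enough to stay in \<open>D\<close>.\<close>

lemma feasible_near:
  obtains C where "C > 0" "\<forall>\<^sub>F x in nhds xbar. \<exists>v. lin_G G v x \<in> D \<and>
     (\<forall>m\<in>Nbar. inner m (lin_G G v x - G xbar) = 0) \<and> norm v \<le> C * norm (x - xbar)"
proof -
  obtain C0 where C0: "C0 > 0" "\<And>x. x \<in> cball xbar 1 \<Longrightarrow> norm (g' x) \<le> C0"
    "\<And>x. x \<in> cball xbar 1 \<Longrightarrow> norm (G x - G xbar) \<le> C0 * norm (x - xbar)"
    using uniform_bounds by (metis centre_in_cball zero_le_one)
  obtain W where W: "cols_basis W (span Nbar)" using cols_basis_exists[OF subspace_span] by blast
  obtain \<rho> where \<rho>: "\<rho> > 0" "\<And>t. t \<in> tangent_cone D (G xbar) \<Longrightarrow> norm t < \<rho> \<Longrightarrow> G xbar + t \<in> D"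
    using polyhedron_local_cone[OF D dbar] by blast
  define C where "C = C0 / (\<gamma> / 2)"
  have C: "C > 0" using C0 \<gamma> by (simp add: C_def)
  define r where "r = min 1 (\<rho> / (C0 + C0 * C))"
  have K: "C0 + C0 * C > 0" using C0 C by (simp add: add_pos_pos)
  have r: "r > 0" using \<rho>(1) K by (simp add: r_def)
  have "\<forall>\<^sub>F x in nhds xbar. \<exists>v. lin_G G v x \<in> D \<and>
     (\<forall>m\<in>Nbar. inner m (lin_G G v x - G xbar) = 0) \<and> norm v \<le> C * norm (x - xbar)"
    using nondeg_near eventually_norm_diff_less[OF r]
  proof eventually_elim
    case (elim x)
    have x: "x \<in> cball xbar 1" "norm (x - xbar) * (C0 + C0 * C) < \<rho>"
      using elim(2) K by (auto simp: r_def dist_norm norm_minus_commute pos_less_divide_eq)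
    let ?A = "Jac G x" and ?At = "tr (Jac G x)"
    have At: "?At *v m = adj (g' x) m" for m using grad_G[of x m] by (simp add: grad_def)
    have WM: "full_col_rank W" "span (set W) = span Nbar" using W by (auto simp: cols_basis_def)
    have nd: "\<gamma> / 2 * norm m \<le> norm (?At *v m)" if "m \<in> span Nbar" for m
      using elim(1) that by (simp add: At)
    obtain B where B: "inverse_mat_of (compress W (?A ** ?At)) B"
      using compress_gram_inverse_exists[OF WM(1), of "\<gamma> / 2" ?A] nd \<gamma> WM(2) by auto
    define y where "y = - (G x - G xbar)"
    define m where "m = expand W B *v y"
    define v where "v = ?At *v m"
    have m: "m \<in> span Nbar" unfolding m_def WM(2)[symmetric] by (rule expand_mult_in_span)
    have o: "inner w (?A *v v - y) = 0" if "w \<in> span Nbar" for w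
      using expand_inverse[OF B, of w y] that
      by (simp add: WM(2) inner_diff_right v_def m_def matrix_vector_mul_assoc matrix_mul_assoc)
    have "norm v \<le> 2 * norm (0::real^'n) + norm y / (\<gamma> / 2)"
      by (rule reduced_system_bound[of "\<gamma> / 2" "span Nbar" ?A m]) (use \<gamma> nd m o v_def in auto)
    also have "\<dots> \<le> 2 * norm (0::real^'n) + (C0 * norm (x - xbar)) / (\<gamma> / 2)"
      using C0(3)[OF x(1)] \<gamma> by (intro add_left_mono divide_right_mono) (auto simp: y_def norm_minus_commute)
    finally have nv: "norm v \<le> C * norm (x - xbar)" by (simp add: C_def mult_ac)
    have eq: "lin_G G v x - G xbar = ?A *v v - y" by (simp add: lin_G_def y_def)
    have o': "inner w (lin_G G v x - G xbar) = 0" if "w \<in> Nbar" for w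
      using o that span_base eq by metis
    have "norm (lin_G G v x - G xbar) = norm ((G x - G xbar) + blinfun_apply (g' x) v)"
      by (simp add: lin_G_eq algebra_simps)
    also have "\<dots> \<le> C0 * norm (x - xbar) + C0 * (C * norm (x - xbar))"
    proof -
      have "norm (blinfun_apply (g' x) v) \<le> C0 * (C * norm (x - xbar))"
        using norm_blinfun[of "g' x" v] C0(1,2) x(1) nv by (smt (verit) mult_mono norm_ge_zero)
      then show ?thesis using C0(3)[OF x(1)] norm_triangle_le[of "G x - G xbar"] by (meson add_mono)
    qed
    also have "\<dots> < \<rho>" using x(2) by (simp add: algebra_simps)
    finally have "G xbar + (lin_G G v x - G xbar) \<in> D"
      using o' by (intro \<rho>(2)) (auto simp: tangent_cone_iff_normal_cone[OF D dbar])
    then have "lin_G G v x \<in> D" by simp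
    with o' nv show ?case by blast
  qed
  with C show thesis by (rule that)
qed

text \<open>With \<open>z = v - u\<close> for the feasible \<open>v\<close> found before,
  \<open><F xbar, z>\<close> is not small by itself. Writing \<open>F xbar\<close> as
  \<open>- adj (g' xbar) lbar\<close> isolates \<open>- <lbar, G' x z>\<close>, which is nonpositive
  because \<open>lbar\<close> is normal at \<open>G xbar\<close> while the displacement of
  \<open>v\<close> is orthogonal to it. The rest is of order
  \<open>norm (x - xbar) * norm z\<close>.\<close>

lemma solution_near:
  obtains C where "C > 0" "\<forall>\<^sub>F x in nhds xbar. \<exists>u. qp_solution F G D x u \<and> norm u \<le> C * norm (x - xbar)"
proof -
  obtain C0 where C0: "C0 > 0" 
    "\<And>x. x \<in> cball xbar 1 \<Longrightarrow> norm (F x - F xbar) \<le> C0 * norm (x - xbar)"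
    "\<And>x. x \<in> cball xbar 1 \<Longrightarrow> norm (g' x - g' xbar) \<le> C0 * norm (x - xbar)"
    using uniform_bounds by (metis centre_in_cball zero_le_one)
  obtain C1 where C1: "C1 > 0" "\<forall>\<^sub>F x in nhds xbar. \<exists>v. lin_G G v x \<in> D \<and>
     (\<forall>m\<in>Nbar. inner m (lin_G G v x - G xbar) = 0) \<and> norm v \<le> C1 * norm (x - xbar)"
    using feasible_near .
  define a where "a = C0 * (1 + norm lbar)"
  have a: "a > 0" using C0 by (simp add: a_def add_pos_nonneg)
  have "\<forall>\<^sub>F x in nhds xbar. \<exists>u. qp_solution F G D x u \<and> norm u \<le> (C1 + 2 * a + C1) * norm (x - xbar)"
    using C1(2) eventually_norm_diff_less[of 1 xbar, OF less_numeral_extra(1)]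
  proof eventually_elim
    case (elim x)
    obtain v where v: "lin_G G v x \<in> D" "\<And>m. m \<in> Nbar \<Longrightarrow> inner m (lin_G G v x - G xbar) = 0"
      "norm v \<le> C1 * norm (x - xbar)" using elim(1) by blast
    have x: "x \<in> cball xbar 1" using elim(2) by (simp add: dist_norm norm_minus_commute)
    obtain u where u: "qp_solution F G D x u" using qp_solution_ex1[OF D v(1)] by blast
    then have uD: "lin_G G u x \<in> D" and VI: "inner (u + F x) (v - u) \<ge> 0"
      using v(1) by (auto simp: qp_solution_iff[OF D])
    define z where "z = v - u"
    define e where "e = norm (x - xbar)"
    have nz: "norm z \<le> norm u + C1 * e" using v(3) norm_triangle_ineq4[of v u] by (simp add: z_def e_def)
    have "blinfun_apply (g' x) z = (lin_G G v x - G xbar) - (lin_G G u x - G xbar)"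
      by (simp add: z_def lin_G_eq blinfun.diff_right)
    then have "inner lbar (blinfun_apply (g' x) z) = - inner lbar (lin_G G u x - G xbar)"
      using v(2)[OF lbar(1)] by (simp add: inner_diff_right)
    then have "inner lbar (blinfun_apply (g' x) z) \<ge> 0"
      using mem_normal_coneD[OF lbar(1) uD] by simp
    moreover have "inner (F xbar) z = inner (adj (g' x - g' xbar) lbar) z - inner lbar (blinfun_apply (g' x) z)"
      by (simp add: F_xbar adj.diff_left inner_diff_left inner_adj)
    ultimately have "inner (F xbar) z \<le> inner (adj (g' x - g' xbar) lbar) z" by simp
    also have "\<dots> \<le> norm (g' x - g' xbar) * norm lbar * norm z"
      using norm_cauchy_schwarz[of "adj (g' x - g' xbar) lbar" z] norm_adj[of "g' x - g' xbar" lbar]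
      by (meson mult_right_mono norm_ge_zero order_trans)
    also have "\<dots> \<le> C0 * e * norm lbar * norm z"
      using C0(3)[OF x] by (intro mult_right_mono) (auto simp: e_def)
    finally have 1: "inner (F xbar) z \<le> C0 * e * norm lbar * norm z" .
    have 2: "inner (F x - F xbar) z \<le> C0 * e * norm z"
      using norm_cauchy_schwarz[of "F x - F xbar" z] C0(2)[OF x] unfolding e_def
      by (meson mult_right_mono norm_ge_zero order_trans)
    have "inner (F x) z \<le> a * e * norm z"
      using 1 2 by (simp add: a_def inner_diff_left algebra_simps)
    also have "\<dots> \<le> a * e * (norm u + C1 * e)"
      using nz a by (intro mult_left_mono) (auto simp: e_def)
    finally have 3: "inner (F x) z \<le> a * e * (norm u + C1 * e)" .
    have "norm u * norm u = inner u v - inner u z"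
      by (simp add: z_def inner_diff_right power2_norm_eq_inner flip: power2_eq_square)
    also have "\<dots> \<le> inner u v + inner (F x) z"
      using VI by (simp add: z_def inner_add_left)
    also have "\<dots> \<le> C1 * e * norm u + a * e * (norm u + C1 * e)"
    proof -
      have "inner u v \<le> norm u * (C1 * e)"
        using norm_cauchy_schwarz[of u v] v(3) unfolding e_def by (meson mult_left_mono norm_ge_zero order_trans)
      then show ?thesis using 3 by (simp add: mult.commute)
    qed
    finally have "norm u \<le> C1 * e + 2 * (a * e) + C1 * e"
      by (intro quadratic_bound) (use C1(1) a in \<open>auto simp: e_def\<close>)
    then show ?case using u by (auto simp: e_def algebra_simps)
  qed
  then show thesis using that[of "C1 + 2 * a + C1"] C1(1) a by simp
qed

text \<open>Collects what the sequel uses about a single point. The equivalences turn the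
  descriptions in \<open>S_map\<close> and \<open>Lambda_map\<close> into genuine values, the
  inclusions for the normal and critical cones are hypotheses of \<open>cone_face_near\<close>, and
  distance at most 1 gives access to \<open>uniform_bounds\<close>.\<close>

definition regular :: "real \<Rightarrow> real^'n \<Rightarrow> bool" where
  "regular C x \<longleftrightarrow> norm (x - xbar) \<le> 1 \<and>
     (\<forall>u. qp_solution F G D x u \<longleftrightarrow> u = S x) \<and>
     (\<forall>l. qp_multiplier F G D x (S x) l \<longleftrightarrow> l = Lam x) \<and>
     norm (S x) \<le> C * norm (x - xbar) \<and> norm (Lam x - lbar) \<le> C * norm (x - xbar) \<and>
     normal_cone D (lin_G G (S x) x) \<subseteq> Nbar \<and>
     critical_cone D (G xbar) (Lam x) \<subseteq> orthogonal_comp {lbar} \<and>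
     (\<forall>m\<in>span Nbar. \<gamma> / 2 * norm m \<le> norm (adj (g' x) m))"

lemma regular_near:
  obtains C where "C > 0" "\<forall>\<^sub>F x in nhds xbar. regular C x"
proof -
  obtain C0 where C0: "C0 > 0" "\<And>x. x \<in> cball xbar 1 \<Longrightarrow> norm (g' x) \<le> C0"
    "\<And>x. x \<in> cball xbar 1 \<Longrightarrow> norm (F x - F xbar) \<le> C0 * norm (x - xbar)"
    "\<And>x. x \<in> cball xbar 1 \<Longrightarrow> norm (G x - G xbar) \<le> C0 * norm (x - xbar)"
    "\<And>x. x \<in> cball xbar 1 \<Longrightarrow> norm (g' x - g' xbar) \<le> C0 * norm (x - xbar)"
    using uniform_bounds by (metis centre_in_cball zero_le_one)
  obtain C1 where C1: "C1 > 0"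
    "\<forall>\<^sub>F x in nhds xbar. \<exists>u. qp_solution F G D x u \<and> norm u \<le> C1 * norm (x - xbar)"
    using solution_near .
  obtain \<rho> where \<rho>: "\<rho> > 0" "\<And>e. e \<in> D \<Longrightarrow> norm (e - G xbar) < \<rho> \<Longrightarrow> normal_cone D e \<subseteq> Nbar"
    by (rule normal_cone_locally_subset[OF D dbar]) (rule that)
  obtain \<sigma> where \<sigma>: "\<sigma> > 0"
    "\<And>l. l \<in> Nbar \<Longrightarrow> norm (l - lbar) < \<sigma> \<Longrightarrow> critical_cone D (G xbar) l \<subseteq> orthogonal_comp {lbar}"
    by (rule critical_cone_multiplier_near[OF D dbar, of lbar]) (rule that)
  \<comment> \<open>Comes from subtracting the multiplier equations at \<open>x\<close> and
    \<open>xbar\<close>: both multipliers lie in \<open>Nbar\<close>, where the adjoint Jacobian at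
    \<open>x\<close> is bounded below by \<open>\<gamma> / 2\<close>.\<close>
  define C2 where "C2 = (C1 + C0 + C0 * norm lbar) / (\<gamma> / 2)"
  have C2: "C2 > 0" using C0(1) C1(1) \<gamma> by (simp add: C2_def add_pos_nonneg)
  define C where "C = C1 + C2"
  \<comment> \<open>The radius keeps \<open>lin_G G u x\<close> within \<open>\<rho>\<close> of
    \<open>G xbar\<close> and the multiplier within \<open>\<sigma>\<close> of
    \<open>lbar\<close>.\<close>
  define r where "r = min 1 (min (\<rho> / (C0 + C0 * C1)) (\<sigma> / C2))"
  have K: "C0 + C0 * C1 > 0" using C0(1) C1(1) by (simp add: add_pos_pos)
  have r: "r > 0" using \<rho>(1) \<sigma>(1) C2 K by (simp add: r_def)
  have "\<forall>\<^sub>F x in nhds xbar. regular C x"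
    using C1(2) nondeg_near eventually_norm_diff_less[OF r]
  proof eventually_elim
    case (elim x)
    obtain u where u: "qp_solution F G D x u" "norm u \<le> C1 * norm (x - xbar)" using elim(1) by blast
    have x: "x \<in> cball xbar 1" "norm (x - xbar) * (C0 + C0 * C1) < \<rho>" "norm (x - xbar) * C2 < \<sigma>"
      using elim(3) K C2 by (auto simp: r_def dist_norm norm_minus_commute pos_less_divide_eq)
    have uD: "lin_G G u x \<in> D" using u(1) by (simp add: qp_solution_iff[OF D])
    have uu: "qp_solution F G D x u' \<longleftrightarrow> u' = u" for u'
      using qp_solution_ex1[OF D uD] u(1) by blast
    have Su: "S x = u"
      unfolding S_map_def by (rule the_equality) (auto simp: uu)
    have "norm (lin_G G u x - G xbar) = norm ((G x - G xbar) + blinfun_apply (g' x) u)"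
      by (simp add: lin_G_eq algebra_simps)
    also have "\<dots> \<le> C0 * norm (x - xbar) + C0 * (C1 * norm (x - xbar))"
    proof -
      have "norm (blinfun_apply (g' x) u) \<le> C0 * (C1 * norm (x - xbar))"
        using norm_blinfun[of "g' x" u] C0(1) C0(2)[OF x(1)] u(2) by (smt (verit) mult_mono norm_ge_zero)
      then show ?thesis using C0(4)[OF x(1)] norm_triangle_le[of "G x - G xbar"] by (meson add_mono)
    qed
    also have "\<dots> < \<rho>" using x(2) by (simp add: algebra_simps)
    finally have sub: "normal_cone D (lin_G G u x) \<subseteq> Nbar" by (rule \<rho>(2)[OF uD])
    then have nd: "\<gamma> / 2 * norm m \<le> norm (adj (g' x) m)" if "m \<in> span (normal_cone D (lin_G G u x))" for m
      using elim(2) that span_mono by blast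
    obtain l where l: "qp_multiplier F G D x u l"
      using qp_multiplier_exists[OF D u(1) _ nd] \<gamma> by auto
    have ll: "qp_multiplier F G D x (S x) l' \<longleftrightarrow> l' = l" for l'
      using qp_multiplier_unique[of "\<gamma> / 2", OF _ nd] l \<gamma> by (auto simp: Su)
    have Ll: "Lam x = l"
      unfolding Lambda_map_def by (rule the_equality) (auto simp: ll)
    have lN: "l \<in> Nbar" using l sub by (auto simp: qp_multiplier_def)
    have "adj (g' x) (l - lbar) = - u - (F x - F xbar) - adj (g' x - g' xbar) lbar"
      using l by (simp add: qp_multiplier_def grad_G adj.diff_right adj.diff_left F_xbar add_eq_0_iff)
    also have "norm \<dots> \<le> norm u + norm (F x - F xbar) + norm (adj (g' x - g' xbar) lbar)"
      using norm_triangle_ineq4[of "- u - (F x - F xbar)" "adj (g' x - g' xbar) lbar"]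
        norm_triangle_ineq4[of "- u" "F x - F xbar"] by simp
    also have "\<dots> \<le> C1 * norm (x - xbar) + C0 * norm (x - xbar) + C0 * norm (x - xbar) * norm lbar"
    proof -
      have "norm (adj (g' x - g' xbar) lbar) \<le> C0 * norm (x - xbar) * norm lbar"
        using norm_adj[of "g' x - g' xbar" lbar] C0(5)[OF x(1)] by (meson mult_right_mono norm_ge_zero order_trans)
      then show ?thesis using u(2) C0(3)[OF x(1)] by linarith
    qed
    finally have "\<gamma> / 2 * norm (l - lbar) \<le> (C1 + C0 + C0 * norm lbar) * norm (x - xbar)"
      using elim(2) lN lbar(1) by (smt (verit) span_base span_diff distrib_right mult.commute mult.left_commute)
    then have lb: "norm (l - lbar) \<le> C2 * norm (x - xbar)"
      using \<gamma> by (simp add: C2_def field_simps)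
    have "C1 * norm (x - xbar) \<le> C * norm (x - xbar)" "C2 * norm (x - xbar) \<le> C * norm (x - xbar)"
      using C1(1) C2 by (auto simp: C_def intro!: mult_right_mono)
    then show ?case
      unfolding regular_def Ll using uu ll Su u(2) lb sub elim(2) x(1) \<sigma>(2)[OF lN] x(3)
      by (auto simp: dist_norm norm_minus_commute mult.commute)
  qed
  then show thesis using that[of C] C1(1) C2 by (simp add: C_def)
qed

lemma regularD:
  assumes "regular C x"
  shows "norm (x - xbar) \<le> 1" "x \<in> cball xbar 1" "qp_solution F G D x u \<longleftrightarrow> u = S x"
    "qp_multiplier F G D x (S x) l \<longleftrightarrow> l = Lam x"
    "norm (S x) \<le> C * norm (x - xbar)" "norm (Lam x - lbar) \<le> C * norm (x - xbar)"
    "lin_G G (S x) x \<in> D" "Lam x \<in> normal_cone D (lin_G G (S x) x)"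
    "S x + F x + adj (g' x) (Lam x) = 0"
    "normal_cone D (lin_G G (S x) x) \<subseteq> Nbar"
    "critical_cone D (G xbar) (Lam x) \<subseteq> orthogonal_comp {lbar}"
    "m \<in> span Nbar \<Longrightarrow> \<gamma> / 2 * norm m \<le> norm (adj (g' x) m)"
proof -
  note r = assms[unfolded regular_def]
  show "norm (x - xbar) \<le> 1" "qp_solution F G D x u \<longleftrightarrow> u = S x"
    "qp_multiplier F G D x (S x) l \<longleftrightarrow> l = Lam x"
    "norm (S x) \<le> C * norm (x - xbar)" "norm (Lam x - lbar) \<le> C * norm (x - xbar)"
    "normal_cone D (lin_G G (S x) x) \<subseteq> Nbar"
    "critical_cone D (G xbar) (Lam x) \<subseteq> orthogonal_comp {lbar}"
    "m \<in> span Nbar \<Longrightarrow> \<gamma> / 2 * norm m \<le> norm (adj (g' x) m)"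
    using r by blast+
  show "x \<in> cball xbar 1" using r by (simp add: dist_norm norm_minus_commute)
  have "qp_solution F G D x (S x)" "qp_multiplier F G D x (S x) (Lam x)" using r by blast+
  then show "lin_G G (S x) x \<in> D" "Lam x \<in> normal_cone D (lin_G G (S x) x)"
    "S x + F x + adj (g' x) (Lam x) = 0"
    by (auto simp: qp_solution_iff[OF D] qp_multiplier_def grad_G)
qed

text \<open>Monotonicity of the normal cone controls \<open>u - w\<close> up to the multiplier difference, which the
  nondegeneracy bounds by \<open>u - w\<close> in turn.\<close>

lemma S_lipschitz:
  assumes C: "C > 0"
  obtains L where "L \<ge> 0" "\<And>x y. regular C x \<Longrightarrow> regular C y \<Longrightarrow> norm (S x - S y) \<le> L * norm (x - y)"
proof -
  obtain C0 where C0: "C0 > 0" 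
    "\<And>x y. x \<in> cball xbar 1 \<Longrightarrow> y \<in> cball xbar 1 \<Longrightarrow> norm (F x - F y) \<le> C0 * norm (x - y)"
    "\<And>x y. x \<in> cball xbar 1 \<Longrightarrow> y \<in> cball xbar 1 \<Longrightarrow> norm (G x - G y) \<le> C0 * norm (x - y)"
    "\<And>x y. x \<in> cball xbar 1 \<Longrightarrow> y \<in> cball xbar 1 \<Longrightarrow> norm (g' x - g' y) \<le> C0 * norm (x - y)"
    using uniform_bounds by metis
  define a where "a = C0 * (1 + norm lbar + C)"
  have a: "a \<ge> 0" using C0(1) C by (simp add: a_def)
  define g where "g = 1 / (\<gamma> / 2)"
  have g: "g > 0" using \<gamma> by (simp add: g_def)
  have "norm (S x - S y) \<le> (2 * a + 2 * (g * a)) * norm (x - y)"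
    if rx: "regular C x" and ry: "regular C y" for x y
  proof -
    note X = regularD[OF rx] and Y = regularD[OF ry]
    define u w l k where uwlk: "u = S x" "w = S y" "l = Lam x" "k = Lam y"
    define e where "e = norm (x - y)"
    define d d' where dd: "d = lin_G G u x" "d' = lin_G G w y"
    have eqs: "u + F x + adj (g' x) l = 0" "w + F y + adj (g' y) k = 0"
      using X(9) Y(9) by (auto simp: uwlk)
    have small: "norm w \<le> C" "norm k \<le> norm lbar + C"
    proof -
      have *: "C * norm (y - xbar) \<le> C * 1" using Y(1) C by (intro mult_left_mono) auto
      show "norm w \<le> C" using Y(5) * by (simp add: uwlk)
      show "norm k \<le> norm lbar + C"
        using Y(6) * norm_triangle_ineq[of "k - lbar" lbar] by (simp add: uwlk)
    qed
    have mono: "inner (l - k) (d - d') \<ge> 0"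
      using mem_normal_coneD[OF X(8) Y(7)] mem_normal_coneD[OF Y(8) X(7)]
      by (simp add: uwlk dd inner_diff_left inner_diff_right)
    define q m where qm: "q = u - w" "m = l - k"
    \<comment> \<open>\<open>r1\<close> and \<open>r2\<close> are the changes of the data between
      \<open>x\<close> and \<open>y\<close> with \<open>w\<close> and \<open>k\<close> frozen, so
      that \<open>q = r1 - adj (g' x) m\<close> and \<open>g' x q = (d - d') - r2\<close>.\<close>
    define r1 where "r1 = - (F x - F y) - adj (g' x - g' y) k"
    define r2 where "r2 = (G x - G y) + blinfun_apply (g' x - g' y) w"
    have q: "q = r1 - adj (g' x) m"
      using eqs by (simp add: qm r1_def adj.diff_left adj.diff_right add_eq_0_iff algebra_simps)
    have g'q: "blinfun_apply (g' x) q = (d - d') - r2"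
      by (simp add: qm dd r2_def lin_G_eq blinfun.diff_left blinfun.diff_right)
    have r1: "norm r1 \<le> a * e"
    proof -
      have "norm (adj (g' x - g' y) k) \<le> (C0 * e) * (norm lbar + C)"
        using norm_adj[of "g' x - g' y" k] C0(4)[OF X(2) Y(2)] small(2) C0(1)
        unfolding e_def by (meson mult_mono norm_ge_zero order_trans mult_nonneg_nonneg less_imp_le)
      moreover have "norm r1 \<le> norm (F x - F y) + norm (adj (g' x - g' y) k)"
        unfolding r1_def using norm_triangle_ineq4[of "- (F x - F y)"] by (metis norm_minus_cancel)
      ultimately show ?thesis using C0(2)[OF X(2) Y(2)] by (simp add: a_def e_def algebra_simps)
    qed
    have r2: "norm r2 \<le> a * e"
    proof -
      have "norm (blinfun_apply (g' x - g' y) w) \<le> (C0 * e) * C"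
        using norm_blinfun[of "g' x - g' y" w] C0(4)[OF X(2) Y(2)] small(1) C0(1)
        unfolding e_def by (meson mult_mono norm_ge_zero order_trans mult_nonneg_nonneg less_imp_le)
      moreover have "norm r2 \<le> norm (G x - G y) + norm (blinfun_apply (g' x - g' y) w)"
        unfolding r2_def by (rule norm_triangle_ineq)
      moreover have "0 \<le> C0 * e * norm lbar" using C0(1) by (simp add: e_def)
      ultimately show ?thesis using C0(3)[OF X(2) Y(2)] by (simp add: a_def e_def algebra_simps)
    qed
    have "m \<in> span Nbar"
      unfolding qm uwlk using X(8,10) Y(8,10) by (intro span_diff span_base) auto
    then have "\<gamma> / 2 * norm m \<le> norm (r1 - q)" using X(12) by (simp add: q)
    then have "norm m \<le> g * norm (r1 - q)" using \<gamma> by (simp add: g_def field_simps)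
    also have "\<dots> \<le> g * (norm q + a * e)"
      using norm_triangle_ineq4[of r1 q] r1 g by (intro mult_left_mono) auto
    finally have m: "norm m \<le> g * (norm q + a * e)" .
    have "norm q * norm q = inner q q" by (simp add: power2_norm_eq_inner flip: power2_eq_square)
    also have "\<dots> = inner q r1 - inner m (blinfun_apply (g' x) q)"
      by (subst (2) q) (simp add: inner_diff_right inner_commute[of q "adj _ _"] inner_adj)
    also have "\<dots> \<le> inner q r1 + inner m r2"
      using mono unfolding g'q by (simp add: qm inner_diff_right)
    also have "\<dots> \<le> norm q * norm r1 + norm m * norm r2"
      by (intro add_mono norm_cauchy_schwarz)
    also have "\<dots> \<le> norm q * (a * e) + (g * (norm q + a * e)) * (a * e)"
      using r1 r2 m g a by (intro add_mono mult_mono) (auto simp: e_def)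
    finally have "norm q \<le> a * e + 2 * (g * (a * e)) + a * e"
      by (intro quadratic_bound) (use a g in \<open>auto simp: e_def algebra_simps\<close>)
    then show ?thesis by (simp add: qm uwlk e_def algebra_simps)
  qed
  then show thesis using that[of "2 * a + 2 * (g * a)"] a g by simp
qed

end

section \<open>The generalized Jacobians of the solution map\<close>

lemma blinfun_of_matrix: "blinfun_apply (Blinfun (\<lambda>h. V *v h)) h = V *v (h::real^'n)" for V :: "real^'n^'m"
  by (simp add: bounded_linear_Blinfun_apply matrix_vector_mul_bounded_linear)

context ge_problem
begin

definition Kx :: "real^'n \<Rightarrow> (real^'s) set" where
  "Kx x = critical_cone D (lin_G G (S x) x) (Lam x)"

text \<open>The basis \<open>W\<close> and the inverse \<open>B\<close> have disappeared; only
  \<open>span E\<close> is left, which is what two different points may share.\<close>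

definition face_op :: "real^'n \<Rightarrow> (real^'s) set \<Rightarrow> real^'n^'n \<Rightarrow> bool" where
  "face_op x E V \<longleftrightarrow> (\<forall>h. face_deriv (Jac G x) (orthogonal_comp (span E))
     (dLag F G (Lam x) x *v h) (Jac (lin_G G (S x)) x *v h) (V *v h))"

lemma TS_matricesE:
  assumes "V \<in> TS_matrices F G D x"
  obtains E where "cone_face (Kx x) E" "face_op x E V"
proof -
  obtain W B E where *: "cone_face (Kx x) E" "span (set W) = orthogonal_comp (span E)"
    "inverse_mat_of (compress W (Jac G x ** grad G x)) B"
    "V = - dLag F G (Lam x) x
         + grad G x ** expand W B ** (Jac G x ** dLag F G (Lam x) x - Jac (lin_G G (S x)) x)"
    using assms by (auto simp: TS_matrices_def Let_def Kx_def)
  have "face_op x E V"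
    unfolding face_op_def *(2)[symmetric]
    using face_deriv_formula[OF *(3,4)[unfolded grad_def]] by blast
  with *(1) show thesis by (rule that)
qed

lemma transpose_Jac: "tr (Jac G x) *v m = adj (g' x) m"
  using grad_G[of x m] by (simp add: grad_def)

lemma regular_nondeg:
  assumes "regular C x" "M \<subseteq> span Nbar" "w \<in> M"
  shows "norm (tr (Jac G x) *v w) \<ge> \<gamma> / 2 * norm w"
  using regularD(12)[OF assms(1), of w] assms(2,3) by (auto simp: transpose_Jac)

lemma regular_face_span:
  assumes r: "regular C x" and E: "cone_face (Kx x) E"
  shows "orthogonal_comp (span E) \<subseteq> span Nbar"
proof -
  have "orthogonal_comp (span E) \<subseteq> span (normal_cone D (lin_G G (S x) x))"
    using orthogonal_cone_face_subset_span[OF D regularD(7,8)[OF r]] E by (simp add: Kx_def)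
  also have "\<dots> \<subseteq> span Nbar" by (intro span_mono regularD(10)[OF r])
  finally show ?thesis .
qed

lemma TS_matrices_ex:
  assumes r: "regular C x" and E: "cone_face (Kx x) E"
  shows "\<exists>V\<in>TS_matrices F G D x. face_op x E V"
proof -
  obtain W where W: "cols_basis W (orthogonal_comp (span E))"
    using cols_basis_exists[OF subspace_orthogonal_comp] by blast
  then have W': "full_col_rank W" "span (set W) = orthogonal_comp (span E)"
    by (auto simp: cols_basis_def)
  obtain B where B: "inverse_mat_of (compress W (Jac G x ** grad G x)) B"
    using compress_gram_inverse_exists[OF W'(1), of "\<gamma> / 2" "Jac G x"] \<gamma>
      regular_nondeg[OF r regular_face_span[OF r E]] by (auto simp: W'(2) grad_def)
  define V where "V = - dLag F G (Lam x) x
         + grad G x ** expand W B ** (Jac G x ** dLag F G (Lam x) x - Jac (lin_G G (S x)) x)"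
  have "V \<in> TS_matrices F G D x"
    using E W' B unfolding TS_matrices_def Let_def V_def Kx_def by blast
  moreover have "face_op x E V"
    unfolding face_op_def W'(2)[symmetric]
    using face_deriv_formula[OF B[unfolded grad_def] V_def[unfolded grad_def]] by blast
  ultimately show ?thesis by blast
qed

lemma face_op_unique:
  assumes r: "regular C x" and E: "cone_face (Kx x) E" and V: "face_op x E V" "face_op x E V'"
  shows "V = V'"
proof -
  have "V *v h = V' *v h" for h
    using V unfolding face_op_def
    by (intro face_deriv_unique[OF half_gt_zero[OF \<gamma>] regular_nondeg[OF r regular_face_span[OF r E]]
          subspace_orthogonal_comp]) auto
  then show ?thesis by (simp add: matrix_eq)
qed

text \<open>All bases \<open>W\<close> belonging to one face yield the same matrix, and a polyhedral
  critical cone has finitely many faces.\<close>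

lemma finite_TS_matrices:
  assumes r: "regular C x"
  shows "finite (TS_matrices F G D x)"
proof (rule finite_subset)
  let ?E = "{E. cone_face (Kx x) E}"
  show "TS_matrices F G D x \<subseteq> (\<lambda>E. THE V. face_op x E V) ` ?E"
  proof
    fix V assume "V \<in> TS_matrices F G D x"
    then obtain E where E: "cone_face (Kx x) E" "face_op x E V" by (rule TS_matricesE)
    then have "(THE V. face_op x E V) = V"
      using face_op_unique[OF r E(1)] by (intro the_equality) auto
    then show "V \<in> (\<lambda>E. THE V. face_op x E V) ` ?E" using E(1) by force
  qed
  show "finite ((\<lambda>E. THE V. face_op x E V) ` ?E)"
    unfolding Kx_def by (intro finite_imageI finite_cone_faces polyhedron_critical_cone D regularD(7)[OF r])
qed

lemma TS_matrices_nonempty: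
  assumes r: "regular C x"
  shows "TS_matrices F G D x \<noteq> {}"
  using TS_matrices_ex[OF r, unfolded Kx_def, OF cone_face_lineality[OF D regularD(7,8)[OF r]]] by blast

section \<open>Comparison with the reference point: faces, semismoothness, outer
  semicontinuity\<close>

lemma regular_xbar:
  assumes "regular C xbar"
  shows "S xbar = 0" "Lam xbar = lbar" "lin_G G (S xbar) xbar = G xbar" "Kx xbar = critical_cone D (G xbar) lbar"
proof -
  show S: "S xbar = 0" using regularD(5)[OF assms] by simp
  show L: "Lam xbar = lbar" using regularD(6)[OF assms] by simp
  show G: "lin_G G (S xbar) xbar = G xbar" by (simp add: S lin_G_def)
  show "Kx xbar = critical_cone D (G xbar) lbar" by (simp add: Kx_def G L)
qed

lemma regular_faces:
  assumes r: "regular C x" and E: "cone_face (Kx x) E"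
  shows "w \<in> orthogonal_comp (span E) \<Longrightarrow> inner w (lin_G G (S x) x - G xbar) = 0"
    "\<exists>E'. cone_face (critical_cone D (G xbar) lbar) E' \<and> span E' = span E"
    "Lam x - lbar \<in> orthogonal_comp (span E)"
proof -
  note near = cone_face_near[OF D dbar regularD(7,10,8,11)[OF r] lbar(1) E[unfolded Kx_def]]
  show "\<exists>E'. cone_face (critical_cone D (G xbar) lbar) E' \<and> span E' = span E" by (rule near(2))
  show "inner w (lin_G G (S x) x - G xbar) = 0" if "w \<in> orthogonal_comp (span E)"
    using that span_base[OF near(1)]
    by (subst inner_commute) (simp add: orthogonal_comp_def Linear_Algebra.orthogonal_def)
  show "Lam x - lbar \<in> orthogonal_comp (span E)"
    unfolding orthogonal_comp_span using near(3,4)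
    by (auto simp: orthogonal_comp_def Linear_Algebra.orthogonal_def inner_diff_right inner_commute subset_iff)
qed

text \<open>\<open>S x\<close> is inserted into the system of \<open>V (x - xbar)\<close> with
  \<open>m = - (l - lbar)\<close> and \<open>e = lin_G G u x - G xbar\<close>. The residuals are
  Taylor remainders of \<open>F\<close>, \<open>g'\<close> and \<open>G\<close> plus products of
  \<open>g'' x h\<close> with \<open>l - lbar\<close> or \<open>u\<close>, which are quadratic in
  \<open>h\<close>.\<close>

lemma S_semismooth:
  assumes C: "C > 0" and \<epsilon>: "\<epsilon> > 0"
  shows "\<forall>\<^sub>F x in nhds xbar. regular C x \<longrightarrow>
     (\<forall>V\<in>TS_matrices F G D x. norm (S x - V *v (x - xbar)) \<le> \<epsilon> * norm (x - xbar))"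
proof -
  obtain C0 where C0: "C0 > 0" "\<And>x. x \<in> cball xbar 1 \<Longrightarrow> norm (g'' x) \<le> C0"
    using uniform_bounds by metis
  define K where "K = 2 * (1 + norm lbar + C0 * C) + (1 + C0 * C) / (\<gamma> / 2)"
  have K: "K > 0"
    using C0(1) C \<gamma> by (simp add: K_def add_pos_nonneg)
  define \<epsilon>1 where "\<epsilon>1 = \<epsilon> / K"
  have \<epsilon>1: "\<epsilon>1 > 0" using \<epsilon> K by (simp add: \<epsilon>1_def)
  show ?thesis
    using taylor_near[OF \<epsilon>1] eventually_norm_diff_less[OF \<epsilon>1]
  proof eventually_elim
    case (elim x)
    show ?case
    proof (intro impI ballI)
      fix V assume r: "regular C x" and V: "V \<in> TS_matrices F G D x"
      obtain E where E: "cone_face (Kx x) E" "face_op x E V"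
        using V by (rule TS_matricesE)
      define h u l e where huele: "h = x - xbar" "u = S x" "l = Lam x" "e = norm (x - xbar)"
      have g'': "norm (blinfun_apply (g'' x) h) \<le> C0 * e"
        using norm_blinfun[of "g'' x" h] C0(2)[OF regularD(2)[OF r]] unfolding huele
        by (meson mult_right_mono norm_ge_zero order_trans)
      let ?M = "orthogonal_comp (span E)"
      have m: "- (l - lbar) \<in> ?M"
        unfolding huele by (intro subspace_neg subspace_orthogonal_comp regular_faces(3)[OF r E(1)])
      have "norm (u - V *v h) \<le>
          2 * norm (u + dLag F G l x *v h - tr (Jac G x) *v (- (l - lbar)))
          + norm (Jac G x *v u + Jac (lin_G G u) x *v h - (lin_G G u x - G xbar)) / (\<gamma> / 2)"
        by (rule face_deriv_stable[OF half_gt_zero[OF \<gamma>] regular_nondeg[OF r regular_face_span[OF r E(1)]]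
              subspace_orthogonal_comp _ m])
           (use E(2) regular_faces(1)[OF r E(1)] in \<open>auto simp: face_op_def huele\<close>)
      also have "\<dots> \<le> 2 * (\<epsilon>1 * e * (1 + norm lbar + C0 * C)) + \<epsilon>1 * e * (1 + C0 * C) / (\<gamma> / 2)"
      proof (intro add_mono mult_left_mono divide_right_mono)
        have u: "u = - F x - adj (g' x) l"
          using regularD(9)[OF r] by (simp add: huele add_eq_0_iff algebra_simps)
        have "u + dLag F G l x *v h - tr (Jac G x) *v (- (l - lbar))
          = - (F x - F xbar - blinfun_apply (f' x) h) - adj (g' x - g' xbar - blinfun_apply (g'' x) h) lbar
            + adj (blinfun_apply (g'' x) h) (l - lbar)"
          by (simp add: u dLag_mult transpose_Jac F_xbar adj.add_left adj.diff_left adj.diff_right adj.minus_right algebra_simps)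
        also have "norm \<dots> \<le> norm (F x - F xbar - blinfun_apply (f' x) h)
            + norm (adj (g' x - g' xbar - blinfun_apply (g'' x) h) lbar)
            + norm (adj (blinfun_apply (g'' x) h) (l - lbar))"
          using norm_triangle_ineq[of "- (F x - F xbar - blinfun_apply (f' x) h) - adj (g' x - g' xbar - blinfun_apply (g'' x) h) lbar"]
            norm_triangle_ineq4[of "- (F x - F xbar - blinfun_apply (f' x) h)" "adj (g' x - g' xbar - blinfun_apply (g'' x) h) lbar"]
          by (smt (verit) norm_minus_cancel)
        also have "\<dots> \<le> \<epsilon>1 * e + \<epsilon>1 * e * norm lbar + C0 * e * (C * \<epsilon>1)"
        proof (intro add_mono)
          show "norm (F x - F xbar - blinfun_apply (f' x) h) \<le> \<epsilon>1 * e" using elim by (simp add: huele)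
          have "norm (g' x - g' xbar - blinfun_apply (g'' x) h) \<le> \<epsilon>1 * e" using elim by (simp add: huele)
          then show "norm (adj (g' x - g' xbar - blinfun_apply (g'' x) h) lbar) \<le> \<epsilon>1 * e * norm lbar"
            using norm_adj by (meson mult_right_mono norm_ge_zero order_trans)
          have "norm (l - lbar) \<le> C * \<epsilon>1"
            using regularD(6)[OF r] elim C by (smt (verit) huele mult_left_mono)
          then show "norm (adj (blinfun_apply (g'' x) h) (l - lbar)) \<le> C0 * e * (C * \<epsilon>1)"
            using norm_adj g'' C0(1) by (smt (verit) mult_mono norm_ge_zero)
        qed
        finally show "norm (u + dLag F G l x *v h - tr (Jac G x) *v (- (l - lbar)))
            \<le> \<epsilon>1 * e * (1 + norm lbar + C0 * C)" by (simp add: algebra_simps)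
        have "Jac G x *v u + Jac (lin_G G u) x *v h - (lin_G G u x - G xbar)
          = - (G x - G xbar - blinfun_apply (g' x) h) + blinfun_apply (blinfun_apply (g'' x) h) u"
          by (simp add: Jac_G Jac_lin_G_mult lin_G_eq algebra_simps)
        also have "norm \<dots> \<le> norm (G x - G xbar - blinfun_apply (g' x) h) + norm (blinfun_apply (blinfun_apply (g'' x) h) u)"
          by (metis norm_minus_cancel norm_triangle_ineq)
        also have "\<dots> \<le> \<epsilon>1 * e + C0 * e * (C * \<epsilon>1)"
        proof (intro add_mono)
          show "norm (G x - G xbar - blinfun_apply (g' x) h) \<le> \<epsilon>1 * e" using elim by (simp add: huele)
          have "norm u \<le> C * \<epsilon>1"
            using regularD(5)[OF r] elim C by (smt (verit) huele mult_left_mono)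
          then show "norm (blinfun_apply (blinfun_apply (g'' x) h) u) \<le> C0 * e * (C * \<epsilon>1)"
            using norm_blinfun g'' C0(1) by (smt (verit) mult_mono norm_ge_zero)
        qed
        finally show "norm (Jac G x *v u + Jac (lin_G G u) x *v h - (lin_G G u x - G xbar)) \<le> \<epsilon>1 * e * (1 + C0 * C)"
          by (simp add: algebra_simps)
      qed (use \<gamma> in auto)
      also have "\<dots> = \<epsilon>1 * K * e" by (simp add: K_def algebra_simps add_divide_distrib)
      also have "\<dots> = \<epsilon> * e" using K by (simp add: \<epsilon>1_def)
      finally show "norm (S x - V *v (x - xbar)) \<le> \<epsilon> * norm (x - xbar)" by (simp add: huele)
    qed
  qed
qed

text \<open>A face at \<open>x\<close> has the span of some face at \<open>xbar\<close>, so
  \<open>V\<close> and \<open>V'\<close> belong to systems with the same \<open>M\<close>. Inserting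
  \<open>V' h\<close> into the system at \<open>x\<close>, with \<open>m\<close> and
  \<open>e\<close> taken from the system at \<open>xbar\<close>, leaves differences of the data as
  residuals, apart from one term containing \<open>S x\<close>.\<close>

lemma TS_outer_semicontinuous:
  assumes C: "C > 0" and rbar: "regular C xbar" and \<epsilon>: "\<epsilon> > 0"
  shows "\<forall>\<^sub>F x in nhds xbar. regular C x \<longrightarrow> (\<forall>V\<in>TS_matrices F G D x.
     \<exists>V'\<in>TS_matrices F G D xbar. \<forall>h. norm (V' *v h - V *v h) \<le> \<epsilon> * norm h)"
proof -
  obtain C0 where C0: "C0 > 0"
    "\<And>x. x \<in> cball xbar 1 \<Longrightarrow> norm (f' x) \<le> C0 \<and> norm (g' x) \<le> C0 \<and> norm (g'' x) \<le> C0"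
    using uniform_bounds by metis
  define a where "a = C0 * (1 + norm lbar)"
  define g where "g = 1 / (\<gamma> / 2)"
  define K1 where "K1 = 2 * a + g * C0"
  define K2 where "K2 = g * (K1 + a)"
  define K where "K = 2 * (1 + (norm lbar + C) + C0 * C + K2) + (K1 + 1 + C0 * C) * g"
  have pos: "a > 0" "g > 0" using C0(1) \<gamma> by (auto simp: a_def g_def intro!: mult_pos_pos add_pos_nonneg)
  then have pos': "K1 > 0" "K2 > 0" using C0(1) by (auto simp: K1_def K2_def intro!: mult_pos_pos add_pos_pos)
  then have K: "K > 0" using pos C0(1) C unfolding K_def
    by (intro add_pos_pos mult_pos_pos add_pos_nonneg) auto
  define \<delta> where "\<delta> = \<epsilon> / K"
  have \<delta>: "\<delta> > 0" using \<epsilon> K by (simp add: \<delta>_def)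
  have xb: "xbar \<in> cball xbar 1" by simp
  show ?thesis
    using derivatives_near[OF \<delta>] eventually_norm_diff_less[OF \<delta>]
  proof eventually_elim
    case (elim x)
    show ?case
    proof (intro impI ballI)
      fix V assume r: "regular C x" and V: "V \<in> TS_matrices F G D x"
      obtain E where E: "cone_face (Kx x) E" "face_op x E V"
        using V by (rule TS_matricesE)
      let ?M = "orthogonal_comp (span E)"
      obtain E' where E': "cone_face (Kx xbar) E'" "span E' = span E"
        using regular_faces(2)[OF r E(1)] by (auto simp: regular_xbar[OF rbar])
      obtain V' where V': "V' \<in> TS_matrices F G D xbar" "face_op xbar E' V'"
        using TS_matrices_ex[OF rbar E'(1)] by blast
      define u l where ul: "u = S x" "l = Lam x"
      have ule: "norm u \<le> C * \<delta>" "norm (l - lbar) \<le> C * \<delta>" "norm l \<le> norm lbar + C"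
      proof -
        have *: "C * norm (x - xbar) \<le> C * \<delta>" "C * norm (x - xbar) \<le> C * 1"
          using elim regularD(1)[OF r] C by (auto intro!: mult_left_mono)
        show "norm u \<le> C * \<delta>" using regularD(5)[OF r] *(1) unfolding ul by (rule order_trans)
        show "norm (l - lbar) \<le> C * \<delta>" using regularD(6)[OF r] *(1) unfolding ul by (rule order_trans)
        show "norm l \<le> norm lbar + C"
          using regularD(6)[OF r] *(2) norm_triangle_ineq[of "l - lbar" lbar] unfolding ul by simp
      qed
      have "norm (V' *v h - V *v h) \<le> \<epsilon> * norm h" for h
      proof -
        define q n where qn: "q = V' *v h" "n = norm h"
        define abar where "abar = blinfun_apply (f' xbar) h + adj (blinfun_apply (g'' xbar) h) lbar"
        \<comment> \<open>No second-order term occurs here, since \<open>S xbar = 0\<close>.\<close>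
        define bbar where "bbar = blinfun_apply (g' xbar) h"
        have n: "n \<ge> 0" by (simp add: qn)
        have bl: "norm (blinfun_apply B h) \<le> c * n" if "norm B \<le> c" for B :: "(real^'n) \<Rightarrow>\<^sub>L 'z::real_normed_vector" and c
          using norm_blinfun[of B h] that unfolding qn by (meson mult_right_mono norm_ge_zero order_trans)
        have fd: "face_deriv (Jac G xbar) ?M abar bbar q"
          using V'(2) unfolding face_op_def E'(2) regular_xbar[OF rbar] dLag_mult Jac_lin_G_mult
          by (simp add: abar_def bbar_def qn blinfun.zero_right)
        obtain m where m: "m \<in> ?M" "q + abar = adj (g' xbar) m"
          and o: "\<And>w. w \<in> ?M \<Longrightarrow> inner w (Jac G xbar *v q + bbar) = 0"
          using fd by (auto simp: face_deriv_def transpose_Jac)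
        have sub: "?M \<subseteq> span Nbar" by (rule regular_face_span[OF r E(1)])
        have ab: "norm abar \<le> a * n" "norm bbar \<le> C0 * n"
        proof -
          have "norm (adj (blinfun_apply (g'' xbar) h) lbar) \<le> C0 * n * norm lbar"
            using norm_adj bl[of "g'' xbar" C0] C0(2)[OF xb] by (meson mult_right_mono norm_ge_zero order_trans)
          moreover have "norm (blinfun_apply (f' xbar) h) \<le> C0 * n" "norm bbar \<le> C0 * n"
            using bl C0(2)[OF xb] by (auto simp: bbar_def)
          ultimately show "norm abar \<le> a * n" "norm bbar \<le> C0 * n"
            unfolding abar_def a_def by (auto intro!: norm_triangle_le simp: algebra_simps)
        qed
        \<comment> \<open>Comparing the solution with \<open>0\<close> bounds it by the data; this
          gives \<open>K1\<close>.\<close>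
        have "norm (0 - q) \<le> 2 * norm (0 + abar - tr (Jac G xbar) *v 0)
            + norm (Jac G xbar *v 0 + bbar - 0) / (\<gamma> / 2)"
          by (rule face_deriv_stable[OF half_gt_zero[OF \<gamma>] regular_nondeg[OF rbar sub] subspace_orthogonal_comp fd])
             (auto simp: subspace_0 subspace_orthogonal_comp)
        then have "norm q \<le> 2 * norm abar + norm bbar * g" by (simp add: g_def)
        also have "\<dots> \<le> 2 * (a * n) + (C0 * n) * g"
          using ab pos by (intro add_mono mult_left_mono mult_right_mono) auto
        finally have q: "norm q \<le> K1 * n" by (simp add: K1_def algebra_simps)
        have "\<gamma> / 2 * norm m \<le> norm (q + abar)"
          using regularD(12)[OF rbar, of m] m sub by auto
        also have "\<dots> \<le> (K1 + a) * n"
          using q ab(1) norm_triangle_ineq[of q abar] by (simp add: algebra_simps)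
        finally have mb: "norm m \<le> K2 * n" using \<gamma> by (simp add: K2_def g_def field_simps)
        have "norm (q - V *v h) \<le>
            2 * norm (q + dLag F G l x *v h - tr (Jac G x) *v m)
            + norm (Jac G x *v q + Jac (lin_G G u) x *v h - (Jac G xbar *v q + bbar)) / (\<gamma> / 2)"
          by (rule face_deriv_stable[OF half_gt_zero[OF \<gamma>] regular_nondeg[OF r sub] subspace_orthogonal_comp _ m(1) o])
             (use E(2) in \<open>auto simp: face_op_def ul\<close>)
        also have "\<dots> \<le> 2 * (\<delta> * n * (1 + (norm lbar + C) + C0 * C + K2)) + \<delta> * n * (K1 + 1 + C0 * C) / (\<gamma> / 2)"
        proof (intro add_mono mult_left_mono divide_right_mono)
          have "q + dLag F G l x *v h - tr (Jac G x) *v m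
            = (blinfun_apply (f' x - f' xbar) h + adj (blinfun_apply (g'' x - g'' xbar) h) l)
              + (adj (blinfun_apply (g'' xbar) h) (l - lbar) - adj (g' x - g' xbar) m)"
            using m(2) by (simp add: dLag_mult transpose_Jac adj.diff_left adj.diff_right blinfun.diff_left
                abar_def algebra_simps)
          also have "norm \<dots> \<le> (\<delta> * n + \<delta> * n * (norm lbar + C)) + (C0 * n * (C * \<delta>) + \<delta> * (K2 * n))"
          proof (intro norm_triangle_le norm_triangle_le_diff add_mono)
            show "norm (blinfun_apply (f' x - f' xbar) h) \<le> \<delta> * n" using elim by (intro bl) auto
            have "norm (blinfun_apply (g'' x - g'' xbar) h) \<le> \<delta> * n" using elim by (intro bl) auto
            then show "norm (adj (blinfun_apply (g'' x - g'' xbar) h) l) \<le> \<delta> * n * (norm lbar + C)"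
              using norm_adj[of "blinfun_apply (g'' x - g'' xbar) h" l] ule(3) \<delta> n by (smt (verit) mult_mono norm_ge_zero)
            have "norm (blinfun_apply (g'' xbar) h) \<le> C0 * n" using C0(2)[OF xb] by (intro bl) auto
            then show "norm (adj (blinfun_apply (g'' xbar) h) (l - lbar)) \<le> C0 * n * (C * \<delta>)"
              using norm_adj[of "blinfun_apply (g'' xbar) h" "l - lbar"] ule(2) by (smt (verit) mult_mono norm_ge_zero)
            show "norm (adj (g' x - g' xbar) m) \<le> \<delta> * (K2 * n)"
              using norm_adj[of "g' x - g' xbar" m] mb elim by (smt (verit) mult_mono norm_ge_zero)
          qed
          finally show "norm (q + dLag F G l x *v h - tr (Jac G x) *v m)
             \<le> \<delta> * n * (1 + (norm lbar + C) + C0 * C + K2)" by (simp add: algebra_simps)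
          have "Jac G x *v q + Jac (lin_G G u) x *v h - (Jac G xbar *v q + bbar)
            = (blinfun_apply (g' x - g' xbar) q + blinfun_apply (g' x - g' xbar) h)
              + blinfun_apply (blinfun_apply (g'' x) h) u"
            by (simp add: Jac_G Jac_lin_G_mult bbar_def blinfun.diff_left algebra_simps)
          also have "norm \<dots> \<le> (\<delta> * (K1 * n) + \<delta> * n) + C0 * n * (C * \<delta>)"
          proof (intro norm_triangle_le add_mono)
            show "norm (blinfun_apply (g' x - g' xbar) q) \<le> \<delta> * (K1 * n)"
              using norm_blinfun[of "g' x - g' xbar" q] q elim by (smt (verit) mult_mono norm_ge_zero)
            show "norm (blinfun_apply (g' x - g' xbar) h) \<le> \<delta> * n" using elim by (intro bl) auto
            have "norm (blinfun_apply (g'' x) h) \<le> C0 * n" using C0(2)[OF regularD(2)[OF r]] by (intro bl) auto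
            then show "norm (blinfun_apply (blinfun_apply (g'' x) h) u) \<le> C0 * n * (C * \<delta>)"
              using norm_blinfun[of "blinfun_apply (g'' x) h" u] ule(1) by (smt (verit) mult_mono norm_ge_zero)
          qed
          finally show "norm (Jac G x *v q + Jac (lin_G G u) x *v h - (Jac G xbar *v q + bbar))
            \<le> \<delta> * n * (K1 + 1 + C0 * C)" by (simp add: algebra_simps)
        qed (use \<gamma> in auto)
        also have "\<dots> = \<delta> * K * n" by (simp add: K_def g_def algebra_simps add_divide_distrib)
        also have "\<dots> = \<epsilon> * n" using K by (simp add: \<delta>_def)
        finally show ?thesis by (simp add: qn)
      qed
      with V'(1) show "\<exists>V'\<in>TS_matrices F G D xbar. \<forall>h. norm (V' *v h - V *v h) \<le> \<epsilon> * norm h"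
        by blast
    qed
  qed
qed

section \<open>Algorithm A as a perturbed Newton method\<close>

text \<open>\<open>VA\<close> is the operator that Algorithm A inverts. It drops the second-order term of the
  linearized constraint in the matrix of \<open>T_S\<close> belonging to the smallest face; that term is of
  order \<open>\<parallel>S x\<parallel>\<close>.\<close>

lemma algA_operator:
  assumes r: "regular C x" and W: "cols_basis W (span (normal_cone D (lin_G G (S x) x)))"
    and C0: "norm (g'' x) \<le> C0"
  obtains VA where
    "\<And>h. face_deriv (Jac G x) (span (set W)) (dLag F G (Lam x) x *v h) (Jac G x *v h) (VA *v h)"
    "dist_le (Blinfun (\<lambda>h. VA *v h)) (T_S F G D x) (C0 / (\<gamma> / 2) * norm (S x))"
proof -
  let ?d = "lin_G G (S x) x"
  let ?N = "normal_cone D ?d"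
  let ?L = "dLag F G (Lam x) x"
  define E where "E = orthogonal_comp ?N"
  have E: "cone_face (Kx x) E"
    unfolding Kx_def E_def by (rule cone_face_lineality[OF D regularD(7,8)[OF r]])
  have W': "full_col_rank W" "span (set W) = span ?N" using W by (auto simp: cols_basis_def)
  have ME: "orthogonal_comp (span E) = span (set W)"
    using orthogonal_comp_self[of "span ?N"] by (simp add: E_def W'(2) orthogonal_comp_span)
  have nd: "norm (tr (Jac G x) *v w) \<ge> \<gamma> / 2 * norm w" if "w \<in> span (set W)" for w
    using regular_nondeg[OF r regular_face_span[OF r E]] that by (simp add: ME)
  obtain B where B: "inverse_mat_of (compress W (Jac G x ** tr (Jac G x))) B"
    using compress_gram_inverse_exists[OF W'(1) half_gt_zero[OF \<gamma>] nd] by blast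
  define VA where "VA = - ?L + tr (Jac G x) ** expand W B ** (Jac G x ** ?L - Jac G x)"
  have VA: "face_deriv (Jac G x) (span (set W)) (?L *v h) (Jac G x *v h) (VA *v h)" for h
    by (rule face_deriv_formula[OF B VA_def])
  obtain V where V: "V \<in> TS_matrices F G D x" "face_op x E V"
    using TS_matrices_ex[OF r E] by blast
  have "norm (V *v h - VA *v h) \<le> C0 / (\<gamma> / 2) * norm (S x) * norm h" for h
  proof -
    have "face_deriv (Jac G x) (span (set W)) (?L *v h) (Jac (lin_G G (S x)) x *v h) (V *v h)"
      using V(2) by (simp add: face_op_def ME)
    then obtain m where m: "m \<in> span (set W)" "V *v h + ?L *v h = tr (Jac G x) *v m"
      and o: "\<And>w. w \<in> span (set W) \<Longrightarrow> inner w (Jac G x *v (V *v h) + Jac (lin_G G (S x)) x *v h) = 0"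
      by (auto simp: face_deriv_def)
    \<comment> \<open>\<open>V h\<close> is inserted into the system of \<open>VA\<close> with
      multiplier and face component from its own system, so only the omitted term
      \<open>g'' x h (S x)\<close> remains.\<close>
    have "norm (V *v h - VA *v h) \<le>
        2 * norm (V *v h + ?L *v h - tr (Jac G x) *v m)
        + norm (Jac G x *v (V *v h) + Jac G x *v h - (Jac G x *v (V *v h) + Jac (lin_G G (S x)) x *v h)) / (\<gamma> / 2)"
      by (rule face_deriv_stable[OF half_gt_zero[OF \<gamma>] nd subspace_span VA m(1) o])
    also have "\<dots> = norm (blinfun_apply (blinfun_apply (g'' x) h) (S x)) / (\<gamma> / 2)"
      by (simp add: m(2) Jac_G Jac_lin_G_mult)
    also have "\<dots> \<le> (C0 * norm h * norm (S x)) / (\<gamma> / 2)"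
    proof (intro divide_right_mono)
      have "norm (blinfun_apply (g'' x) h) \<le> C0 * norm h"
        using norm_blinfun[of "g'' x" h] C0 by (meson mult_right_mono norm_ge_zero order_trans)
      then show "norm (blinfun_apply (blinfun_apply (g'' x) h) (S x)) \<le> C0 * norm h * norm (S x)"
        using norm_blinfun[of "blinfun_apply (g'' x) h" "S x"] by (meson mult_right_mono norm_ge_zero order_trans)
    qed (use \<gamma> in simp)
    finally show ?thesis by (simp add: mult_ac)
  qed
  moreover have "0 \<le> C0 / (\<gamma> / 2) * norm (S x)"
    using order_trans[OF norm_ge_zero C0] \<gamma> by simp
  ultimately have "norm (Blinfun (\<lambda>h. VA *v h) - Blinfun (\<lambda>h. V *v h)) \<le> C0 / (\<gamma> / 2) * norm (S x)"
    by (intro norm_blinfun_bound) (auto simp: blinfun.diff_left blinfun_of_matrix norm_minus_commute)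
  moreover have "Blinfun (\<lambda>h. V *v h) \<in> T_S F G D x"
    using V(1) by (simp add: T_S_def)
  ultimately have "dist_le (Blinfun (\<lambda>h. VA *v h)) (T_S F G D x) (C0 / (\<gamma> / 2) * norm (S x))"
    unfolding dist_le_def by (auto simp: dist_norm intro: infdist_le2)
  with VA show thesis by (rule that)
qed

lemma Lag_regular:
  assumes "regular C x"
  shows "Lag F G (Lam x) x = - S x"
  using regularD(9)[OF assms] by (simp add: Lag_def grad_G eq_neg_iff_add_eq_0 add_ac)

text \<open>The kernel of \<open>W^T A\<close> and the range of \<open>A^T W\<close> are orthogonal
  complements. Thus the equation multiplied by \<open>Z^T\<close> says that a multiplier in
  \<open>span (set W)\<close> exists, and \<open>Z\<close> is eliminated.\<close>

lemma mem_image_transpose_iff: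
  assumes Z: "span (set Z) = {v. \<forall>w\<in>set W. inner w (Jac G x *v v) = 0}"
  shows "(\<forall>z\<in>set Z. inner z r = 0) \<longleftrightarrow> (\<exists>m\<in>span (set W). r = tr (Jac G x) *v m)"
proof -
  let ?R = "(*v) (tr (Jac G x)) ` span (set W)"
  have sub: "subspace ?R" by (intro linear_subspace_image subspace_span) simp
  have "span (set Z) = orthogonal_comp ?R"
  proof (intro equalityI subsetI)
    fix v assume "v \<in> span (set Z)"
    then have v: "\<And>w. w \<in> set W \<Longrightarrow> inner w (Jac G x *v v) = 0" by (simp add: Z)
    have "inner w (Jac G x *v v) = 0" if "w \<in> span (set W)" for w
      using that by (induction rule: span_induct_alt) (auto simp: inner_add_left v)
    then show "v \<in> orthogonal_comp ?R"
      by (auto simp: orthogonal_comp_def Linear_Algebra.orthogonal_def inner_transpose_mult)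
  next
    fix v assume "v \<in> orthogonal_comp ?R"
    then show "v \<in> span (set Z)"
      by (auto simp: Z orthogonal_comp_def Linear_Algebra.orthogonal_def inner_transpose_mult span_base)
  qed
  then have "?R = orthogonal_comp (set Z)"
    using orthogonal_comp_self[OF sub] orthogonal_comp_span[of "set Z"] by simp
  then show ?thesis
    by (auto simp: orthogonal_comp_def Linear_Algebra.orthogonal_def set_eq_iff image_iff)
qed

text \<open>Since the Lagrangian at \<open>x\<close> equals \<open>- S x\<close>, the two equations
  of the algorithm say that \<open>- S x\<close> solves the reduced system for
  \<open>\<Delta>\<close>; uniqueness identifies it with \<open>VA \<Delta>\<close>.\<close>

lemma algA_newton_system:
  assumes r: "regular C x" and W: "cols_basis W (span (normal_cone D (lin_G G (S x) x)))"
    and Z: "span (set Z) = {v. \<forall>w\<in>set W. inner w (Jac G x *v v) = 0}"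
    and VA: "\<And>h. face_deriv (Jac G x) (span (set W)) (dLag F G (Lam x) x *v h) (Jac G x *v h) (VA *v h)"
  shows "(\<forall>z\<in>set Z. inner z (dLag F G (Lam x) x *v \<Delta> + Lag F G (Lam x) x) = 0) \<and>
         (\<forall>w\<in>set W. inner w (G x + Jac G x *v \<Delta> - lin_G G (S x) x) = 0) \<longleftrightarrow> VA *v \<Delta> = - S x"
proof -
  have sub: "span (set W) \<subseteq> span Nbar"
    using W span_mono[OF regularD(10)[OF r]] by (simp add: cols_basis_def)
  have "(\<forall>w\<in>set W. inner w (G x + Jac G x *v \<Delta> - lin_G G (S x) x) = 0)
      \<longleftrightarrow> (\<forall>w\<in>span (set W). inner w (Jac G x *v (- S x) + Jac G x *v \<Delta>) = 0)" (is "?l \<longleftrightarrow> ?r")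
  proof
    assume ?l
    have eq: "G x + Jac G x *v \<Delta> - lin_G G (S x) x = Jac G x *v (- S x) + Jac G x *v \<Delta>"
      by (simp add: lin_G_def Jac_G blinfun.minus_right)
    have "inner w (Jac G x *v (- S x) + Jac G x *v \<Delta>) = 0" if "w \<in> span (set W)" for w
      using that by (induction rule: span_induct_alt) (use \<open>?l\<close> in \<open>auto simp: inner_add_left eq\<close>)
    then show ?r by blast
  next
    assume ?r
    then show ?l by (auto simp: lin_G_def Jac_G blinfun.minus_right algebra_simps dest!: bspec[OF _ span_base])
  qed
  then have "(\<forall>z\<in>set Z. inner z (dLag F G (Lam x) x *v \<Delta> + Lag F G (Lam x) x) = 0) \<and>
         (\<forall>w\<in>set W. inner w (G x + Jac G x *v \<Delta> - lin_G G (S x) x) = 0) \<longleftrightarrow>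
      face_deriv (Jac G x) (span (set W)) (dLag F G (Lam x) x *v \<Delta>) (Jac G x *v \<Delta>) (- S x)"
    unfolding mem_image_transpose_iff[OF Z] face_deriv_def Lag_regular[OF r] by (simp add: add.commute)
  also have "\<dots> \<longleftrightarrow> VA *v \<Delta> = - S x"
    using face_deriv_unique[OF half_gt_zero[OF \<gamma>] regular_nondeg[OF r sub] subspace_span VA] VA by metis
  finally show ?thesis .
qed

lemma approx_step_regular:
  assumes "regular C x"
  shows "approx_step F G D x u l \<longleftrightarrow> u = S x \<and> l = Lam x"
  using regularD(3)[OF assms, of u] regularD(4)[OF assms, of l] by (auto simp: approx_step_def)

lemma algA_imp_algB:
  assumes r: "regular C x" and C0: "norm (g'' x) \<le> C0" and st: "algA_step F G D x y"
  shows "algB_step F G D (C0 / (\<gamma> / 2)) x y"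
proof -
  obtain W Z \<Delta> where *: "cols_basis W (span (normal_cone D (lin_G G (S x) x)))"
    "cols_orth_basis Z {v. \<forall>w\<in>set W. inner w (Jac G x *v v) = 0}"
    "\<forall>z\<in>set Z. inner z (dLag F G (Lam x) x *v \<Delta> + Lag F G (Lam x) x) = 0"
    "\<forall>w\<in>set W. inner w (G x + Jac G x *v \<Delta> - lin_G G (S x) x) = 0" "y = x + \<Delta>"
    using st unfolding algA_step_def by (auto simp: approx_step_regular[OF r])
  obtain VA where VA: "\<And>h. face_deriv (Jac G x) (span (set W)) (dLag F G (Lam x) x *v h) (Jac G x *v h) (VA *v h)"
    "dist_le (Blinfun (\<lambda>h. VA *v h)) (T_S F G D x) (C0 / (\<gamma> / 2) * norm (S x))"
    by (rule algA_operator[OF r *(1) C0]) (rule that)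
  have "VA *v \<Delta> = - S x"
    using algA_newton_system[OF r *(1) _ VA(1)] * by (auto simp: cols_orth_basis_def cols_basis_def)
  then show ?thesis
    using VA(2) *(5) unfolding algB_step_def approx_step_regular[OF r]
    by (intro exI[of _ "S x"] exI[of _ "Lam x"] exI[of _ "Blinfun (\<lambda>h. VA *v h)"] exI[of _ \<Delta>])
       (simp add: blinfun_of_matrix)
qed

text \<open>The operator \<open>VA\<close> is admissible, so \<open>inj\<close> makes it injective
  and hence surjective. The prescribed column numbers hold because \<open>lin\<close> of the tangent
  cone is the complement of the normal cone, and because nondegeneracy gives \<open>W^T A\<close>
  full row rank.\<close>

lemma algA_step_exists:
  assumes r: "regular C x" and C0: "norm (g'' x) \<le> C0" and c: "c > 0"
    and inj: "\<And>V h. dist_le V (T_S F G D x) (C0 / (\<gamma> / 2) * norm (S x)) \<Longrightarrow> c * norm h \<le> norm (blinfun_apply V h)"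
  shows "\<exists>y. algA_step F G D x y"
proof -
  let ?d = "lin_G G (S x) x"
  let ?N = "normal_cone D ?d"
  obtain W where W: "cols_basis W (span ?N)" using cols_basis_exists[OF subspace_span] by blast
  then have W': "full_col_rank W" "span (set W) = span ?N" by (auto simp: cols_basis_def)
  let ?U = "{v. \<forall>w\<in>set W. inner w (Jac G x *v v) = 0}"
  let ?At = "\<lambda>m. tr (Jac G x) *v m"
  have U: "?U = orthogonal_comp (?At ` set W)"
    by (auto simp: orthogonal_comp_def Linear_Algebra.orthogonal_def inner_transpose_mult)
  obtain Z where Z: "cols_orth_basis Z ?U"
    using cols_orth_basis_exists[OF subspace_orthogonal_comp[of "?At ` set W"]] unfolding U by blast
  then have Z': "full_col_rank Z" "span (set Z) = ?U" by (auto simp: cols_orth_basis_def cols_basis_def)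
  have lenW: "length W + dim (lin (tangent_cone D ?d)) = CARD('s)"
    using dim_orthogonal_comp[of ?N] full_col_rank_length[OF W'(1)]
    by (simp add: lin_tangent_cone[OF D regularD(7)[OF r]] W'(2) dim_span)
  have lin: "linear ?At" by simp
  have "inj_on ?At (span (set W))"
  proof (rule inj_onI)
    fix a b assume ab: "a \<in> span (set W)" "b \<in> span (set W)" "?At a = ?At b"
    then have "a - b \<in> span Nbar"
      using span_mono[OF regularD(10)[OF r]] by (auto simp: W'(2) intro!: span_diff)
    then have "\<gamma> / 2 * norm (a - b) \<le> norm (?At (a - b))"
      using regular_nondeg[OF r order_refl] by blast
    then show "a = b" using ab(3) \<gamma> by (simp add: matrix_vector_mult_diff_distrib mult_le_0_iff)
  qed
  then have "dim (?At ` set W) = length W"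
    using dim_image_eq[OF lin, of "set W"] full_col_rank_length[OF W'(1)] by (simp add: dim_span)
  then have lenZ: "length Z + length W = CARD('n)"
    using dim_orthogonal_comp[of "?At ` set W"] full_col_rank_length[OF Z'(1)] by (simp add: Z'(2) U)
  obtain VA where VA: "\<And>h. face_deriv (Jac G x) (span (set W)) (dLag F G (Lam x) x *v h) (Jac G x *v h) (VA *v h)"
    "dist_le (Blinfun (\<lambda>h. VA *v h)) (T_S F G D x) (C0 / (\<gamma> / 2) * norm (S x))"
    by (rule algA_operator[OF r W C0]) (rule that)
  have "VA *v h = 0 \<Longrightarrow> h = 0" for h
    using inj[OF VA(2), of h] c by (simp add: blinfun_of_matrix mult_le_0_iff)
  then have "inj ((*v) VA)" by (simp add: linear_injective_0)
  then have "surj ((*v) VA)" by (intro linear_injective_imp_surjective) simp_all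
  then obtain \<Delta> where "VA *v \<Delta> = - S x" by (metis surjD)
  then have "(\<forall>z\<in>set Z. inner z (dLag F G (Lam x) x *v \<Delta> + Lag F G (Lam x) x) = 0) \<and>
         (\<forall>w\<in>set W. inner w (G x + Jac G x *v \<Delta> - ?d) = 0)"
    using algA_newton_system[OF r W Z'(2) VA(1)] by blast
  then have "algA_step F G D x (x + \<Delta>)"
    unfolding algA_step_def approx_step_regular[OF r]
    using W Z lenW lenZ by blast
  then show ?thesis by blast
qed

section \<open>Convergence\<close>

lemma S_zero_iff:
  assumes r: "regular C x"
  shows "S x = 0 \<longleftrightarrow> solves_ge F G D x"
proof
  assume "S x = 0"
  then show "solves_ge F G D x"
    using regularD(8,9)[OF r] by (auto simp: solves_ge_def lin_G_def grad_G image_iff intro!: bexI[of _ "Lam x"])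
next
  assume "solves_ge F G D x"
  then obtain l where l: "l \<in> normal_cone D (G x)" "F x + grad G x *v l = 0"
    by (auto simp: solves_ge_def)
  then have "qp_multiplier F G D x 0 l" by (simp add: qp_multiplier_def lin_G_def)
  then show "S x = 0"
    using qp_multiplier_imp_solution[OF D] regularD(3)[OF r] by metis
qed

lemma algB_iff_gss:
  assumes r: "regular C x" and x: "x \<in> \<Omega>"
  shows "algB_step F G D \<rho> x y \<longleftrightarrow> gss_newton_step \<Omega> S (T_S F G D) \<rho> x y"
  unfolding algB_step_def gss_newton_step_def approx_step_regular[OF r]
  using x by (auto simp: eq_neg_iff_add_eq_0)

text \<open>If \<open>V h = 0\<close>, the system says \<open>A h \<in> span E\<close> and
  \<open>L' h \<in> A^T M\<close>. The first puts \<open>h\<close> in the range of \<open>Z\<close>;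
  the second makes \<open>L' h\<close> orthogonal to the columns of \<open>Z\<close>, which
  \<open>A\<close> maps into \<open>span E\<close>.\<close>

lemma TS_matrix_injective:
  assumes r: "regular C xbar"
    and faces: "\<And>E. cone_face (critical_cone D (G xbar) lbar) E \<Longrightarrow>
        \<exists>Z. cols_orth_basis Z {u. Jac G xbar *v u \<in> span E} \<and>
            invertible_mat (compress Z (dLag F G lbar xbar))"
    and V: "V \<in> TS_matrices F G D xbar" and h: "V *v h = 0"
  shows "h = 0"
proof -
  obtain E where E: "cone_face (Kx xbar) E" "face_op xbar E V"
    using V by (rule TS_matricesE)
  obtain Z where Z: "cols_orth_basis Z {u. Jac G xbar *v u \<in> span E}"
    "invertible_mat (compress Z (dLag F G lbar xbar))"
    using faces E(1) by (auto simp: regular_xbar[OF r])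
  have Z': "distinct Z" "span (set Z) = {u. Jac G xbar *v u \<in> span E}"
    using Z(1) by (auto simp: cols_orth_basis_def cols_basis_def full_col_rank_def)
  have "face_deriv (Jac G xbar) (orthogonal_comp (span E)) (dLag F G lbar xbar *v h) (Jac G xbar *v h) 0"
    using E(2) h unfolding face_op_def regular_xbar[OF r]
    by (metis Jac_lin_G_mult Jac_G add.right_neutral blinfun.zero_right)
  then obtain m where m: "m \<in> orthogonal_comp (span E)"
      "dLag F G lbar xbar *v h = tr (Jac G xbar) *v m"
    and o: "\<And>w. w \<in> orthogonal_comp (span E) \<Longrightarrow> inner w (Jac G xbar *v h) = 0"
    by (auto simp: face_deriv_def)
  have "Jac G xbar *v h \<in> orthogonal_comp (orthogonal_comp (span E))"
    using o by (simp add: orthogonal_comp_def Linear_Algebra.orthogonal_def)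
  then have "h \<in> span (set Z)"
    by (simp add: Z'(2) orthogonal_comp_self)
  moreover have "inner z (dLag F G lbar xbar *v h) = 0" if "z \<in> set Z" for z
  proof -
    have "Jac G xbar *v z \<in> span E" using that Z'(2) span_base by blast
    then have "inner (Jac G xbar *v z) m = 0"
      using m(1) by (simp add: orthogonal_comp_def Linear_Algebra.orthogonal_def)
    then show ?thesis
      by (simp add: m(2) inner_commute[of z] inner_transpose_mult inner_commute[of m])
  qed
  ultimately show ?thesis
    by (rule compress_invertible_kernel[OF Z(2) Z'(1)])
qed

lemma gss_hyps:
  assumes C: "C > 0" and \<omega>: "\<omega> > 0" and reg: "\<And>x. x \<in> cball xbar \<omega> \<Longrightarrow> regular C x"
    and faces: "\<And>E. cone_face (critical_cone D (G xbar) lbar) E \<Longrightarrow>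
        \<exists>Z. cols_orth_basis Z {u. Jac G xbar *v u \<in> span E} \<and>
            invertible_mat (compress Z (dLag F G lbar xbar))"
  shows "gss_newton_hyps (ball xbar \<omega>) S (T_S F G D) xbar"
  unfolding gss_newton_hyps_def
proof (intro conjI ballI)
  have rbar: "regular C xbar" using \<omega> by (intro reg) simp
  show "xbar \<in> ball xbar \<omega>" "open (ball xbar \<omega>)" using \<omega> by auto
  show "S xbar = 0" by (rule regular_xbar[OF rbar])
  obtain L where L: "L \<ge> 0" "\<And>x y. regular C x \<Longrightarrow> regular C y \<Longrightarrow> norm (S x - S y) \<le> L * norm (x - y)"
    using S_lipschitz[OF C] by blast
  have lip: "L-lipschitz_on (ball xbar \<omega>) S"
    using L reg by (auto simp: lipschitz_on_def dist_norm)
  show "locally_lipschitz_on (ball xbar \<omega>) S"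
    unfolding locally_lipschitz_on_def
    by (intro ballI exI[of _ 1] conjI exI[of _ L] lipschitz_on_subset[OF lip]) auto
  show "compact (T_S F G D x)" if "x \<in> ball xbar \<omega>" for x
    unfolding T_S_def using finite_TS_matrices[OF reg] that by (intro finite_imp_compact) auto
  show "G_semismooth_at (ball xbar \<omega>) S (T_S F G D) xbar"
    unfolding G_semismooth_at_def
  proof (intro conjI allI impI)
    show "continuous_on (ball xbar \<omega>) S" using lip by (rule lipschitz_on_continuous_on)
    fix \<epsilon> :: real assume "\<epsilon> > 0"
    from S_semismooth[OF C this] obtain \<delta> where \<delta>: "\<delta> > 0"
      "\<And>x V. dist x xbar < \<delta> \<Longrightarrow> regular C x \<Longrightarrow> V \<in> TS_matrices F G D x \<Longrightarrow>
         norm (S x - V *v (x - xbar)) \<le> \<epsilon> * norm (x - xbar)"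
      by (auto simp: eventually_nhds_metric)
    have "norm (S (xbar + h) - S xbar - blinfun_apply V h) \<le> \<epsilon> * norm h"
      if h: "norm h \<le> \<delta> / 2" "xbar + h \<in> ball xbar \<omega>" and V: "V \<in> T_S F G D (xbar + h)" for h V
    proof -
      obtain V0 where V0: "V0 \<in> TS_matrices F G D (xbar + h)" "V = Blinfun (\<lambda>h. V0 *v h)"
        using V by (auto simp: T_S_def)
      have "norm (S (xbar + h) - V0 *v (xbar + h - xbar)) \<le> \<epsilon> * norm (xbar + h - xbar)"
        using h \<delta>(1) reg by (intro \<delta>(2) V0(1)) (auto simp: dist_norm)
      then show ?thesis by (simp add: V0(2) blinfun_of_matrix regular_xbar[OF rbar])
    qed
    then show "\<exists>\<delta>>0. \<forall>h. norm h \<le> \<delta> \<and> xbar + h \<in> ball xbar \<omega> \<longrightarrow>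
        (\<forall>V\<in>T_S F G D (xbar + h). norm (S (xbar + h) - S xbar - blinfun_apply V h) \<le> \<epsilon> * norm h)"
      using \<delta>(1) by (intro exI[of _ "\<delta> / 2"]) auto
  qed
  show "outer_semicont_at (ball xbar \<omega>) (T_S F G D) xbar"
    unfolding outer_semicont_at_def
  proof (intro allI impI)
    fix \<epsilon> :: real assume \<epsilon>: "\<epsilon> > 0"
    from TS_outer_semicontinuous[OF C rbar this] obtain \<delta> where \<delta>: "\<delta> > 0"
      "\<And>x V. dist x xbar < \<delta> \<Longrightarrow> regular C x \<Longrightarrow> V \<in> TS_matrices F G D x \<Longrightarrow>
         \<exists>V'\<in>TS_matrices F G D xbar. \<forall>h. norm (V' *v h - V *v h) \<le> \<epsilon> * norm h"
      by (auto simp: eventually_nhds_metric)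
    have "V \<in> (\<Union>V\<in>T_S F G D xbar. cball V \<epsilon>)"
      if x: "x \<in> ball xbar \<omega>" "norm (x - xbar) \<le> \<delta> / 2" and V: "V \<in> T_S F G D x" for x V
    proof -
      obtain V0 where V0: "V0 \<in> TS_matrices F G D x" "V = Blinfun (\<lambda>h. V0 *v h)"
        using V by (auto simp: T_S_def)
      have "regular C x" using x(1) by (intro reg) simp
      then obtain V' where V': "V' \<in> TS_matrices F G D xbar"
        "\<And>h. norm (V' *v h - V0 *v h) \<le> \<epsilon> * norm h"
        using \<delta>(2)[of x V0] \<delta>(1) x(2) V0(1) by (force simp: dist_norm)
      have "norm (Blinfun (\<lambda>h. V' *v h) - V) \<le> \<epsilon>"
        using V'(2) \<epsilon> by (intro norm_blinfun_bound) (auto simp: V0(2) blinfun.diff_left blinfun_of_matrix)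
      then have "V \<in> cball (Blinfun (\<lambda>h. V' *v h)) \<epsilon>" by (simp add: dist_norm)
      moreover have "Blinfun (\<lambda>h. V' *v h) \<in> T_S F G D xbar" using V'(1) by (simp add: T_S_def)
      ultimately show ?thesis by blast
    qed
    then show "\<exists>\<delta>>0. \<forall>x'\<in>ball xbar \<omega>. norm (x' - xbar) \<le> \<delta> \<longrightarrow>
        T_S F G D x' \<subseteq> (\<Union>V\<in>T_S F G D xbar. cball V \<epsilon>)"
      using \<delta>(1) by (intro exI[of _ "\<delta> / 2"]) auto
  qed
  fix V assume "V \<in> T_S F G D xbar"
  then obtain V0 where V0: "V0 \<in> TS_matrices F G D xbar" "V = Blinfun (\<lambda>h. V0 *v h)"
    by (auto simp: T_S_def)
  have "inj ((*v) V0)"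
    using TS_matrix_injective[OF rbar faces V0(1)] by (simp add: linear_injective_0)
  then obtain B where B: "B ** V0 = Finite_Cartesian_Product.mat 1"
    using matrix_left_invertible_injective by blast
  then have "V0 ** B = Finite_Cartesian_Product.mat 1" by (simp add: matrix_left_right_inverse)
  with B have "V0 *v (B *v h) = h" "B *v (V0 *v h) = h" for h
    by (simp_all add: matrix_vector_mul_assoc)
  then show "\<exists>V'. V o\<^sub>L V' = id_blinfun \<and> V' o\<^sub>L V = id_blinfun"
    by (intro exI[of _ "Blinfun (\<lambda>h. B *v h)"] conjI blinfun_eqI) (simp_all add: V0(2) blinfun_of_matrix)
qed

lemma convergence:
  assumes faces: "\<And>E. cone_face (critical_cone D (G xbar) lbar) E \<Longrightarrow>
        \<exists>Z. cols_orth_basis Z {u. Jac G xbar *v u \<in> span E} \<and>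
            invertible_mat (compress Z (dLag F G lbar xbar))"
  shows "\<exists>\<omega>>0.
     (\<forall>x\<in>cball xbar \<omega>.
        (\<exists>!u. qp_solution F G D x u) \<and>
        (\<exists>!l. qp_multiplier F G D x (S_map F G D x) l) \<and>
        T_S F G D x \<noteq> {} \<and>
        (S_map F G D x = 0 \<longleftrightarrow> solves_ge F G D x)) \<and>
     gss_newton_hyps (ball xbar \<omega>) (S_map F G D) (T_S F G D) xbar \<and>
     (\<forall>\<rho>\<ge>0. \<forall>x\<in>ball xbar \<omega>. \<forall>x'.
        algB_step F G D \<rho> x x' \<longleftrightarrow>
        gss_newton_step (ball xbar \<omega>) (S_map F G D) (T_S F G D) \<rho> x x') \<and>
     (\<exists>\<rho>\<ge>0. \<forall>x\<in>ball xbar \<omega>. \<forall>x'. algA_step F G D x x' \<longrightarrow> algB_step F G D \<rho> x x') \<and>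
     locally_superlinear (solves_ge F G D) (algA_step F G D) xbar"
proof -
  obtain C where C: "C > 0" "\<forall>\<^sub>F x in nhds xbar. regular C x" using regular_near .
  then obtain r where r: "r > 0" "\<And>x. dist x xbar < r \<Longrightarrow> regular C x"
    by (auto simp: eventually_nhds_metric)
  define \<omega> where "\<omega> = r / 2"
  have \<omega>: "\<omega> > 0" using r(1) by (simp add: \<omega>_def)
  have reg: "regular C x" if "x \<in> cball xbar \<omega>" for x
    using that r by (intro r(2)) (auto simp: \<omega>_def dist_commute)
  obtain C0 where C0: "C0 > 0" "\<And>x. x \<in> cball xbar 1 \<Longrightarrow> norm (g'' x) \<le> C0"
    using uniform_bounds by metis
  have g'': "norm (g'' x) \<le> C0" if "regular C x" for x
    using C0(2) regularD(2)[OF that] by blast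
  define \<rho> where "\<rho> = C0 / (\<gamma> / 2)"
  have \<rho>: "\<rho> \<ge> 0" using C0(1) \<gamma> by (simp add: \<rho>_def)
  note hyps = gss_hyps[OF C(1) \<omega> reg faces]
  have AB: "algB_step F G D \<rho> x y" if "x \<in> ball xbar \<omega>" "algA_step F G D x y" for x y
    unfolding \<rho>_def using algA_imp_algB[OF _ g'' that(2)] reg[of x] that(1) by auto
  have BG: "algB_step F G D \<rho> x y \<longleftrightarrow> gss_newton_step (ball xbar \<omega>) S (T_S F G D) \<rho> x y"
    if "x \<in> ball xbar \<omega>" for x y \<rho>
    using algB_iff_gss[OF reg that] that by simp
  have "locally_superlinear (solves_ge F G D) (algA_step F G D) xbar"
  proof (rule locally_superlinearI)
    fix \<epsilon> :: real assume "\<epsilon> > 0"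
    from gss_newton_contraction[OF hyps \<rho> this] obtain \<delta> where \<delta>: "\<delta> > 0"
      "\<And>x y. norm (x - xbar) < \<delta> \<Longrightarrow> gss_newton_step (ball xbar \<omega>) S (T_S F G D) \<rho> x y \<Longrightarrow>
        norm (y - xbar) \<le> \<epsilon> * norm (x - xbar)" by blast
    then show "\<exists>\<delta>>0. \<forall>x y. norm (x - xbar) < \<delta> \<longrightarrow> algA_step F G D x y \<longrightarrow>
        norm (y - xbar) \<le> \<epsilon> * norm (x - xbar)"
      using \<omega> AB BG by (intro exI[of _ "min \<delta> \<omega>"]) (auto simp: dist_norm norm_minus_commute)
  next
    \<comment> \<open>Continuation of a run needs the uniform lower bound, not the contraction: it
      makes the linear system of Algorithm A solvable.\<close>
    obtain c where c: "c > 0"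
      "\<And>\<epsilon>. \<epsilon> > 0 \<Longrightarrow> \<exists>\<delta>>0. \<forall>x. norm (x - xbar) < \<delta> \<longrightarrow> x \<in> ball xbar \<omega> \<and>
       (\<forall>V. dist_le V (T_S F G D x) (\<rho> * norm (S x)) \<longrightarrow>
          (\<forall>h. c * norm h \<le> norm (blinfun_apply V h)) \<and>
          norm (S x - blinfun_apply V (x - xbar)) \<le> \<epsilon> * norm (x - xbar))"
      using gss_newton_local[OF hyps \<rho>] by blast
    obtain \<delta> where \<delta>: "\<delta> > 0" "\<And>x. norm (x - xbar) < \<delta> \<Longrightarrow> x \<in> ball xbar \<omega>"
       "\<And>x V h. norm (x - xbar) < \<delta> \<Longrightarrow> dist_le V (T_S F G D x) (\<rho> * norm (S x)) \<Longrightarrow>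
          c * norm h \<le> norm (blinfun_apply V h)"
      using c(2)[of 1] by auto
    have "\<exists>y. algA_step F G D x y" if x: "norm (x - xbar) < \<delta>" for x
    proof -
      have rx: "regular C x" using \<delta>(2)[OF x] by (intro reg) simp
      show ?thesis
        using algA_step_exists[OF rx g''[OF rx] c(1)] \<delta>(3)[OF x] by (simp add: \<rho>_def)
    qed
    then show "\<exists>\<delta>>0. \<forall>x. norm (x - xbar) < \<delta> \<longrightarrow> \<not> solves_ge F G D x \<longrightarrow> (\<exists>y. algA_step F G D x y)"
      using \<delta>(1) by blast
  qed
  moreover have "(\<exists>!u. qp_solution F G D x u) \<and> (\<exists>!l. qp_multiplier F G D x (S x) l) \<and>
        T_S F G D x \<noteq> {} \<and> (S x = 0 \<longleftrightarrow> solves_ge F G D x)" if "x \<in> cball xbar \<omega>" for x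
  proof (intro conjI)
    note r = reg[OF that]
    show "\<exists>!u. qp_solution F G D x u" by (simp add: regularD(3)[OF r])
    show "\<exists>!l. qp_multiplier F G D x (S x) l" by (simp add: regularD(4)[OF r])
    show "T_S F G D x \<noteq> {}" using TS_matrices_nonempty[OF r] by (simp add: T_S_def)
    show "S x = 0 \<longleftrightarrow> solves_ge F G D x" by (rule S_zero_iff[OF r])
  qed
  moreover have "\<exists>\<rho>\<ge>0. \<forall>x\<in>ball xbar \<omega>. \<forall>x'. algA_step F G D x x' \<longrightarrow> algB_step F G D \<rho> x x'"
    using AB \<rho> by blast
  ultimately show ?thesis
    using \<omega> hyps BG by - (rule exI[of _ \<omega>], intro conjI; blast)
qed

end

text \<open>Being an instance is expressed on one common ball, with one \<open>\<rho>\<close> for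
  all points and all choices of \<open>W\<close> and \<open>Z\<close>. The uniqueness clauses ensure
  that \<open>S_map\<close> and \<open>Lambda_map\<close> are not arbitrary values of a description,
  and nonemptiness of \<open>T_S\<close> lets the distance condition be satisfied.\<close>

theorem theorem4p1:
  fixes F :: "real^'n \<Rightarrow> real^'n"
    and G :: "real^'n \<Rightarrow> real^'s"
    and D :: "(real^'s) set"
    and xbar :: "real^'n"
    and lbar :: "real^'s"
    and \<gamma> :: real
  assumes F_C1: "cont_diff F"
    and G_C2: "twice_cont_diff G"
    and D_polyhedral: "polyhedron D"
    and xbar_solution: "solves_ge F G D xbar"
    and nondeg: "nondegenerate G D \<gamma> xbar (G xbar)"
    and lbar_multiplier: "lbar \<in> normal_cone D (G xbar)" "Lag F G lbar xbar = 0"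
    and faces: "\<And>E. cone_face (critical_cone D (G xbar) lbar) E \<Longrightarrow>
        \<exists>Z. cols_orth_basis Z {u. Jac G xbar *v u \<in> span E} \<and>
            invertible_mat (compress Z (dLag F G lbar xbar))"
  shows "\<exists>\<omega>>0.
     (\<forall>x\<in>cball xbar \<omega>.
        (\<exists>!u. qp_solution F G D x u) \<and>
        (\<exists>!l. qp_multiplier F G D x (S_map F G D x) l) \<and>
        T_S F G D x \<noteq> {} \<and>
        (S_map F G D x = 0 \<longleftrightarrow> solves_ge F G D x)) \<and>
     gss_newton_hyps (ball xbar \<omega>) (S_map F G D) (T_S F G D) xbar \<and>
     (\<forall>\<rho>\<ge>0. \<forall>x\<in>ball xbar \<omega>. \<forall>x'.
        algB_step F G D \<rho> x x' \<longleftrightarrow>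
        gss_newton_step (ball xbar \<omega>) (S_map F G D) (T_S F G D) \<rho> x x') \<and>
     (\<exists>\<rho>\<ge>0. \<forall>x\<in>ball xbar \<omega>. \<forall>x'. algA_step F G D x x' \<longrightarrow> algB_step F G D \<rho> x x') \<and>
     locally_superlinear (solves_ge F G D) (algA_step F G D) xbar"
proof -
  obtain f' where f': "\<And>x. (F has_derivative blinfun_apply (f' x)) (at x)" "continuous_on UNIV f'"
    using F_C1 by (auto simp: cont_diff_def)
  obtain g' g'' where g': "\<And>x. (G has_derivative blinfun_apply (g' x)) (at x)"
    and g'': "\<And>x. (g' has_derivative blinfun_apply (g'' x)) (at x)" "continuous_on UNIV g''"
    using G_C2 by (auto simp: twice_cont_diff_def cont_diff_def)
  interpret ge_problem F G f' g' g'' xbar D lbar \<gamma>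
    by unfold_locales (fact f' g' g'' D_polyhedral nondeg lbar_multiplier)+
  show ?thesis using faces by (rule convergence)
qed

end
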